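(* Let $d\in\{1,2,3\}$, $\omega_0>0$, $k_0=\omega_0/c$, let $\bm\mu_\imath,\bm\mu_\jmath\in\mathbb{R}^3$ be dipole vectors, and let $\bm r_{\imath\jmath}\in\mathbb{R}^d$ with $\bm r_{\imath\jmath}\neq\bm 0$. Define $$\omega_{\imath\jmath}=-\frac{2\pi}{c^d}\int\frac{d^{d-1}\Omega_{\hat{\bm k}}}{(2\pi)^{d-1}}\,\bm\mu_\imath\cdot\big[\mathds{1}_3-\hat{\bm k}\hat{\bm k}\big]\cdot\bm\mu_\jmath\;\sum_{\pm}\mathcal P\!\int_0^\infty\frac{d\omega}{2\pi}\,\frac{\omega^d}{\omega\pm\omega_0}\,e^{i\omega\hat{\bm k}\cdot\bm r_{\imath\jmath}/c},$$ $$\gamma_{\imath\jmath}=\frac{2\pi\omega_0^d}{c^d}\int\frac{d^{d-1}\Omega_{\hat{\bm k}}}{(2\pi)^{d-1}}\,\bm\mu_\imath\cdot\big[\mathds{1}_3-\hat{\bm k}\hat{\bm k}\big]\cdot\bm\mu_\jmath\,e^{i\omega_0\hat{\bm k}\cdot\bm r_{\imath\jmath}/c}.$$ Then the complex collective frequency shift satisfies $$\Gamma_{\imath\jmath}:=-\omega_{\imath\jmath}+\frac{i}{2}\gamma_{\imath\jmath}=4\pi k_0^2\,\bm\mu_\imath\cdot\overleftrightarrow{G}_d(\bm r_{\imath\jmath},\omega_0)\cdot\bm\mu_\jmath,$$ where $\overleftrightarrow{G}_d$ is the $d$-dimensional dyadic Green's function defined below.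
   Context: $\mathbb{R}^d$ is identified with the span of the first $d$ Cartesian unit vectors $\hat{\bm x}_1,\dots,\hat{\bm x}_d$ in $\mathbb{R}^3$; $\mathds{1}_d=\sum_{l=1}^d\hat{\bm x}_l\hat{\bm x}_l$ and $\mathds 1_3$ is the identity dyad on $\mathbb{R}^3$. $c>0$ is a constant (speed of light). $d^{d-1}\Omega_{\hat{\bm k}}$ is the solid-angle measure over unit vectors $\hat{\bm k}\in\mathbb{R}^d$ (for $d=1$ counting measure on $\{\pm\hat{\bm x}_1\}$). $\mathcal P$ denotes the Cauchy principal value. $\nabla_d$ is the gradient with respect to the first $d$ coordinates. The dyadic Green's function is $\overleftrightarrow{G}_d:=\mathcal D G_d$ with the dyadic operator $\mathcal D:=\mathds 1_3+\frac{1}{k_0^2}\nabla_d\nabla_d$, where $G_d(\bm r,\omega_0)$ is the solution of the $d$-dimensional Helmholtz equation $(\nabla_d^2+k_0^2)G_d(\bm r,\omega_0)=-\delta(\bm r)$ satisfying the Sommerfeld outgoing radiation condition $\lim_{\tilde r\to\infty}|\bm r|^{(d-1)/2}\big(\partial_{\tilde r}-i\big)G_d=0$, $\tilde r=k_0|\bm r|$; explicitly $G_d(\bm r,\omega_0)=\frac{i}{4}\big(\frac{k_0^2}{2\pi}\big)^{d/2-1}\check H^{(1)}_{d/2-1}(k_0|\bm r|)$, where $\check H^{(1)}_\alpha(x):=H^{(1)}_\alpha(x)/x^\alpha$ and $H^{(1)}_\alpha$ is the Hankel function of the first kind.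
   Formalization: The principal-value frequency integral in ω_ij diverges as written; it is taken with a convergence factor e^{-εω}, and the identity is stated as the limit ε→0+ of −ω_ij(ε)+(i/2)γ_ij, taken after the angular integration. *)

theory Defs
  imports "HOL-Analysis.Analysis"
begin

text \<open>Bessel function of the first kind, via its power series
  J_alpha(x) = sum_m (-1)^m / (m! Gamma(m+alpha+1)) (x/2)^(2m+alpha), x > 0.
  The reciprocal Gamma function rGamma is entire, so no poles occur.\<close>
definition bessel_J :: "real \<Rightarrow> real \<Rightarrow> real" where
  "bessel_J \<alpha> x = (\<Sum>m. (-1) ^ m * rGamma (real m + \<alpha> + 1) / fact m * (x / 2) powr (2 * real m + \<alpha>))"

definition bessel_Y :: "real \<Rightarrow> real \<Rightarrow> real" where
  "bessel_Y \<alpha> x =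
     (if \<alpha> \<in> \<int> then
        Lim (at \<alpha>) (\<lambda>\<beta>. (bessel_J \<beta> x * cos (\<beta> * pi) - bessel_J (- \<beta>) x) / sin (\<beta> * pi))
      else (bessel_J \<alpha> x * cos (\<alpha> * pi) - bessel_J (- \<alpha>) x) / sin (\<alpha> * pi))"

definition hankel1 :: "real \<Rightarrow> real \<Rightarrow> complex" where
  "hankel1 \<alpha> x = Complex (bessel_J \<alpha> x) (bessel_Y \<alpha> x)"

definition hankel1_check :: "real \<Rightarrow> real \<Rightarrow> complex" where
  "hankel1_check \<alpha> x = hankel1 \<alpha> x / complex_of_real (x powr \<alpha>)"

definition dim_idx :: "nat \<Rightarrow> 3 set" where
  "dim_idx d = (if d = 1 then {1} else if d = 2 then {1, 2} else UNIV)"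

definition Rd :: "nat \<Rightarrow> (real^3) set" where
  "Rd d = {x. \<forall>i. i \<notin> dim_idx d \<longrightarrow> x $ i = 0}"

text \<open>Integral over unit vectors k of R^d against the solid-angle measure d^(d-1) Omega_k:
  counting measure on {+x1, -x1} for d = 1, arc length on the unit circle for d = 2,
  surface measure on the unit sphere for d = 3 (spherical coordinates).\<close>
definition sphere_int :: "nat \<Rightarrow> (real^3 \<Rightarrow> complex) \<Rightarrow> complex" where
  "sphere_int d f =
     (if d = 1 then f (axis 1 1) + f (- axis 1 1)
      else if d = 2 then integral {0..2*pi} (\<lambda>\<phi>. f (vector [cos \<phi>, sin \<phi>, 0]))
      else integral {0..pi} (\<lambda>\<theta>. integral {0..2*pi} (\<lambda>\<phi>.
              complex_of_real (sin \<theta>) * f (vector [sin \<theta> * cos \<phi>, sin \<theta> * sin \<phi>, cos \<theta>]))))"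

definition transv_proj :: "real^3 \<Rightarrow> real^3 \<Rightarrow> real^3 \<Rightarrow> real" where
  "transv_proj \<mu> k \<nu> = \<mu> \<bullet> \<nu> - (\<mu> \<bullet> k) * (k \<bullet> \<nu>)"

definition pv_int_0_inf :: "real \<Rightarrow> (real \<Rightarrow> complex) \<Rightarrow> complex" where
  "pv_int_0_inf w0 f = Lim (at_right 0) (\<lambda>\<delta>. integral ({0..w0 - \<delta>} \<union> {w0 + \<delta>..}) f)"

text \<open>omega_ij, with the (otherwise divergent) frequency integral regularised by the
  Abel convergence factor exp(-eps w); the physical value is the limit eps -> 0+.\<close>
definition omega_reg :: "nat \<Rightarrow> real \<Rightarrow> real \<Rightarrow> real^3 \<Rightarrow> real^3 \<Rightarrow> real^3 \<Rightarrow> real \<Rightarrow> complex" where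
  "omega_reg d c w0 \<mu>i \<mu>j r \<epsilon> =
     - complex_of_real (2 * pi / c ^ d) *
       sphere_int d (\<lambda>k. complex_of_real (transv_proj \<mu>i k \<mu>j / (2 * pi) ^ (d - 1)) *
         (\<Sum>s\<in>{1, -1::real}. pv_int_0_inf w0 (\<lambda>w.
            complex_of_real (w ^ d / (w + s * w0) / (2 * pi)) *
            exp (\<i> * complex_of_real (w * (k \<bullet> r) / c)) * complex_of_real (exp (- \<epsilon> * w)))))"

definition gamma_ij :: "nat \<Rightarrow> real \<Rightarrow> real \<Rightarrow> real^3 \<Rightarrow> real^3 \<Rightarrow> real^3 \<Rightarrow> complex" where
  "gamma_ij d c w0 \<mu>i \<mu>j r =
     complex_of_real (2 * pi * w0 ^ d / c ^ d) *
       sphere_int d (\<lambda>k. complex_of_real (transv_proj \<mu>i k \<mu>j / (2 * pi) ^ (d - 1)) *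
         exp (\<i> * complex_of_real (w0 * (k \<bullet> r) / c)))"

text \<open>Scalar outgoing Green's function of the d-dimensional Helmholtz equation:
  G_d(r) = (i/4) (k0^2/(2 pi))^(d/2-1) Hcheck_(d/2-1)(k0 |r|).\<close>
definition green :: "nat \<Rightarrow> real \<Rightarrow> real^3 \<Rightarrow> complex" where
  "green d k0 r = (\<i> / 4) * complex_of_real ((k0\<^sup>2 / (2 * pi)) powr (real d / 2 - 1)) *
                   hankel1_check (real d / 2 - 1) (k0 * norm r)"

definition pdiff :: "3 \<Rightarrow> (real^3 \<Rightarrow> complex) \<Rightarrow> real^3 \<Rightarrow> complex" where
  "pdiff l f r = vector_derivative (\<lambda>t. f (r + t *\<^sub>R axis l 1)) (at 0)"

text \<open>mu . G_d(r) . nu for the dyadic Green's function G_d = (1_3 + k0^-2 nabla_d nabla_d) G_d.\<close>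
definition dyadic_green_contr :: "nat \<Rightarrow> real \<Rightarrow> real^3 \<Rightarrow> real^3 \<Rightarrow> real^3 \<Rightarrow> complex" where
  "dyadic_green_contr d k0 \<mu> r \<nu> =
     complex_of_real (\<mu> \<bullet> \<nu>) * green d k0 r
     + complex_of_real (1 / k0\<^sup>2) *
       (\<Sum>l\<in>dim_idx d. \<Sum>m\<in>dim_idx d.
          complex_of_real (\<mu> $ l * \<nu> $ m) * pdiff l (pdiff m (green d k0)) r)"

end

theory Submission
  imports Defs "HOL-Real_Asymp.Real_Asymp"
begin

text \<open>
  With \<open>z = \<epsilon> - \<i> k \<bullet> r / c\<close> the regularised frequency integral is a principal value of
  \<open>w\<^sup>d e\<^sup>-\<^sup>z\<^sup>w / (w \<plusminus> \<omega>\<^sub>0)\<close>. It has an elementary primitive up to the exponential integral, hence equals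
  an explicit kernel with a logarithmic branch point at \<open>z = 0\<close>. The kernels for successive powers
  of \<open>w\<close> are derivatives of each other, so in dimensions 2 and 3 the factor \<open>1 - kk\<close> can be written as
  second derivatives in \<open>r\<close> of the spherical integral of the kernel of order \<open>d - 2\<close>, and only a radial
  function and its first two derivatives have to be followed as \<open>\<epsilon> \<rightarrow> 0\<close>.

  In dimensions 1 and 3 everything reduces to kernel values at the two points \<open>\<epsilon> \<plusminus> \<i> x\<close>, and only the
  jump \<open>Ln (\<i> x) - Ln (- \<i> x) = \<i> \<pi>\<close> survives in the limit. In dimension 2 the radial function solves, for every
  \<open>\<epsilon> > 0\<close>, Bessel's equation of order 0 with smooth initial data at the origin and with a source that
  concentrates there; its Wronskians with \<open>J\<^sub>0\<close> and \<open>Y\<^sub>0\<close> converge, the logarithm \<open>ln \<epsilon>\<close> of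
  the initial value cancelling against the one produced by the source and \<open>Y\<^sub>0\<close>.
\<close>

text \<open>For d = 2, 3 the limit cannot be taken under the spherical integral: directions with
  \<open>k \<bullet> r = 0\<close> bring z to the singular point, where \<open>kern d\<close> grows
  like 2/z^2 or 4/z^3. Lowering the order by two leaves the rational remainder
  \<open>kern d - kern (d - 2)\<close>, which is integrated over directions in closed form and
  vanishes in the limit at every positive distance. In space the surface measure is uniform in the
  cosine of the angle to r, and \<open>- kern 0\<close> is a primitive of \<open>kern 1\<close>, so
  only end points survive. On the circle the measure is not uniform in the cosine, hence the
  differential equation in the distance; at distance 0 all directions are singular at once, which
  produces \<open>ln \<epsilon>\<close>. The jump of the logarithm yields only a standing wave, such
  as 2 pi i cos x from \<open>kern 0\<close>; the term from gamma adds -2 pi sin x, and the sum 2 pi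
  i exp(i x) is outgoing. Euler's constant enters the kernel through the exponential integral at
  infinity and Y_0 through Digamma at the positive integers; the planar limit needs both with their
  exact values.\<close>

section \<open>The exponential integral\<close>

text \<open>\<open>ein z\<close> is the entire function \<open>\<integral>\<^sub>0\<^sup>1 (e\<^sup>z\<^sup>v - 1) / v dv\<close>; the summand for \<open>n = 0\<close>
  vanishes because of \<open>1 / 0 = 0\<close>.\<close>

definition ein :: "'a \<Rightarrow> 'a::{real_normed_field,banach}" where
  "ein z = (\<Sum>n. 1 / (of_nat n * fact n) * z ^ n)"

lemma summable_ein: "summable (\<lambda>n. 1 / (of_nat n * fact n) * z ^ n :: 'a::{real_normed_field,banach})"
proof (rule summable_comparison_test'[where N = 0])
  show "summable (\<lambda>n. norm (z ^ n /\<^sub>R fact n))"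
    using summable_norm_exp by blast
  fix n :: nat
  have "norm (1 / (of_nat n * fact n) * z ^ n) = inverse (real n) * norm (z ^ n /\<^sub>R fact n)"
    by (simp add: norm_mult norm_divide divide_simps norm_power)
  also have "\<dots> \<le> 1 * norm (z ^ n /\<^sub>R fact n)"
    by (intro mult_right_mono) (auto simp: inverse_eq_divide divide_simps)
  finally show "norm (1 / (of_nat n * fact n) * z ^ n) \<le> norm (z ^ n /\<^sub>R fact n)" by simp
qed

lemma ein_0 [simp]: "ein 0 = 0"
  unfolding ein_def powser_zero by simp

lemma has_field_derivative_ein:
  fixes z :: "'a::{real_normed_field,banach}"
  assumes "z \<noteq> 0"
  shows "(ein has_field_derivative (exp z - 1) / z) (at z)"
proof -
  have d: "diffs (\<lambda>n. 1 / (of_nat n * fact n)) = (\<lambda>n. 1 / fact (Suc n) :: 'a)"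
    by (rule ext) (simp add: diffs_def divide_simps del: fact_Suc of_nat_Suc)
  have "(ein has_field_derivative (\<Sum>n. 1 / fact (Suc n) * z ^ n)) (at z)"
    using termdiffs_strong_converges_everywhere[OF summable_ein, of z] unfolding d ein_def[abs_def] .
  moreover have "(\<lambda>n. 1 / fact (Suc n) * z ^ n) sums ((exp z - 1) / z)"
  proof -
    have "(\<lambda>n. z ^ n /\<^sub>R fact n) sums exp z" by (rule exp_converges)
    then have "(\<lambda>n. z ^ Suc n /\<^sub>R fact (Suc n)) sums (exp z - 1)"
      by (subst sums_Suc_iff) simp
    then have "(\<lambda>n. z ^ Suc n /\<^sub>R fact (Suc n) / z) sums ((exp z - 1) / z)"
      by (rule sums_divide)
    then show ?thesis
      using assms by (simp add: scaleR_conv_of_real divide_simps del: fact_Suc)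
  qed
  ultimately show ?thesis by (simp add: sums_iff del: fact_Suc)
qed

lemma isCont_ein: "isCont ein (z :: 'a::{real_normed_field,banach})"
  unfolding ein_def using termdiffs_strong_converges_everywhere[OF summable_ein] DERIV_isCont by blast

lemma continuous_on_ein [continuous_intros]:
  fixes f :: "'b::t2_space \<Rightarrow> 'a::{real_normed_field,banach}"
  assumes "continuous_on S f"
  shows "continuous_on S (\<lambda>x. ein (f x))"
  using continuous_on_compose2[OF continuous_at_imp_continuous_on assms, of UNIV ein] isCont_ein by blast

lemmas tendsto_ein [tendsto_intros] = isCont_tendsto_compose[OF isCont_ein]

lemma ein_of_real: "ein (of_real x) = (of_real (ein x) :: 'a::{real_normed_field,banach})"
proof -
  have "ein (of_real x) = (\<Sum>n. of_real (1 / (of_nat n * fact n) * x ^ n) :: 'a)"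
    by (simp add: ein_def)
  also have "\<dots> = of_real (ein x)"
    unfolding ein_def using suminf_of_real[OF summable_ein] by metis
  finally show ?thesis .
qed

text \<open>Integration by parts with \<open>1 - exp (-u)\<close> in place of
  \<open>- exp (-u)\<close>: the boundary term at 0 then vanishes despite the logarithm, and
  \<open>(exp (-u) - 1) / u\<close> is the derivative of \<open>ein (-u)\<close>.\<close>

lemma integral_exp_minus_ln:
  assumes "N > 0"
  shows "((\<lambda>u. exp (-u) * ln u) has_integral (1 - exp (-N)) * ln N + ein (-N)) {0..N::real}"
proof -
  let ?V = "\<lambda>u::real. (1 - exp (-u)) * ln u + ein (-u)"
  have c0: "((\<lambda>u::real. (1 - exp (-u)) * ln u) \<longlongrightarrow> 0) (at_right 0)"
    by real_asymp
  have "((\<lambda>u. exp (-u) * ln u) has_integral (?V N - ?V 0)) {0..N}"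
  proof (rule fundamental_theorem_of_calculus_interior)
    show "continuous_on {0..N} ?V"
    proof (intro continuous_on_add)
      show "continuous_on {0..N} (\<lambda>u. ein (-u))" by (intro continuous_intros)
      show "continuous_on {0..N} (\<lambda>u. (1 - exp (-u)) * ln u)"
        unfolding continuous_on_def
      proof
        fix x assume x: "x \<in> {0..N}"
        show "((\<lambda>u. (1 - exp (-u)) * ln u) \<longlongrightarrow> (1 - exp (-x)) * ln x) (at x within {0..N})"
        proof (cases "x = 0")
          case True
          have "at 0 within {0..N} = at_right (0::real)"
            using assms by (rule at_within_Icc_at_right)
          then show ?thesis using c0 True by simp
        next
          case False
          with x have "x > 0" by auto
          then show ?thesis by (auto intro!: tendsto_intros)
        qed
      qed
    qed
    fix x assume "x \<in> {0<..<N}"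
    then show "(?V has_vector_derivative exp (-x) * ln x) (at x)"
      unfolding has_real_derivative_iff_has_vector_derivative[symmetric]
      by (auto intro!: derivative_eq_intros DERIV_chain2[OF has_field_derivative_ein] simp: field_simps)
  qed (use assms in simp)
  then show ?thesis by simp
qed

text \<open>The integrand \<open>e\<^sup>-\<^sup>u ln u\<close> of \<open>\<Gamma>'(1) = -\<gamma>\<close> is squeezed between \<open>e\<^sup>-\<^sup>u (u\<^sup>s - 1) / s\<close> for
  \<open>s < 0\<close> and \<open>s > 0\<close>.\<close>

lemma powr_minus_1_bounds:
  fixes u s :: real
  assumes "u > 0" "s > 0"
  shows "ln u \<le> (u powr s - 1) / s" "(1 - u powr (-s)) / s \<le> ln u"
proof -
  have "1 + s * ln u \<le> exp (s * ln u)" "1 + (-s * ln u) \<le> exp (-s * ln u)"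
    by (rule exp_ge_add_one_self)+
  then show "ln u \<le> (u powr s - 1) / s" "(1 - u powr (-s)) / s \<le> ln u"
    using assms by (auto simp: powr_def field_simps)
qed

lemma incomplete_Gamma_le:
  fixes x N :: real
  assumes "x > 0"
  shows "(\<lambda>t. t powr (x - 1) * exp (-t)) integrable_on {0..N}"
    "integral {0..N} (\<lambda>t. t powr (x - 1) * exp (-t)) \<le> Gamma x"
proof -
  have G: "((\<lambda>t. t powr (x - 1) * exp (-t)) has_integral Gamma x) {0..}"
    using Gamma_integral_real[OF assms] by (simp add: exp_minus field_simps)
  show i: "(\<lambda>t. t powr (x - 1) * exp (-t)) integrable_on {0..N}"
  proof (rule integrable_on_subinterval)
    show "(\<lambda>t. t powr (x - 1) * exp (-t)) integrable_on {0..}" using G by blast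
  qed auto
  show "integral {0..N} (\<lambda>t. t powr (x - 1) * exp (-t)) \<le> Gamma x"
    unfolding integral_unique[OF G, symmetric]
    by (rule integral_subset_le) (use i G in auto)
qed

text \<open>The bounds of \<open>powr_minus_1_bounds\<close> are integrated against
  \<open>exp (-u)\<close>. Extending the incomplete Gamma integrals to the half-line enlarges them,
  which is admissible on both sides because the one in the lower bound enters with a minus
  sign.\<close>

lemma ein_ln_bounds:
  fixes N s :: real
  assumes N: "N > 0" and s: "0 < s" "s < 1"
  shows "(1 - exp (-N)) * ln N + ein (-N) \<le> (Gamma (1 + s) - 1 + exp (-N)) / s"
    "(1 - exp (-N) - Gamma (1 - s)) / s \<le> (1 - exp (-N)) * ln N + ein (-N)"
proof -
  note I = integral_exp_minus_ln[OF N]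
  have e: "((\<lambda>u. exp (-u)) has_integral (1 - exp (-N))) {0..N}"
  proof -
    have "((\<lambda>u. exp (-u)) has_integral (- exp (-N) - (- exp (-0)))) {0..N}"
      using N by (intro fundamental_theorem_of_calculus)
        (auto simp: has_real_derivative_iff_has_vector_derivative[symmetric] intro!: derivative_eq_intros)
    then show ?thesis by simp
  qed
  define Gp where "Gp = integral {0..N} (\<lambda>t. t powr (1 + s - 1) * exp (-t))"
  define Gm where "Gm = integral {0..N} (\<lambda>t. t powr (1 - s - 1) * exp (-t))"
  have p: "((\<lambda>t. (t powr (1 + s - 1) * exp (-t) - exp (-t)) / s) has_integral (Gp - (1 - exp (-N))) / s) {0..N}"
    unfolding Gp_def using s by (intro has_integral_divide has_integral_diff e integrable_integral incomplete_Gamma_le) auto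
  have m: "((\<lambda>t. (exp (-t) - t powr (1 - s - 1) * exp (-t)) / s) has_integral ((1 - exp (-N)) - Gm) / s) {0..N}"
    unfolding Gm_def using s by (intro has_integral_divide has_integral_diff e integrable_integral incomplete_Gamma_le) auto
  \<comment> \<open>The comparison runs over the open interval, since the bounds on
    \<open>ln u\<close> require \<open>u > 0\<close>.\<close>
  have "(1 - exp (-N)) * ln N + ein (-N) \<le> (Gp - (1 - exp (-N))) / s"
  proof (rule has_integral_le)
    show "((\<lambda>u. exp (-u) * ln u) has_integral (1 - exp (-N)) * ln N + ein (-N)) {0<..<N}"
      using I by (simp add: has_integral_Icc_iff_Ioo)
    show "((\<lambda>t. (t powr (1 + s - 1) * exp (-t) - exp (-t)) / s) has_integral (Gp - (1 - exp (-N))) / s) {0<..<N}"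
      using p by (simp add: has_integral_Icc_iff_Ioo)
    fix u assume "u \<in> {0<..<N}"
    then have "exp (-u) * ln u \<le> exp (-u) * ((u powr s - 1) / s)"
      using s powr_minus_1_bounds by (intro mult_left_mono) auto
    then show "exp (-u) * ln u \<le> (u powr (1 + s - 1) * exp (-u) - exp (-u)) / s"
      by (simp add: field_simps)
  qed
  also have "\<dots> \<le> (Gamma (1 + s) - 1 + exp (-N)) / s"
    unfolding Gp_def using incomplete_Gamma_le(2)[of "1 + s" N] s by (intro divide_right_mono) auto
  finally show "(1 - exp (-N)) * ln N + ein (-N) \<le> (Gamma (1 + s) - 1 + exp (-N)) / s" .
  have "(1 - exp (-N) - Gamma (1 - s)) / s \<le> ((1 - exp (-N)) - Gm) / s"
    unfolding Gm_def using incomplete_Gamma_le(2)[of "1 - s" N] s by (intro divide_right_mono) auto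
  also have "\<dots> \<le> (1 - exp (-N)) * ln N + ein (-N)"
  proof (rule has_integral_le)
    show "((\<lambda>u. exp (-u) * ln u) has_integral (1 - exp (-N)) * ln N + ein (-N)) {0<..<N}"
      using I by (simp add: has_integral_Icc_iff_Ioo)
    show "((\<lambda>t. (exp (-t) - t powr (1 - s - 1) * exp (-t)) / s) has_integral ((1 - exp (-N)) - Gm) / s) {0<..<N}"
      using m by (simp add: has_integral_Icc_iff_Ioo)
    fix u assume "u \<in> {0<..<N}"
    then have "exp (-u) * ((1 - u powr (-s)) / s) \<le> exp (-u) * ln u"
      using s powr_minus_1_bounds by (intro mult_left_mono) auto
    then show "(exp (-u) - u powr (1 - s - 1) * exp (-u)) / s \<le> exp (-u) * ln u"
      by (simp add: field_simps)
  qed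
  finally show "(1 - exp (-N) - Gamma (1 - s)) / s \<le> (1 - exp (-N)) * ln N + ein (-N)" .
qed

text \<open>Up to the error \<open>exp (-N) / s\<close> the bounds of \<open>ein_ln_bounds\<close>
  are difference quotients of Gamma at 1, whose limit is - gamma. First s is fixed, then N is taken
  so large that the error is negligible; no derivative has to be moved under an integral.\<close>

lemma ln_plus_ein_at_top:
  "((\<lambda>N::real. ln N + ein (-N)) \<longlongrightarrow> - euler_mascheroni) at_top"
proof -
  have dG: "((\<lambda>s::real. Gamma (1 + s)) has_real_derivative - euler_mascheroni) (at 0)"
    by (auto intro!: derivative_eq_intros simp: )
  have dp: "((\<lambda>s::real. (Gamma (1 + s) - 1) / s) \<longlongrightarrow> - euler_mascheroni) (at_right 0)"
    using dG by (auto simp: DERIV_def filterlim_at_split)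
  have "((\<lambda>s::real. Gamma (1 - s)) has_real_derivative euler_mascheroni) (at 0)"
    by (auto intro!: derivative_eq_intros simp: )
  then have "((\<lambda>s::real. (Gamma (1 - s) - 1) / s) \<longlongrightarrow> euler_mascheroni) (at_right 0)"
    by (auto simp: DERIV_def filterlim_at_split)
  then have dm: "((\<lambda>s::real. - ((Gamma (1 - s) - 1) / s)) \<longlongrightarrow> - euler_mascheroni) (at_right 0)"
    by (rule tendsto_minus)
  have "((\<lambda>N::real. (1 - exp (-N)) * ln N + ein (-N)) \<longlongrightarrow> - euler_mascheroni) at_top"
  proof (rule tendstoI)
    fix e :: real assume "e > 0"
    have "\<forall>\<^sub>F s in at_right 0. s \<in> {0<..<1::real} \<and> dist ((Gamma (1 + s) - 1) / s) (- euler_mascheroni) < e/2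
        \<and> dist (- ((Gamma (1 - s) - 1) / s)) (- euler_mascheroni) < e/2"
      using \<open>e > 0\<close> by (intro eventually_conj tendstoD[OF dp] tendstoD[OF dm] eventually_at_right_real) auto
    then obtain s :: real where s: "0 < s" "s < 1"
      and sp: "dist ((Gamma (1 + s) - 1) / s) (- euler_mascheroni) < e/2"
      and sm: "dist (- ((Gamma (1 - s) - 1) / s)) (- euler_mascheroni) < e/2"
      by (auto dest!: eventually_happens)
    have "((\<lambda>N::real. exp (-N) / s) \<longlongrightarrow> 0) at_top" using s by real_asymp
    from tendstoD[OF this, of "e/2"] have "\<forall>\<^sub>F N in at_top. exp (-N) / s < e/2"
      using \<open>e > 0\<close> s by (simp add: dist_real_def)
    then show "\<forall>\<^sub>F N::real in at_top. dist ((1 - exp (-N)) * ln N + ein (-N)) (- euler_mascheroni) < e"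
      using eventually_gt_at_top[of 0]
    proof eventually_elim
      case (elim N)
      let ?b = "exp (-N) / s"
      have "(1 - exp (-N)) * ln N + ein (-N) \<le> (Gamma (1 + s) - 1) / s + ?b"
        using ein_ln_bounds(1)[OF elim(2) s] by (simp add: add_divide_distrib diff_divide_distrib)
      moreover have "- ((Gamma (1 - s) - 1) / s) - ?b \<le> (1 - exp (-N)) * ln N + ein (-N)"
        using ein_ln_bounds(2)[OF elim(2) s] by (simp add: add_divide_distrib diff_divide_distrib)
      ultimately show ?case using sp sm elim(1) unfolding dist_real_def by linarith
    qed
  qed
  moreover have "((\<lambda>N::real. exp (-N) * ln N) \<longlongrightarrow> 0) at_top" by real_asymp
  ultimately have "((\<lambda>N::real. ((1 - exp (-N)) * ln N + ein (-N)) + exp (-N) * ln N) \<longlongrightarrow> - euler_mascheroni + 0) at_top"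
    by (rule tendsto_add)
  then show ?thesis by (simp add: algebra_simps)
qed

text \<open>In classical terms this is - E_1(z) - gamma on the slit plane, with E_1 the exponential
  integral.\<close>

definition ln_ein :: "complex \<Rightarrow> complex" where
  "ln_ein z = Ln z + ein (- z)"

lemma has_field_derivative_ln_ein:
  assumes "z \<notin> \<real>\<^sub>\<le>\<^sub>0"
  shows "(ln_ein has_field_derivative exp (- z) / z) (at z)"
proof -
  have "z \<noteq> 0" using assms by auto
  then show ?thesis unfolding ln_ein_def[abs_def]
    using assms by (auto intro!: derivative_eq_intros DERIV_chain2[OF has_field_derivative_ein] simp: field_simps)
qed

lemma not_nonpos_Reals_if_Re_pos: "Re z > 0 \<Longrightarrow> z \<notin> \<real>\<^sub>\<le>\<^sub>0"
  by (auto simp: complex_nonpos_Reals_iff)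

text \<open>The limit is known along the positive real ray. The points \<open>z * u\<close> and
  \<open>Re z * u\<close> have the same real part, and on the half-plane to their right the
  derivative \<open>exp (- w) / w\<close> is exponentially small, so the values at the two points
  approach each other.\<close>

lemma ln_ein_at_top:
  assumes "Re z > 0"
  shows "((\<lambda>u. ln_ein (z * of_real u)) \<longlongrightarrow> - of_real euler_mascheroni) at_top"
proof -
  define x where "x = Re z"
  have x: "x > 0" using assms by (simp add: x_def)
  have "((\<lambda>u. ln (x * u) + ein (- (x * u))) \<longlongrightarrow> - euler_mascheroni) at_top"
    by (rule filterlim_compose[OF ln_plus_ein_at_top])
      (use x in \<open>auto intro: filterlim_tendsto_pos_mult_at_top filterlim_ident\<close>)
  then have "((\<lambda>u. complex_of_real (ln (x * u) + ein (- (x * u)))) \<longlongrightarrow> of_real (- euler_mascheroni)) at_top"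
    by (rule tendsto_of_real)
  moreover have "\<forall>\<^sub>F u in at_top. complex_of_real (ln (x * u) + ein (- (x * u))) = ln_ein (of_real (x * u))"
    using eventually_gt_at_top[of 0]
    by eventually_elim (use x in \<open>simp add: ln_ein_def Ln_of_real del: of_real_mult flip: ein_of_real of_real_minus\<close>)
  ultimately have 1: "((\<lambda>u. ln_ein (of_real (x * u))) \<longlongrightarrow> of_real (- euler_mascheroni)) at_top"
    by (rule Lim_transform_eventually)
  have "((\<lambda>u. exp (- (x * u)) * (norm (z - x) / x)) \<longlongrightarrow> 0) at_top"
    using x by real_asymp
  then have 2: "((\<lambda>u. ln_ein (z * of_real u) - ln_ein (of_real (x * u))) \<longlongrightarrow> 0) at_top"
  proof (rule Lim_null_comparison[rotated])
    show "\<forall>\<^sub>F u in at_top. norm (ln_ein (z * of_real u) - ln_ein (of_real (x * u)))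
        \<le> exp (- (x * u)) * (norm (z - x) / x)"
      using eventually_gt_at_top[of 0]
    proof eventually_elim
      case (elim u)
      have xu: "x * u > 0" using x elim by simp
      have "norm (ln_ein (z * of_real u) - ln_ein (of_real (x * u)))
          \<le> (exp (- (x * u)) / (x * u)) * norm (z * of_real u - of_real (x * u))"
      proof (rule field_differentiable_bound[where S = "{w. Re w \<ge> x * u}" and f' = "\<lambda>w. exp (-w) / w"])
        show "convex {w. Re w \<ge> x * u}" by (rule convex_halfspace_Re_ge)
        fix w assume w: "w \<in> {w. Re w \<ge> x * u}"
        then have "Re w > 0" using xu by auto
        then show "(ln_ein has_field_derivative exp (- w) / w) (at w within {w. Re w \<ge> x * u})"
          by (intro has_field_derivative_at_within[OF has_field_derivative_ln_ein] not_nonpos_Reals_if_Re_pos)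
        have "norm w \<ge> x * u" using w complex_Re_le_cmod[of w] by auto
        then show "norm (exp (- w) / w) \<le> exp (- (x * u)) / (x * u)"
          unfolding norm_divide norm_exp_eq_Re using w xu by (intro frac_le) auto
      qed (use elim in \<open>auto simp: x_def\<close>)
      also have "norm (z * of_real u - of_real (x * u)) = norm (z - x) * u"
      proof -
        have "z * of_real u - of_real (x * u) = (z - x) * of_real u" by (simp add: algebra_simps)
        then show ?thesis using elim by (simp add: norm_mult)
      qed
      finally show ?case using elim by simp
    qed
  qed
  from tendsto_add[OF 1 2] show ?thesis by simp
qed

section \<open>Tails of exponential integrals with a pole\<close>

lemma exp_times_power_at_top:
  assumes "Re z > 0"
  shows "((\<lambda>u. exp (- z * of_real u) * of_real u ^ n) \<longlongrightarrow> 0) at_top"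
proof (rule tendsto_norm_zero_cancel)
  have "((\<lambda>u. exp (- (Re z) * u) * u ^ n) \<longlongrightarrow> 0) at_top"
    using assms by real_asymp
  then show "((\<lambda>u. norm (exp (- z * of_real u) * of_real u ^ n)) \<longlongrightarrow> 0) at_top"
  proof (rule Lim_transform_eventually)
    show "\<forall>\<^sub>F u in at_top. exp (- (Re z) * u) * u ^ n = norm (exp (- z * of_real u) * of_real u ^ n)"
      using eventually_ge_at_top[of 0] by eventually_elim (simp add: norm_mult norm_power)
  qed
qed

text \<open>The majorant \<open>h\<close> allows dominated convergence for the truncations to
  \<open>{b..b + n}\<close>, whose integrals are known from the primitive.\<close>

lemma has_integral_improper:
  fixes f F :: "real \<Rightarrow> complex"
  assumes der: "\<And>u. u \<ge> b \<Longrightarrow> (F has_vector_derivative f u) (at u)"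
    and h: "h integrable_on {b..}" and le: "\<And>u. u \<ge> b \<Longrightarrow> norm (f u) \<le> h u"
    and lim: "(F \<longlongrightarrow> L) at_top"
  shows "(f has_integral (L - F b)) {b..}"
proof -
  define g where "g n u = (if u \<in> {b..b + real n} then f u else 0)" for n :: nat and u
  have g: "(g n has_integral (F (b + real n) - F b)) {b..}" for n
    unfolding g_def
    by (subst has_integral_restrict, force, rule fundamental_theorem_of_calculus)
      (auto intro: has_vector_derivative_at_within der)
  have conv: "(\<lambda>n. g n u) \<longlonglongrightarrow> f u" if "u \<in> {b..}" for u
  proof (rule tendsto_eventually)
    obtain N :: nat where "real N \<ge> u - b" using real_arch_simple by blast
    then show "\<forall>\<^sub>F n in sequentially. g n u = f u"
      using that by (intro eventually_sequentiallyI[of N]) (auto simp: g_def)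
  qed
  have le': "norm (g n u) \<le> h u" if "u \<in> {b..}" for n u
  proof (cases "u \<in> {b..b + real n}")
    case True
    then show ?thesis using le that by (simp add: g_def)
  next
    case False
    have "0 \<le> h u" using le[of u] that norm_ge_zero[of "f u"] by (simp del: norm_ge_zero) 
    with False show ?thesis by (simp only: g_def if_False norm_zero)
  qed
  note dc = dominated_convergence[of g "{b..}" h f]
  have int: "f integrable_on {b..}"
    by (rule dc(1)) (use g h le' conv in \<open>auto simp: integrable_on_def\<close>)
  have "(\<lambda>n. integral {b..} (g n)) \<longlonglongrightarrow> integral {b..} f"
    by (rule dc(2)) (use g h le' conv in \<open>auto simp: integrable_on_def\<close>)
  moreover have "(\<lambda>n. integral {b..} (g n)) \<longlonglongrightarrow> L - F b"
  proof -
    have "filterlim (\<lambda>n. b + real n) at_top sequentially" by real_asymp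
    from filterlim_compose[OF lim this] have "(\<lambda>n. F (b + real n) - F b) \<longlonglongrightarrow> L - F b"
      by (intro tendsto_diff tendsto_const)
    then show ?thesis using integral_unique[OF g] by simp
  qed
  ultimately have "integral {b..} f = L - F b" using LIMSEQ_unique by blast
  with int show ?thesis using has_integral_integral by metis
qed

text \<open>Half of the decay rate pays for the polynomial factor:
  \<open>y * exp (- y) \<le> 1\<close> is used with y = x u / 2 and, squared, with y = x u / 4,
  whence the constants 2 / x and 16 / x^2.\<close>

lemma poly_times_exp_bound:
  fixes x u :: real
  assumes "x > 0" "u \<ge> 0"
  shows "u * exp (- x * u) \<le> 2 / x * exp (- (x / 2) * u)"
    "u\<^sup>2 * exp (- x * u) \<le> 16 / x\<^sup>2 * exp (- (x / 2) * u)"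
    "exp (- x * u) \<le> exp (- (x / 2) * u)"
proof -
  have s: "exp (- x * u) = exp (- (x / 2) * u) * exp (- (x / 2) * u)" by (simp flip: exp_add)
  have y: "y * exp (- y) \<le> 1" for y :: real
    using exp_ge_add_one_self[of y] by (simp add: exp_minus divide_simps del: exp_ge_add_one_self)
  have "x / 2 * u * exp (- (x / 2) * u) \<le> 1" using y[of "x / 2 * u"] by simp
  then have "u * exp (- (x / 2) * u) \<le> 2 / x" using assms by (simp add: field_simps)
  then have "u * exp (- (x / 2) * u) * exp (- (x / 2) * u) \<le> 2 / x * exp (- (x / 2) * u)"
    by (intro mult_right_mono) auto
  then show "u * exp (- x * u) \<le> 2 / x * exp (- (x / 2) * u)" by (simp only: s mult.assoc)
  have "x / 4 * u * exp (- (x / 4) * u) \<le> 1" using y[of "x / 4 * u"] by simp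
  then have "(x / 4 * u * exp (- (x / 4) * u))\<^sup>2 \<le> 1"
    using assms by (simp add: power_le_one)
  moreover have "(x / 4 * u * exp (- (x / 4) * u))\<^sup>2 = x\<^sup>2 / 16 * u\<^sup>2 * exp (- (x / 2) * u)"
  proof -
    have "(exp (- (x / 4) * u))\<^sup>2 = exp (- (x / 2) * u)" by (simp flip: exp_double)
    then show ?thesis by (simp only: power_mult_distrib power_divide) simp
  qed
  ultimately have "x\<^sup>2 / 16 * u\<^sup>2 * exp (- (x / 2) * u) \<le> 1" by (simp only:)
  then have "u\<^sup>2 * exp (- (x / 2) * u) \<le> 16 / x\<^sup>2" using assms by (simp add: field_simps)
  then have "u\<^sup>2 * exp (- (x / 2) * u) * exp (- (x / 2) * u) \<le> 16 / x\<^sup>2 * exp (- (x / 2) * u)"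
    by (intro mult_right_mono) auto
  then show "u\<^sup>2 * exp (- x * u) \<le> 16 / x\<^sup>2 * exp (- (x / 2) * u)" by (simp only: s mult.assoc)
  show "exp (- x * u) \<le> exp (- (x / 2) * u)" using assms by simp
qed

section \<open>Principal values with one pole\<close>

lemma pv_int_0_infI:
  assumes "a > 0"
    and "\<And>\<delta>. 0 < \<delta> \<Longrightarrow> \<delta> < a \<Longrightarrow> (f has_integral I1 \<delta>) {0..a - \<delta>}"
    and "\<And>\<delta>. 0 < \<delta> \<Longrightarrow> \<delta> < a \<Longrightarrow> (f has_integral I2 \<delta>) {a + \<delta>..}"
    and "((\<lambda>\<delta>. I1 \<delta> + I2 \<delta>) \<longlongrightarrow> l) (at_right 0)"
  shows "pv_int_0_inf a f = l"
  unfolding pv_int_0_inf_def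
proof (rule tendsto_Lim)
  have "\<forall>\<^sub>F \<delta> in at_right 0. \<delta> \<in> {0<..<a}"
    using assms(1) by (rule eventually_at_right_real)
  then have "\<forall>\<^sub>F \<delta> in at_right 0. I1 \<delta> + I2 \<delta> = integral ({0..a - \<delta>} \<union> {a + \<delta>..}) f"
  proof eventually_elim
    case (elim \<delta>)
    have "{0..a - \<delta>} \<inter> {a + \<delta>..} = {}" using elim by auto
    then have "(f has_integral I1 \<delta> + I2 \<delta>) ({0..a - \<delta>} \<union> {a + \<delta>..})"
      using elim by (intro has_integral_Un assms) auto
    then show ?case by (simp add: integral_unique)
  qed
  with assms(4) show "((\<lambda>\<delta>. integral ({0..a - \<delta>} \<union> {a + \<delta>..}) f) \<longlongrightarrow> l) (at_right 0)"
    by (rule Lim_transform_eventually)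
qed simp

definition poly_exp_prim :: "complex \<Rightarrow> complex \<Rightarrow> complex \<Rightarrow> complex \<Rightarrow> complex \<Rightarrow> complex" where
  "poly_exp_prim c0 c1 c2 z w = - exp (- z * w) *
     (c0 / z + c1 * (w / z + 1 / z\<^sup>2) + c2 * (w\<^sup>2 / z + 2 * w / z\<^sup>2 + 2 / z ^ 3))"

lemma has_field_derivative_poly_exp_prim:
  assumes "z \<noteq> 0"
  shows "(poly_exp_prim c0 c1 c2 z has_field_derivative (c0 + c1 * w + c2 * w\<^sup>2) * exp (- z * w)) (at w)"
proof -
  have 1: "((\<lambda>w. - exp (- z * w)) has_field_derivative z * exp (- z * w)) (at w)"
    by (auto intro!: derivative_eq_intros)
  have 2: "((\<lambda>w. c0 / z + c1 * (w / z + 1 / z\<^sup>2) + c2 * (w\<^sup>2 / z + 2 * w / z\<^sup>2 + 2 / z ^ 3))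
      has_field_derivative (0 + c1 * (1 / z + 0) + c2 * (2 * w / z + 2 / z\<^sup>2 + 0))) (at w)"
    by (intro DERIV_add DERIV_cmult DERIV_const DERIV_cdivide) (auto intro!: derivative_eq_intros)
  show ?thesis
    unfolding poly_exp_prim_def[abs_def] using DERIV_mult[OF 1 2]
    by (rule DERIV_cong) (use assms in \<open>simp add: field_simps power2_eq_square power3_eq_cube\<close>)
qed

lemma poly_exp_prim_at_top:
  assumes "Re z > 0"
  shows "((\<lambda>u. poly_exp_prim c0 c1 c2 z (of_real u)) \<longlongrightarrow> 0) at_top"
proof -
  note t = exp_times_power_at_top[OF assms]
  have "((\<lambda>u. - ((exp (- z * of_real u) * of_real u ^ 0) * (c0 / z + c1 / z\<^sup>2 + c2 * 2 / z ^ 3)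
      + (exp (- z * of_real u) * of_real u ^ 1) * (c1 / z + c2 * 2 / z\<^sup>2)
      + (exp (- z * of_real u) * of_real u ^ 2) * (c2 / z)))
     \<longlongrightarrow> - (0 * (c0 / z + c1 / z\<^sup>2 + c2 * 2 / z ^ 3) + 0 * (c1 / z + c2 * 2 / z\<^sup>2) + 0 * (c2 / z))) at_top"
    by (intro tendsto_intros t)
  then show ?thesis by (simp add: poly_exp_prim_def algebra_simps)
qed

text \<open>Since \<open>exp (- z * w) = exp (z * b) * exp (- z * (w + b))\<close>, the pole term
  has the primitive \<open>ln_ein (z * (w + b))\<close> up to a factor, and its limit at infinity
  gives Euler's constant. Both signs of b are covered: the pole -a with the interval starting at 0,
  and the pole a with the interval starting to its right.\<close>

lemma poly_exp_cauchy_tail: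
  assumes z: "Re z > 0" and s: "s \<ge> 0" and sb: "s + b > 0"
  shows "((\<lambda>w. (c0 + c1 * of_real w + c2 * (of_real w)\<^sup>2 + c / of_real (w + b)) * exp (- z * of_real w)) has_integral
     (- c * exp (z * b) * euler_mascheroni
      - (poly_exp_prim c0 c1 c2 z s + c * exp (z * b) * ln_ein (z * of_real (s + b))))) {s..}"
proof -
  define x where "x = Re z"
  have x: "x > 0" using z by (simp add: x_def)
  have z0: "z \<noteq> 0" using z by auto
  let ?F = "\<lambda>w. poly_exp_prim c0 c1 c2 z (of_real w) + c * exp (z * b) * ln_ein (z * of_real (w + b))"
  let ?f = "\<lambda>w. (c0 + c1 * of_real w + c2 * (of_real w)\<^sup>2 + c / of_real (w + b)) * exp (- z * of_real w)"
  let ?h = "\<lambda>w. (norm c0 + norm c1 * (2 / x) + norm c2 * (16 / x\<^sup>2) + norm c / (s + b)) * exp (- (x / 2) * w)"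
  have "(?f has_integral ((0 + c * exp (z * b) * (- of_real euler_mascheroni)) - ?F s)) {s..}"
  proof (rule has_integral_improper[where h = ?h])
    fix w assume w: "w \<ge> s"
    have wb: "w + b > 0" using w sb by simp
    have "((\<lambda>w. poly_exp_prim c0 c1 c2 z w + c * exp (z * b) * ln_ein (z * (w + b))) has_field_derivative
       (c0 + c1 * of_real w + c2 * (of_real w)\<^sup>2) * exp (- z * of_real w)
       + c * exp (z * b) * (exp (- (z * (complex_of_real w + complex_of_real b))) / (z * (complex_of_real w + complex_of_real b)) * z)) (at (of_real w))"
    proof (rule DERIV_add[OF has_field_derivative_poly_exp_prim[OF z0] DERIV_cmult])
      have "Re (z * (complex_of_real w + complex_of_real b)) > 0"
        using mult_pos_pos[OF z wb] by (simp flip: of_real_add)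
      then have "(ln_ein has_field_derivative exp (- (z * (complex_of_real w + complex_of_real b))) / (z * (complex_of_real w + complex_of_real b))) (at (z * (complex_of_real w + complex_of_real b)))"
        by (intro has_field_derivative_ln_ein not_nonpos_Reals_if_Re_pos)
      then show "((\<lambda>w. ln_ein (z * (w + b))) has_field_derivative
          exp (- (z * (complex_of_real w + complex_of_real b))) / (z * (complex_of_real w + complex_of_real b)) * z) (at (of_real w))"
        by (rule DERIV_chain2) (auto intro!: derivative_eq_intros)
    qed
    moreover have "c * exp (z * b) * (exp (- (z * (complex_of_real w + complex_of_real b))) / (z * (complex_of_real w + complex_of_real b)) * z)
        = c / of_real (w + b) * exp (- z * of_real w)"
    proof -
      have e: "exp (- (z * (complex_of_real w + complex_of_real b))) = exp (- z * of_real w) / exp (z * b)"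
        unfolding exp_diff[symmetric] by (rule arg_cong[where f = exp]) (simp add: algebra_simps)
      have "complex_of_real w + complex_of_real b \<noteq> 0" using wb by (simp flip: of_real_add)
      then show ?thesis unfolding e of_real_add using z0 by (simp add: divide_simps)
    qed
    ultimately have "((\<lambda>w. poly_exp_prim c0 c1 c2 z w + c * exp (z * b) * ln_ein (z * (w + b))) has_field_derivative ?f w)
       (at (of_real w))" by (simp only: ring_distribs)
    from has_vector_derivative_real_field[OF this]
    show "(?F has_vector_derivative ?f w) (at w)" by simp
    have "norm (?f w) \<le> (norm c0 + norm c1 * w + norm c2 * w\<^sup>2 + norm c / (w + b)) * exp (- x * w)"
      unfolding norm_mult
    proof (rule mult_mono)
      have "norm (c0 + c1 * of_real w + c2 * (of_real w)\<^sup>2 + c / of_real (w + b))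
          \<le> norm c0 + norm (c1 * of_real w) + norm (c2 * (of_real w)\<^sup>2) + norm (c / of_real (w + b))"
        by (intro norm_triangle_le add_mono order.refl)
      then show "norm (c0 + c1 * of_real w + c2 * (of_real w)\<^sup>2 + c / of_real (w + b))
          \<le> norm c0 + norm c1 * w + norm c2 * w\<^sup>2 + norm c / (w + b)"
        using w s wb by (simp add: norm_mult norm_divide norm_power del: of_real_add)
    qed (use w s wb in \<open>auto simp: x_def intro!: add_nonneg_nonneg\<close>)
    also have "\<dots> = norm c0 * exp (- x * w) + norm c1 * (w * exp (- x * w)) + norm c2 * (w\<^sup>2 * exp (- x * w))
        + norm c / (w + b) * exp (- x * w)" by (simp add: ring_distribs)
    also have "\<dots> \<le> norm c0 * exp (- (x / 2) * w) + norm c1 * (2 / x * exp (- (x / 2) * w))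
        + norm c2 * (16 / x\<^sup>2 * exp (- (x / 2) * w)) + norm c / (s + b) * exp (- (x / 2) * w)"
      using w s sb wb x by (intro add_mono mult_mono frac_le poly_times_exp_bound) auto
    finally show "norm (?f w) \<le> ?h w" by (simp add: ring_distribs)
  next
    show "?h integrable_on {s..}"
      using integrable_on_exp_minus_to_infinity[of "x / 2" s] x by (intro integrable_on_mult_right) simp
    have "filterlim (\<lambda>w. w + b) at_top at_top" by real_asymp
    then show "(?F \<longlongrightarrow> 0 + c * exp (z * b) * (- of_real euler_mascheroni)) at_top"
      by (intro tendsto_add tendsto_mult_left poly_exp_prim_at_top z filterlim_compose[OF ln_ein_at_top[OF z]])
  qed
  then show ?thesis by simp
qed


text \<open>The pole -a lies outside the half-line, so the excised interval around a contributes
  nothing in the limit and the value is the ordinary integral from 0.\<close>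

lemma pv_int_plus:
  assumes z: "Re z > 0" and a: "a > 0"
  shows "pv_int_0_inf a (\<lambda>w. (c0 + c1 * of_real w + c2 * (of_real w)\<^sup>2 + c / of_real (w + a)) * exp (- z * of_real w))
    = c0 / z + c1 / z\<^sup>2 + 2 * c2 / z ^ 3 - c * exp (z * a) * (euler_mascheroni + ln_ein (z * a))"
proof -
  let ?f = "\<lambda>w. (c0 + c1 * of_real w + c2 * (of_real w)\<^sup>2 + c / of_real (w + a)) * exp (- z * of_real w)"
  define F where "F s = - c * exp (z * a) * euler_mascheroni
      - (poly_exp_prim c0 c1 c2 z (of_real s) + c * exp (z * a) * ln_ein (z * of_real (s + a)))" for s
  have tail: "(?f has_integral F s) {s..}" if "s \<ge> 0" for s
    using poly_exp_cauchy_tail[OF z that, of a c0 c1 c2 c] a that unfolding F_def by simp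
  have head: "(?f has_integral (F 0 - F (a - \<delta>))) {0..a - \<delta>}" if "0 < \<delta>" "\<delta> < a" for \<delta>
  proof -
    have i: "?f integrable_on {0..a - \<delta>}"
      using integrable_on_subinterval[of ?f "{0..}" 0 "a - \<delta>"] tail[of 0] by auto
    have "(?f has_integral (integral {0..a - \<delta>} ?f + F (a - \<delta>))) ({0..a - \<delta>} \<union> {a - \<delta>..})"
      using that by (intro has_integral_Un tail integrable_integral[OF i]) (auto simp: Int_atLeastAtMostR2)
    moreover have "{0..a - \<delta>} \<union> {a - \<delta>..} = {0..}" using that by auto
    ultimately have "(?f has_integral (integral {0..a - \<delta>} ?f + F (a - \<delta>))) {0..}" by (simp only:)
    from has_integral_unique[OF this tail[OF order.refl]]
    have "integral {0..a - \<delta>} ?f = F 0 - F (a - \<delta>)" by (simp only: eq_diff_eq)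
    with integrable_integral[OF i] show ?thesis by (simp only:)
  qed
  have p: "z * of_real (a + a) \<notin> \<real>\<^sub>\<le>\<^sub>0" "z * of_real a \<notin> \<real>\<^sub>\<le>\<^sub>0"
    using z a by (auto intro!: not_nonpos_Reals_if_Re_pos)
  have c: "isCont F a"
    unfolding F_def poly_exp_prim_def using z p
    by (auto intro!: continuous_intros isCont_o2[OF _ DERIV_isCont[OF has_field_derivative_ln_ein]])
  have l: "((\<lambda>\<delta>. F (a - \<delta>)) \<longlongrightarrow> F a) (at_right 0)" "((\<lambda>\<delta>. F (a + \<delta>)) \<longlongrightarrow> F a) (at_right 0)"
    by (rule isCont_tendsto_compose[OF c]; auto intro!: tendsto_eq_intros)+
  have "((\<lambda>\<delta>. F 0 - F (a - \<delta>) + F (a + \<delta>)) \<longlongrightarrow> F 0 - F a + F a) (at_right 0)"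
    by (intro tendsto_add tendsto_diff tendsto_const l)
  then have "pv_int_0_inf a ?f = F 0 - F a + F a"
    by (rule pv_int_0_infI[OF a head tail, rotated -1]) (use a in auto)
  also have "\<dots> = c0 / z + c1 / z\<^sup>2 + 2 * c2 / z ^ 3 - c * exp (z * a) * (euler_mascheroni + ln_ein (z * a))"
    by (simp add: F_def poly_exp_prim_def ring_distribs)
  finally show ?thesis .
qed

text \<open>The primitives on the two sides of the pole carry the same logarithm \<open>ln \<delta>\<close>, which therefore
  cancels in the principal value.\<close>

lemma pv_int_minus:
  assumes z: "Re z > 0" and a: "a > 0"
  shows "pv_int_0_inf a (\<lambda>w. (c0 + c1 * of_real w + c2 * (of_real w)\<^sup>2 + c / of_real (w - a)) * exp (- z * of_real w))
    = c0 / z + c1 / z\<^sup>2 + 2 * c2 / z ^ 3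
      - c * exp (- z * a) * (euler_mascheroni + Ln (z * a) + ein (z * a))"
proof -
  let ?f = "\<lambda>w. (c0 + c1 * of_real w + c2 * (of_real w)\<^sup>2 + c / of_real (w - a)) * exp (- z * of_real w)"
  let ?P = "poly_exp_prim c0 c1 c2 z"
  let ?T = "\<lambda>\<delta>. - c * exp (- z * a) * euler_mascheroni
      - (?P (of_real (a + \<delta>)) + c * exp (- z * a) * ln_ein (z * of_real \<delta>))"
  \<comment> \<open>To the left of the pole \<open>z * (s - a)\<close> can lie on the branch cut; it
    does for real z. The logarithm is therefore split into \<open>Ln z\<close> and the real
    logarithm of the distance to the pole, and \<open>ein\<close> takes the argument
    \<open>z * (a - s)\<close>.\<close>
  let ?H = "\<lambda>s. ?P (of_real s) + c * exp (- z * a) * (Ln z + of_real (ln (a - s)) + ein (z * of_real (a - s)))"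
  have z0: "z \<noteq> 0" using z by auto
  have tail: "(?f has_integral ?T \<delta>) {a + \<delta>..}" if "0 < \<delta>" for \<delta>
    using poly_exp_cauchy_tail[OF z, of "a + \<delta>" "- a" c0 c1 c2 c] a that by simp
  have head: "(?f has_integral (?H (a - \<delta>) - ?H 0)) {0..a - \<delta>}" if "0 < \<delta>" "\<delta> < a" for \<delta>
  proof (rule fundamental_theorem_of_calculus)
    fix w assume "w \<in> {0..a - \<delta>}"
    then have w: "a - w > 0" using that by auto
    then have wn: "complex_of_real a - complex_of_real w \<noteq> 0" by (simp flip: of_real_diff)
    have L: "((\<lambda>s. complex_of_real (ln (a - s))) has_vector_derivative of_real (- 1 / (a - w))) (at w)"
      by (intro has_vector_derivative_of_real) (use w in \<open>auto intro!: derivative_eq_intros simp flip: has_real_derivative_iff_has_vector_derivative\<close>)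
    have "((\<lambda>s. ?P s + c * exp (- z * a) * (Ln z + ein (z * (of_real a - s)))) has_field_derivative
        (c0 + c1 * of_real w + c2 * (of_real w)\<^sup>2) * exp (- z * of_real w)
        + c * exp (- z * a) * (0 + (exp (z * (of_real a - of_real w)) - 1) / (z * (of_real a - of_real w)) * (- z))) (at (of_real w))"
      using wn z0
      by (intro DERIV_add DERIV_cmult has_field_derivative_poly_exp_prim z0 DERIV_const DERIV_chain2[OF has_field_derivative_ein])
        (auto intro!: derivative_eq_intros)
    from has_vector_derivative_real_field[OF this]
    have "((\<lambda>s. ?P (of_real s) + c * exp (- z * a) * (Ln z + ein (z * (of_real a - of_real s)))) has_vector_derivative
        (c0 + c1 * of_real w + c2 * (of_real w)\<^sup>2) * exp (- z * of_real w)
        + c * exp (- z * a) * (0 + (exp (z * (of_real a - of_real w)) - 1) / (z * (of_real a - of_real w)) * (- z))) (at w)"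
      .
    from has_vector_derivative_add[OF this has_vector_derivative_mult_right[OF L, of "c * exp (- z * a)"]]
    have "(?H has_vector_derivative
        ((c0 + c1 * of_real w + c2 * (of_real w)\<^sup>2) * exp (- z * of_real w)
        + c * exp (- z * a) * (0 + (exp (z * (of_real a - of_real w)) - 1) / (z * (of_real a - of_real w)) * (- z))
        + c * exp (- z * a) * of_real (- 1 / (a - w)))) (at w)"
      by (simp add: algebra_simps)
    moreover have "c * exp (- z * a) * (0 + (exp (z * (of_real a - of_real w)) - 1) / (z * (of_real a - of_real w)) * (- z))
        + c * exp (- z * a) * of_real (- 1 / (a - w)) = c / of_real (w - a) * exp (- z * of_real w)"
    proof -
      have e: "exp (z * (of_real a - of_real w)) = exp (- z * w) / exp (- z * a)"
        unfolding exp_diff[symmetric] by (rule arg_cong[where f = exp]) (simp add: algebra_simps)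
      have d: "complex_of_real (w - a) = - (of_real a - of_real w)" by simp
      show ?thesis unfolding e d using z0 wn by (simp add: divide_simps) (simp add: algebra_simps)
    qed
    ultimately have "(?H has_vector_derivative ?f w) (at w)"
      by (simp only: ring_distribs add.assoc)
    then show "(?H has_vector_derivative ?f w) (at w within {0..a - \<delta>})"
      by (rule has_vector_derivative_at_within)
  qed (use that in simp)
  define e where "e = c * exp (- z * a)"
  define P where "P s = ?P (of_real s)" for s
  define H where "H = ?H 0"
  have c: "isCont P a"
    unfolding P_def poly_exp_prim_def using z0 by (auto intro!: continuous_intros)
  have lP: "((\<lambda>\<delta>. P (a - \<delta>)) \<longlongrightarrow> P a) (at_right 0)" "((\<lambda>\<delta>. P (a + \<delta>)) \<longlongrightarrow> P a) (at_right 0)"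
    by (rule isCont_tendsto_compose[OF c]; auto intro!: tendsto_eq_intros)+
  have lE: "((\<lambda>\<delta>. ein (z * of_real \<delta>)) \<longlongrightarrow> ein (z * of_real 0)) (at_right 0)"
    "((\<lambda>\<delta>. ein (- (z * of_real \<delta>))) \<longlongrightarrow> ein (- (z * of_real 0))) (at_right 0)"
    by (intro tendsto_intros)+
  have "((\<lambda>\<delta>. P (a - \<delta>) - P (a + \<delta>) - H - e * euler_mascheroni + e * (ein (z * of_real \<delta>) - ein (- (z * of_real \<delta>))))
      \<longlongrightarrow> P a - P a - H - e * euler_mascheroni + e * (ein (z * of_real 0) - ein (- (z * of_real 0)))) (at_right 0)"
    by (intro tendsto_add tendsto_diff tendsto_mult_left tendsto_const lP lE)
  moreover have "\<forall>\<^sub>F \<delta> in at_right 0.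
      P (a - \<delta>) - P (a + \<delta>) - H - e * euler_mascheroni + e * (ein (z * of_real \<delta>) - ein (- (z * of_real \<delta>)))
      = ?H (a - \<delta>) - ?H 0 + ?T \<delta>"
    using eventually_at_right_less[of 0]
  proof eventually_elim
    case (elim \<delta>)
    have "Ln (z * of_real \<delta>) = Ln z + of_real (ln \<delta>)"
      using Ln_times_of_real[OF elim z0] elim by (simp add: Ln_of_real ac_simps)
    moreover have "a - (a - \<delta>) = \<delta>" by simp
    ultimately show ?case
      unfolding ln_ein_def H_def P_def e_def by (simp add: ring_distribs)
  qed
  ultimately have lim: "((\<lambda>\<delta>. ?H (a - \<delta>) - ?H 0 + ?T \<delta>) \<longlongrightarrow>
      P a - P a - H - e * euler_mascheroni + e * (ein (z * of_real 0) - ein (- (z * of_real 0)))) (at_right 0)"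
    by (rule Lim_transform_eventually)
  have "pv_int_0_inf a ?f = P a - P a - H - e * euler_mascheroni + e * (ein (z * of_real 0) - ein (- (z * of_real 0)))"
    by (rule pv_int_0_infI[OF a head tail lim])
  also have "\<dots> = - H - e * euler_mascheroni" by simp
  also have "H = - (c0 / z + c1 / z\<^sup>2 + 2 * c2 / z ^ 3) + e * (Ln (z * a) + ein (z * a))"
  proof -
    have "Ln (z * of_real a) = Ln z + of_real (ln a)"
      using Ln_times_of_real[OF a z0] a by (simp add: Ln_of_real ac_simps)
    then show ?thesis unfolding H_def e_def by (simp add: poly_exp_prim_def)
  qed
  finally show ?thesis unfolding e_def by (simp add: ring_distribs)
qed

section \<open>The frequency integral\<close>

lemma pv_int_0_inf_cong:
  assumes "a > 0" and eq: "\<And>w. w \<ge> 0 \<Longrightarrow> w \<noteq> a \<Longrightarrow> f w = g w"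
  shows "pv_int_0_inf a f = pv_int_0_inf a g"
proof -
  have ev: "\<forall>\<^sub>F \<delta> in at_right 0. integral ({0..a - \<delta>} \<union> {a + \<delta>..}) f = integral ({0..a - \<delta>} \<union> {a + \<delta>..}) g"
    using eventually_at_right_less[of 0]
    by eventually_elim (use assms(1) in \<open>auto intro!: integral_cong eq\<close>)
  show ?thesis
    unfolding pv_int_0_inf_def Topological_Spaces.Lim_def tendsto_cong[OF ev] ..
qed

text \<open>Equal to - exp(-z) Ei(z) with the exponential integral Ei: the contribution of the pole
  w = 1. The name refers to the factor \<open>exp (- z)\<close>.\<close>

definition decaying_part :: "complex \<Rightarrow> complex" where
  "decaying_part z = - exp (- z) * (euler_mascheroni + Ln z + ein z)"

text \<open>Equal to exp(z) E_1(z): the contribution of the pole w = -1. The name refers to the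
  factor \<open>exp z\<close>.\<close>

definition growing_part :: "complex \<Rightarrow> complex" where
  "growing_part z = - exp z * (euler_mascheroni + Ln z + ein (- z))"

text \<open>\<open>kern d\<close> is the frequency integral \<open>\<Sum>\<^sub>\<plusminus> \<P>\<integral> w\<^sup>d e\<^sup>-\<^sup>z\<^sup>w / (w \<plusminus> 1) dw\<close>;
  \<open>kern 0\<close> is only needed because \<open>kern (n + 1)\<close> is minus the derivative of \<open>kern n\<close>.\<close>

definition kern :: "nat \<Rightarrow> complex \<Rightarrow> complex" where
  "kern n z = (if n = 0 then 0 else if n = 1 then 2 / z else if n = 2 then 2 / z\<^sup>2 else 4 / z ^ 3 + 2 / z)
     + decaying_part z + (-1) ^ n * growing_part z"

text \<open>Formally, differentiating the integral multiplies the integrand by -w, and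
  \<open>- w / (w - 1) = - 1 - 1 / (w - 1)\<close> while
  \<open>- w / (w + 1) = - 1 + 1 / (w + 1)\<close>; the constant -1 integrates to
  \<open>- 1 / z\<close>. The proof differentiates the closed forms.\<close>

lemma
  assumes "z \<notin> \<real>\<^sub>\<le>\<^sub>0"
  shows has_field_derivative_decaying_part: "(decaying_part has_field_derivative - decaying_part z - 1 / z) (at z)"
    and has_field_derivative_growing_part: "(growing_part has_field_derivative growing_part z - 1 / z) (at z)"
proof -
  have z: "z \<noteq> 0" "- z \<noteq> 0" using assms by auto
  have 1: "((\<lambda>z. ein z) has_field_derivative (exp z - 1) / z) (at z)"
    using has_field_derivative_ein[OF z(1)] .
  have 2: "((\<lambda>z. ein (- z)) has_field_derivative ((exp (- z) - 1) / - z) * (- 1)) (at z)"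
    by (rule DERIV_chain2[where f = ein and g = uminus, OF has_field_derivative_ein[OF z(2)]]) (auto intro!: derivative_eq_intros)
  have e: "exp z * exp (- z) = 1" "exp (- z) * exp z = 1" by (simp_all flip: exp_add)
  show "(decaying_part has_field_derivative - decaying_part z - 1 / z) (at z)"
    unfolding decaying_part_def[abs_def]
    by (rule derivative_eq_intros 1 assms refl)+ (use z e in \<open>simp add: field_simps\<close>)
  show "(growing_part has_field_derivative growing_part z - 1 / z) (at z)"
    unfolding growing_part_def[abs_def]
    by (rule derivative_eq_intros 2 assms refl)+ (use z e in \<open>simp add: field_simps\<close>)
qed

lemma has_field_derivative_kern:
  assumes "z \<notin> \<real>\<^sub>\<le>\<^sub>0" "n \<le> 2"
  shows "(kern n has_field_derivative - kern (Suc n) z) (at z)"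
proof -
  have z: "z \<noteq> 0" using assms by auto
  from assms(2) consider "n = 0" | "n = 1" | "n = 2" by linarith
  then show ?thesis
    unfolding kern_def[abs_def]
    by cases (use z in \<open>auto intro!: derivative_eq_intros has_field_derivative_decaying_part[OF assms(1)]
      has_field_derivative_growing_part[OF assms(1)] simp: field_simps power2_eq_square power3_eq_cube\<close>)
qed

text \<open>For s = 1 and s = -1 one has w^(n+2) / (w + s) = w^n (w - s) + w^n / (w + s), so summing
  over s leaves the integral of 2 w^(n+1) exp(-z w) as difference. These rational terms carry the
  strong singularity at 0: in the plane they become the source of Bessel's equation, in space they
  cancel between the two end points.\<close>

lemma kern_2: "kern 2 z = kern 0 z + 2 / z\<^sup>2" and kern_3: "kern 3 z = kern 1 z + 4 / z ^ 3"
  by (simp_all add: kern_def)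

lemma isCont_kern:
  assumes "z \<notin> \<real>\<^sub>\<le>\<^sub>0" "n \<le> 2"
  shows "isCont (kern n) z"
  using has_field_derivative_kern[OF assms] by (rule DERIV_isCont)

lemma isCont_kern3:
  assumes "z \<notin> \<real>\<^sub>\<le>\<^sub>0"
  shows "isCont (kern 3) z"
proof -
  have "z \<noteq> 0" using assms by auto
  then show ?thesis unfolding kern_3[abs_def]
    by (intro continuous_intros isCont_kern assms) auto
qed

lemma sum_pv_int_eq_kern:
  fixes a \<epsilon> kr c :: real
  assumes a: "a > 0" and \<epsilon>: "\<epsilon> > 0" and d: "d \<in> {1, 2, 3}"
  shows "(\<Sum>s\<in>{1, -1::real}. pv_int_0_inf a (\<lambda>w. complex_of_real (w ^ d / (w + s * a) / (2 * pi)) *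
            exp (\<i> * complex_of_real (w * kr / c)) * complex_of_real (exp (- \<epsilon> * w))))
    = a ^ d / (2 * pi) * kern d (a * (\<epsilon> - \<i> * (kr / c)))"
proof -
  define z where "z = complex_of_real \<epsilon> - \<i> * (kr / c)"
  have z: "Re z > 0" using \<epsilon> by (simp add: z_def)
  then have z0: "z \<noteq> 0" by auto
  have exp_z: "exp (\<i> * complex_of_real (w * kr / c)) * complex_of_real (exp (- \<epsilon> * w)) = exp (- z * w)" for w
    by (simp add: z_def exp_of_real[symmetric] exp_add[symmetric] algebra_simps)
  define q where "q = complex_of_real (1 / (2 * pi))"
  define A where "A = complex_of_real a"
  have A0: "A \<noteq> 0" using a by (simp add: A_def)
  \<comment> \<open>Coefficients of the quotient in the division of w^d by w + a; those of
    \<open>C'\<close> belong to w - a. The remainders are \<open>(- A) ^ d\<close> and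
    \<open>A ^ d\<close>.\<close>
  define C where "C = (if d = 1 then (1, 0, 0) else if d = 2 then (- A, 1, 0) else (A\<^sup>2, - A, 1 :: complex))"
  define C' where "C' = (if d = 1 then (1, 0, 0) else if d = 2 then (A, 1, 0) else (A\<^sup>2, A, 1 :: complex))"
  obtain c0 c1 c2 where C: "C = (c0, c1, c2)" by (metis prod_cases3)
  obtain c0' c1' c2' where C': "C' = (c0', c1', c2')" by (metis prod_cases3)
  have dv: "d = 1 \<or> d = 2 \<or> d = 3" using d by auto
  have plus: "pv_int_0_inf a (\<lambda>w. complex_of_real (w ^ d / (w + 1 * a) / (2 * pi)) *
            exp (\<i> * complex_of_real (w * kr / c)) * complex_of_real (exp (- \<epsilon> * w)))
     = q * (c0 / z + c1 / z\<^sup>2 + 2 * c2 / z ^ 3 + (- A) ^ d * growing_part (z * A))"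
  proof -
    have "pv_int_0_inf a (\<lambda>w. complex_of_real (w ^ d / (w + 1 * a) / (2 * pi)) *
            exp (\<i> * complex_of_real (w * kr / c)) * complex_of_real (exp (- \<epsilon> * w)))
      = pv_int_0_inf a (\<lambda>w. (q * c0 + q * c1 * of_real w + q * c2 * (of_real w)\<^sup>2 + q * (- A) ^ d / of_real (w + a))
         * exp (- z * of_real w))"
    proof (rule pv_int_0_inf_cong[OF a])
      fix w :: real assume "w \<ge> 0" "w \<noteq> a"
      then have w: "complex_of_real w + A \<noteq> 0" using a by (simp add: A_def flip: of_real_add)
      have "complex_of_real (w ^ d / (w + 1 * a) / (2 * pi)) = q * (of_real w ^ d / (of_real w + A))"
        by (simp add: q_def A_def)
      also have "complex_of_real w ^ d / (of_real w + A) = c0 + c1 * of_real w + c2 * (of_real w)\<^sup>2 + (- A) ^ d / of_real (w + a)"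
        using dv C w by (elim disjE) (auto simp: C_def A_def[symmetric] field_simps power2_eq_square power3_eq_cube)
      finally show "complex_of_real (w ^ d / (w + 1 * a) / (2 * pi)) *
            exp (\<i> * complex_of_real (w * kr / c)) * complex_of_real (exp (- \<epsilon> * w))
         = (q * c0 + q * c1 * of_real w + q * c2 * (of_real w)\<^sup>2 + q * (- A) ^ d / of_real (w + a)) * exp (- z * of_real w)"
        unfolding mult.assoc exp_z by (simp add: ring_distribs)
    qed
    also have "\<dots> = q * (c0 / z + c1 / z\<^sup>2 + 2 * c2 / z ^ 3 + (- A) ^ d * growing_part (z * A))"
      unfolding pv_int_plus[OF z a] by (simp add: growing_part_def ln_ein_def A_def algebra_simps)
    finally show ?thesis .
  qed
  have minus: "pv_int_0_inf a (\<lambda>w. complex_of_real (w ^ d / (w + (-1) * a) / (2 * pi)) *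
            exp (\<i> * complex_of_real (w * kr / c)) * complex_of_real (exp (- \<epsilon> * w)))
     = q * (c0' / z + c1' / z\<^sup>2 + 2 * c2' / z ^ 3 + A ^ d * decaying_part (z * A))"
  proof -
    have "pv_int_0_inf a (\<lambda>w. complex_of_real (w ^ d / (w + (-1) * a) / (2 * pi)) *
            exp (\<i> * complex_of_real (w * kr / c)) * complex_of_real (exp (- \<epsilon> * w)))
      = pv_int_0_inf a (\<lambda>w. (q * c0' + q * c1' * of_real w + q * c2' * (of_real w)\<^sup>2 + q * A ^ d / of_real (w - a))
         * exp (- z * of_real w))"
    proof (rule pv_int_0_inf_cong[OF a])
      fix w :: real assume "w \<ge> 0" "w \<noteq> a"
      then have w: "complex_of_real w - A \<noteq> 0" by (simp add: A_def)
      have "complex_of_real (w ^ d / (w + (-1) * a) / (2 * pi)) = q * (of_real w ^ d / (of_real w - A))"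
        by (simp add: q_def A_def)
      also have "complex_of_real w ^ d / (of_real w - A) = c0' + c1' * of_real w + c2' * (of_real w)\<^sup>2 + A ^ d / of_real (w - a)"
        using dv C' w by (elim disjE) (auto simp: C'_def A_def[symmetric] field_simps power2_eq_square power3_eq_cube)
      finally show "complex_of_real (w ^ d / (w + (-1) * a) / (2 * pi)) *
            exp (\<i> * complex_of_real (w * kr / c)) * complex_of_real (exp (- \<epsilon> * w))
         = (q * c0' + q * c1' * of_real w + q * c2' * (of_real w)\<^sup>2 + q * A ^ d / of_real (w - a)) * exp (- z * of_real w)"
        unfolding mult.assoc exp_z by (simp add: ring_distribs)
    qed
    also have "\<dots> = q * (c0' / z + c1' / z\<^sup>2 + 2 * c2' / z ^ 3 + A ^ d * decaying_part (z * A))"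
      unfolding pv_int_minus[OF z a] by (simp add: decaying_part_def A_def algebra_simps)
    finally show ?thesis .
  qed
  have "(\<Sum>s\<in>{1, -1::real}. pv_int_0_inf a (\<lambda>w. complex_of_real (w ^ d / (w + s * a) / (2 * pi)) *
            exp (\<i> * complex_of_real (w * kr / c)) * complex_of_real (exp (- \<epsilon> * w))))
     = q * (c0 / z + c1 / z\<^sup>2 + 2 * c2 / z ^ 3 + (- A) ^ d * growing_part (z * A))
     + q * (c0' / z + c1' / z\<^sup>2 + 2 * c2' / z ^ 3 + A ^ d * decaying_part (z * A))"
    unfolding plus[symmetric] minus[symmetric] by simp
  also have "\<dots> = q * (A ^ d * kern d (A * z))"
    using dv C C' z0 A0
    by (elim disjE) (auto simp: C_def C'_def kern_def field_simps power2_eq_square power3_eq_cube)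
  finally show ?thesis by (simp add: q_def A_def z_def)
qed

section \<open>The kernel on the imaginary axis and at the branch point\<close>

lemma Ln_i_times_diff:
  assumes "x > 0"
  shows "Ln (\<i> * of_real x) - Ln (- \<i> * of_real x) = \<i> * pi"
proof -
  have "Ln (of_real x * \<i>) = of_real (ln x) + Ln \<i>" "Ln (of_real x * - \<i>) = of_real (ln x) + Ln (- \<i>)"
    using Ln_times_of_real[OF assms, of \<i>] Ln_times_of_real[OF assms, of "- \<i>"] assms
    by (simp_all add: Ln_of_real del: mult_minus_right)
  then show ?thesis by (simp add: mult.commute)
qed

text \<open>Replacing z by -z exchanges \<open>decaying_part\<close> and \<open>growing_part\<close>
  except for their logarithms, so Euler's constant and \<open>ein\<close> drop out and the jump
  remains. In \<open>kern 1\<close> the two parts have opposite signs, hence a sum takes the place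
  of the difference there.\<close>

lemma kern_0_imaginary:
  assumes "x > 0"
  shows "kern 0 (- \<i> * of_real x) - kern 0 (\<i> * of_real x) = 2 * pi * \<i> * cos x"
proof -
  have "kern 0 (- \<i> * of_real x) - kern 0 (\<i> * of_real x)
      = (exp (\<i> * of_real x) + exp (- (\<i> * of_real x))) * (Ln (\<i> * of_real x) - Ln (- \<i> * of_real x))"
    by (simp add: kern_def decaying_part_def growing_part_def algebra_simps)
  also have "\<dots> = 2 * cos (of_real x) * (\<i> * pi)"
    unfolding Ln_i_times_diff[OF assms] by (simp add: cos_exp_eq)
  finally show ?thesis by (simp add: cos_of_real)
qed

lemma kern_1_imaginary:
  assumes "x > 0"
  shows "kern 1 (- \<i> * of_real x) + kern 1 (\<i> * of_real x) = - 2 * pi * sin x"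
proof -
  have "kern 1 (- \<i> * of_real x) + kern 1 (\<i> * of_real x)
      = (exp (\<i> * of_real x) - exp (- (\<i> * of_real x))) * (Ln (\<i> * of_real x) - Ln (- \<i> * of_real x))"
    by (simp add: kern_def decaying_part_def growing_part_def algebra_simps)
  also have "\<dots> = (2 * \<i> * sin (of_real x)) * (\<i> * pi)"
    unfolding Ln_i_times_diff[OF assms] by (simp add: sin_exp_eq)
  finally show ?thesis by (simp add: sin_of_real)
qed

text \<open>This governs the planar radial function at distance 0, where all directions contribute
  the same value. The combined coefficient \<open>2 - exp (- \<eta>) - exp \<eta>\<close> of the
  logarithm is of second order at 0 and outweighs it.\<close>

lemma kern_0_at_0:
  "((\<lambda>\<eta>. kern 0 (of_real \<eta>) + of_real (2 * ln \<eta>)) \<longlongrightarrow> of_real (- 2 * euler_mascheroni)) (at_right 0)"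
proof -
  let ?f = "\<lambda>\<eta>::real. (2 - exp (- \<eta>) - exp \<eta>) * ln \<eta> - (exp (- \<eta>) + exp \<eta>) * euler_mascheroni
      - exp (- \<eta>) * ein \<eta> - exp \<eta> * ein (- \<eta>)"
  have "((\<lambda>\<eta>::real. (2 - exp (- \<eta>) - exp \<eta>) * ln \<eta>) \<longlongrightarrow> 0) (at_right 0)" by real_asymp
  then have "(?f \<longlongrightarrow> 0 - (exp (- 0) + exp 0) * euler_mascheroni - exp (- 0) * ein 0 - exp 0 * ein (- 0)) (at_right 0)"
    by (intro tendsto_intros)
  then have "((\<lambda>\<eta>. complex_of_real (?f \<eta>)) \<longlongrightarrow> of_real (- 2 * euler_mascheroni)) (at_right 0)"
    by (intro tendsto_of_real) simp
  moreover have "\<forall>\<^sub>F \<eta> in at_right 0. complex_of_real (?f \<eta>) = kern 0 (of_real \<eta>) + of_real (2 * ln \<eta>)"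
    using eventually_at_right_less[of 0]
  proof eventually_elim
    case (elim \<eta>)
    have k: "kern 0 (of_real \<eta>) = of_real (- exp (- \<eta>) * (euler_mascheroni + ln \<eta> + ein \<eta>)
        - exp \<eta> * (euler_mascheroni + ln \<eta> + ein (- \<eta>)))"
    proof -
      have "exp (- complex_of_real \<eta>) = of_real (exp (- \<eta>))" "exp (complex_of_real \<eta>) = of_real (exp \<eta>)"
        "ein (- complex_of_real \<eta>) = of_real (ein (- \<eta>))"
        by (simp_all flip: exp_of_real ein_of_real)
      then show ?thesis
        using elim by (simp add: kern_def decaying_part_def growing_part_def Ln_of_real ein_of_real)
    qed
    show ?case unfolding k by (simp add: algebra_simps)
  qed
  ultimately show ?thesis by (rule Lim_transform_eventually)
qed

section \<open>Bessel functions\<close>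

definition bessel_coeff :: "nat \<Rightarrow> real" where
  "bessel_coeff n = (-1) ^ n / (4 ^ n * (fact n)\<^sup>2)"

text \<open>Euler's constant and -ln 2 are put into the coefficients, so that Y_0 becomes
  \<open>ln x * J0 x\<close> plus an even power series, up to the factor 2 / pi.\<close>

definition bessel_log_coeff :: "nat \<Rightarrow> real" where
  "bessel_log_coeff n = bessel_coeff n * (euler_mascheroni - ln 2 - harm n)"

text \<open>A power series in x^2. Below, \<open>diffs\<close> stands for differentiation in that
  variable, which explains the factors 2 x in \<open>J0'\<close> and \<open>Y0'\<close>.\<close>

definition even_series :: "(nat \<Rightarrow> real) \<Rightarrow> real \<Rightarrow> real" where
  "even_series c x = (\<Sum>n. c n * (x\<^sup>2) ^ n)"

definition J0 :: "real \<Rightarrow> real" where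
  "J0 = even_series bessel_coeff"

definition J0' :: "real \<Rightarrow> real" where
  "J0' x = 2 * x * even_series (diffs bessel_coeff) x"

definition Y0 :: "real \<Rightarrow> real" where
  "Y0 x = 2 / pi * (ln x * J0 x + even_series bessel_log_coeff x)"

definition Y0' :: "real \<Rightarrow> real" where
  "Y0' x = 2 / pi * (J0 x / x + ln x * J0' x + 2 * x * even_series (diffs bessel_log_coeff) x)"

lemma summable_powser_if_le_fact:
  fixes c :: "nat \<Rightarrow> real"
  assumes "\<And>n. \<bar>c n\<bar> \<le> C / fact n"
  shows "summable (\<lambda>n. c n * y ^ n)"
proof (rule summable_comparison_test'[where N = 0])
  show "summable (\<lambda>n. C * (inverse (fact n) * \<bar>y\<bar> ^ n))"
    by (intro summable_mult summable_exp)
  fix n :: nat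
  have "\<bar>c n\<bar> * \<bar>y\<bar> ^ n \<le> C / fact n * \<bar>y\<bar> ^ n"
    by (intro mult_right_mono assms) auto
  then show "norm (c n * y ^ n) \<le> C * (inverse (fact n) * \<bar>y\<bar> ^ n)"
    by (simp add: abs_mult power_abs field_simps)
qed

lemma harm_le: "harm n \<le> real n"
proof -
  have "harm n \<le> (\<Sum>k\<in>{1..n}. 1 :: real)"
    unfolding harm_def by (intro sum_mono) (auto simp: inverse_eq_divide)
  then show ?thesis by simp
qed

lemma bessel_coeff_le: "\<bar>bessel_coeff n\<bar> \<le> 1 / (4 ^ n * fact n)"
proof -
  have "(4::real) ^ n * fact n * 1 \<le> 4 ^ n * fact n * fact n"
    by (intro mult_left_mono) auto
  then show ?thesis
    by (simp add: bessel_coeff_def abs_mult power2_eq_square power_abs divide_simps)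
qed

lemma
  shows summable_bessel_coeff: "summable (\<lambda>n. bessel_coeff n * y ^ n)"
    and summable_bessel_log_coeff: "summable (\<lambda>n. bessel_log_coeff n * y ^ n)"
proof -
  have le: "1 / (4 ^ n * fact n) \<le> 1 / (fact n :: real)" for n :: nat
    by (intro divide_left_mono) (auto simp: mult_le_cancel_right1)
  show "summable (\<lambda>n. bessel_coeff n * y ^ n)"
    using order.trans[OF bessel_coeff_le le] by (rule summable_powser_if_le_fact)
  let ?k = "\<bar>euler_mascheroni - ln 2 :: real\<bar>"
  show "summable (\<lambda>n. bessel_log_coeff n * y ^ n)"
  proof (rule summable_powser_if_le_fact)
    fix n :: nat
    have h: "0 \<le> (harm n :: real)" "harm n \<le> real n" by (auto simp: harm_nonneg harm_le)
    have "real n < 2 ^ n" by (rule of_nat_less_two_power)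
    also have "(2::real) ^ n \<le> 4 ^ n" by (intro power_mono) auto
    finally have n: "real n \<le> 4 ^ n" by simp
    have "\<bar>euler_mascheroni - ln 2 - harm n\<bar> \<le> ?k + real n" using h by linarith
    also have "\<dots> \<le> ?k * 4 ^ n + 1 * 4 ^ n" using n by (intro add_mono) (auto simp: mult_le_cancel_left1)
    also have "\<dots> = (?k + 1) * 4 ^ n" by (simp add: ring_distribs)
    finally have "\<bar>bessel_log_coeff n\<bar> \<le> 1 / (4 ^ n * fact n) * ((?k + 1) * 4 ^ n)"
      unfolding bessel_log_coeff_def abs_mult by (intro mult_mono bessel_coeff_le) auto
    then show "\<bar>bessel_log_coeff n\<bar> \<le> (?k + 1) / fact n" by simp
  qed
qed

lemma bessel_coeff_Suc: "4 * (real n + 1)\<^sup>2 * bessel_coeff (Suc n) = - bessel_coeff n"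
  by (simp add: bessel_coeff_def power2_eq_square divide_simps) (simp add: algebra_simps)

text \<open>The increment 1 / (n + 1) of the harmonic numbers produces the extra term; it will
  offset what the derivatives of \<open>ln x\<close> add to Bessel's equation.\<close>

lemma bessel_log_coeff_Suc:
  "4 * (real n + 1)\<^sup>2 * bessel_log_coeff (Suc n) = - bessel_log_coeff n - 4 * diffs bessel_coeff n"
proof -
  let ?k = "euler_mascheroni - ln 2 :: real"
  have "4 * (real n + 1)\<^sup>2 * bessel_log_coeff (Suc n)
      = 4 * (real n + 1)\<^sup>2 * bessel_coeff (Suc n) * (?k - harm n - 1 / (real n + 1))"
    by (simp add: bessel_log_coeff_def harm_Suc inverse_eq_divide ac_simps)
  also have "\<dots> = 4 * (real n + 1)\<^sup>2 * bessel_coeff (Suc n) * (?k - harm n) - 4 * (real n + 1) * bessel_coeff (Suc n)"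
    by (simp add: power2_eq_square field_simps)
  finally show ?thesis
    unfolding bessel_coeff_Suc by (simp add: bessel_log_coeff_def diffs_def)
qed

text \<open>For f(x) = p(x^2) the expression f'' + f' / x equals 4 p'(x^2) + 4 x^2 p''(x^2).
  Bessel's equation thereby becomes a recurrence for the coefficients.\<close>

lemma
  fixes c :: "nat \<Rightarrow> real"
  assumes c: "\<And>y. summable (\<lambda>n. c n * y ^ n)"
  shows has_real_derivative_even_series:
      "(even_series c has_real_derivative 2 * x * even_series (diffs c) x) (at x)"
    and even_series_bessel_operator:
      "4 * even_series (diffs c) x + 4 * x\<^sup>2 * even_series (diffs (diffs c)) x
        = even_series (\<lambda>n. 4 * (real n + 1)\<^sup>2 * c (Suc n)) x"
proof -
  have c1: "summable (\<lambda>n. diffs c n * y ^ n)" for y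
    using termdiff_converges_all[OF c] by simp
  have c2: "summable (\<lambda>n. diffs (diffs c) n * y ^ n)" for y
    using termdiff_converges_all[OF c1] by simp
  show "(even_series c has_real_derivative 2 * x * even_series (diffs c) x) (at x)"
    unfolding even_series_def[abs_def]
    by (rule DERIV_cong[OF DERIV_chain2[OF termdiffs_strong_converges_everywhere[OF c]]])
      (auto intro!: derivative_eq_intros)
  let ?y = "x\<^sup>2"
  have 1: "(\<lambda>n. diffs c n * ?y ^ n) sums even_series (diffs c) x"
    unfolding even_series_def by (intro summable_sums c1)
  have "(\<lambda>n. diffs (diffs c) n * ?y ^ n) sums even_series (diffs (diffs c)) x"
    unfolding even_series_def by (intro summable_sums c2)
  then have "(\<lambda>n. diffs (diffs c) n * ?y ^ n * ?y) sums (even_series (diffs (diffs c)) x * ?y)"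
    by (rule sums_mult2)
  then have "(\<lambda>n. real (Suc n) * diffs c (Suc n) * ?y ^ Suc n) sums (even_series (diffs (diffs c)) x * ?y)"
    by (simp add: diffs_def ac_simps)
  then have 2: "(\<lambda>n. real n * diffs c n * ?y ^ n) sums (even_series (diffs (diffs c)) x * ?y)"
    by (subst (asm) sums_Suc_iff) simp
  have "(\<lambda>n. 4 * (diffs c n * ?y ^ n) + 4 * (real n * diffs c n * ?y ^ n)) sums
      (4 * even_series (diffs c) x + 4 * (even_series (diffs (diffs c)) x * ?y))"
    by (intro sums_add sums_mult 1 2)
  moreover have "4 * (diffs c n * ?y ^ n) + 4 * (real n * diffs c n * ?y ^ n)
      = 4 * (real n + 1)\<^sup>2 * c (Suc n) * ?y ^ n" for n
    by (simp add: diffs_def power2_eq_square algebra_simps)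
  ultimately show "4 * even_series (diffs c) x + 4 * x\<^sup>2 * even_series (diffs (diffs c)) x
        = even_series (\<lambda>n. 4 * (real n + 1)\<^sup>2 * c (Suc n)) x"
    unfolding even_series_def[of "\<lambda>n. 4 * (real n + 1)\<^sup>2 * c (Suc n)"] by (simp add: sums_iff)
qed

lemmas summable_diffs_bessel_coeff = termdiff_converges_all[OF summable_bessel_coeff]
lemmas summable_diffs_bessel_log_coeff = termdiff_converges_all[OF summable_bessel_log_coeff]

lemma has_real_derivative_J0: "(J0 has_real_derivative J0' x) (at x)"
  unfolding J0_def J0'_def by (intro has_real_derivative_even_series summable_bessel_coeff)

text \<open>Bessel's equation in the self-adjoint form (x y')' = - x y. It makes sense at x = 0 as
  well, and Wronskians can be differentiated from it without second derivatives.\<close>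

lemma J0_ode: "((\<lambda>x. x * J0' x) has_real_derivative - x * J0 x) (at x)"
proof -
  note d = has_real_derivative_even_series[OF summable_diffs_bessel_coeff]
  have op: "4 * even_series (diffs bessel_coeff) x + 4 * x\<^sup>2 * even_series (diffs (diffs bessel_coeff)) x = - J0 x"
    unfolding even_series_bessel_operator[OF summable_bessel_coeff] bessel_coeff_Suc
    using suminf_minus[OF summable_bessel_coeff] by (simp add: even_series_def J0_def)
  have "((\<lambda>x. x * J0' x) has_real_derivative
      x * (4 * even_series (diffs bessel_coeff) x + 4 * x\<^sup>2 * even_series (diffs (diffs bessel_coeff)) x)) (at x)"
    unfolding J0'_def[abs_def]
    by (rule derivative_eq_intros d refl)+ (simp add: algebra_simps power2_eq_square)
  then show ?thesis unfolding op by simp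
qed

lemma has_real_derivative_Y0:
  assumes "x > 0"
  shows "(Y0 has_real_derivative Y0' x) (at x)"
  unfolding Y0_def[abs_def] Y0'_def
  by (rule derivative_eq_intros has_real_derivative_J0
      has_real_derivative_even_series[OF summable_bessel_log_coeff] assms refl)+ (simp add: field_simps)

lemma Y0_ode:
  assumes "x > 0"
  shows "((\<lambda>x. x * Y0' x) has_real_derivative - x * Y0 x) (at x)"
proof -
  note d = has_real_derivative_even_series[OF summable_diffs_bessel_log_coeff]
  let ?v = "even_series (diffs bessel_log_coeff)"
  let ?j1 = "even_series (diffs bessel_coeff) x"
  \<comment> \<open>After multiplication by x the term \<open>- 4 * ?j1\<close> is
    \<open>- 2 * J0' x\<close>; it cancels the two copies of \<open>J0' x\<close> that the
    logarithmic part produces.\<close>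
  have op: "4 * ?v x + 4 * x\<^sup>2 * even_series (diffs (diffs bessel_log_coeff)) x
      = - even_series bessel_log_coeff x - 4 * ?j1"
  proof -
    have "(\<lambda>n. - (bessel_log_coeff n * (x\<^sup>2) ^ n) - 4 * (diffs bessel_coeff n * (x\<^sup>2) ^ n)) sums
        (- even_series bessel_log_coeff x - 4 * ?j1)"
      unfolding even_series_def
      by (intro sums_diff sums_minus sums_mult summable_sums summable_bessel_log_coeff summable_diffs_bessel_coeff)
    then show ?thesis
      unfolding even_series_bessel_operator[OF summable_bessel_log_coeff] bessel_log_coeff_Suc
      by (simp add: even_series_def sums_iff algebra_simps)
  qed
  let ?D = "2 / pi * (J0' x + (1 / x * (x * J0' x) + ln x * (- x * J0 x))
      + (4 * x * ?v x + 2 * x\<^sup>2 * (2 * x * even_series (diffs (diffs bessel_log_coeff)) x)))"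
  have "((\<lambda>x. 2 / pi * (J0 x + ln x * (x * J0' x) + 2 * x\<^sup>2 * ?v x)) has_real_derivative ?D) (at x)"
  proof (intro DERIV_cmult DERIV_add has_real_derivative_J0)
    show "((\<lambda>x. ln x * (x * J0' x)) has_real_derivative 1 / x * (x * J0' x) + ln x * (- x * J0 x)) (at x)"
      by (rule DERIV_cong[OF DERIV_mult[OF DERIV_ln_divide[OF assms] J0_ode]]) (simp add: ac_simps)
    show "((\<lambda>x. 2 * x\<^sup>2 * ?v x) has_real_derivative
        4 * x * ?v x + 2 * x\<^sup>2 * (2 * x * even_series (diffs (diffs bessel_log_coeff)) x)) (at x)"
      by (rule derivative_eq_intros d refl)+ (simp add: ac_simps)
  qed
  moreover have "?D = - x * Y0 x"
  proof -
    have "?D = 2 / pi * (2 * J0' x - x * ln x * J0 x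
        + x * (4 * ?v x + 4 * x\<^sup>2 * even_series (diffs (diffs bessel_log_coeff)) x))"
      using assms by (simp add: field_simps power2_eq_square)
    also have "\<dots> = - x * Y0 x"
      unfolding op J0'_def Y0_def by (simp add: field_simps)
    finally show ?thesis .
  qed
  ultimately have "((\<lambda>x. 2 / pi * (J0 x + ln x * (x * J0' x) + 2 * x\<^sup>2 * ?v x)) has_real_derivative - x * Y0 x) (at x)"
    by simp
  then show ?thesis
    by (rule has_field_derivative_transform_within_open[where S = "{0<..}"])
      (use assms in \<open>auto simp: Y0'_def field_simps power2_eq_square\<close>)
qed

text \<open>By the functional equation the value is \<open>rGamma (1 + \<beta>)\<close> divided by
  \<open>pochhammer (1 + \<beta>) m\<close>, a product whose first factor is at least 1/2 and whose
  others are at least 1. Uniformity in m serves the Weierstrass test for the Bessel series as a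
  function of its order.\<close>

lemma rGamma_shift_bounded:
  obtains C where "\<And>m \<beta>. \<bar>\<beta>\<bar> \<le> 1/2 \<Longrightarrow> \<bar>rGamma (real m + \<beta> + 1)\<bar> \<le> C"
proof -
  have "continuous_on {1/2..3/2::real} rGamma"
    by (intro continuous_intros)
  then have "bounded (rGamma ` {1/2..3/2::real})"
    by (intro compact_imp_bounded compact_continuous_image) auto
  then obtain B where B: "\<And>x. x \<in> {1/2..3/2} \<Longrightarrow> \<bar>rGamma (x::real)\<bar> \<le> B"
    unfolding bounded_iff by force
  have "\<bar>rGamma (real m + \<beta> + 1)\<bar> \<le> 2 * B" if \<beta>: "\<bar>\<beta>\<bar> \<le> 1/2" for m \<beta>
  proof -
    have "1/2 \<le> pochhammer (1 + \<beta>) m"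
    proof (induction m)
      case (Suc m)
      show ?case
      proof (cases m)
        case 0
        then show ?thesis using \<beta> by simp
      next
        case (Suc k)
        then have "1 + \<beta> + real m \<ge> 1" using \<beta> by simp
        then have "pochhammer (1 + \<beta>) m * 1 \<le> pochhammer (1 + \<beta>) m * (1 + \<beta> + real m)"
          using Suc.IH by (intro mult_left_mono) auto
        with Suc.IH show ?thesis unfolding pochhammer_Suc by linarith
      qed
    qed simp
    then have p: "pochhammer (1 + \<beta>) m \<ge> 1/2" "pochhammer (1 + \<beta>) m > 0" by auto
    have "rGamma (1 + \<beta>) = pochhammer (1 + \<beta>) m * rGamma (real m + \<beta> + 1)"
      using pochhammer_rGamma[of "1 + \<beta>" m] by (simp add: ac_simps)
    then have "\<bar>rGamma (real m + \<beta> + 1)\<bar> = \<bar>rGamma (1 + \<beta>)\<bar> / pochhammer (1 + \<beta>) m"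
      using p by (simp add: abs_mult)
    also have "\<dots> \<le> B / (1/2)"
    proof (intro frac_le)
      show "\<bar>rGamma (1 + \<beta>)\<bar> \<le> B" by (rule B) (use \<beta> in \<open>auto simp: abs_le_iff\<close>)
      then show "0 \<le> B" by linarith
    qed (use p in auto)
    finally show ?thesis by simp
  qed
  then show ?thesis by (rule that)
qed

text \<open>Monotonicity reduces the claim to the values at 1/2 and at an integer, the latter being
  a harmonic number minus Euler's constant. Linear growth in m is harmless next to the 1 / m! in the
  Bessel series.\<close>

lemma Digamma_shift_bounded:
  obtains D where "D \<ge> 0" "\<And>m \<beta>. \<bar>\<beta>\<bar> \<le> 1/2 \<Longrightarrow> \<bar>Digamma (real m + \<beta> + 1)\<bar> \<le> D + real m"
proof
  let ?D = "\<bar>Digamma (1/2::real)\<bar> + 1 + \<bar>euler_mascheroni\<bar>"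
  show "?D \<ge> 0" by simp
  fix m :: nat and \<beta> :: real
  assume \<beta>: "\<bar>\<beta>\<bar> \<le> 1/2"
  have "Digamma (1/2) \<le> Digamma (real m + \<beta> + 1)" using \<beta> by (intro Digamma_real_mono) auto
  moreover have "Digamma (real m + \<beta> + 1) \<le> Digamma (real (Suc (Suc m)))"
    using \<beta> by (intro Digamma_real_mono) auto
  moreover have "Digamma (real (Suc (Suc m))) = harm (Suc m) - euler_mascheroni"
    by (rule Digamma_of_nat)
  moreover have "harm (Suc m) \<le> real (Suc m)" by (rule harm_le)
  ultimately show "\<bar>Digamma (real m + \<beta> + 1)\<bar> \<le> ?D + real m" by simp
qed

text \<open>Termwise differentiation in the order turns rGamma into - rGamma Digamma, and Digamma at
  the positive integers supplies the harmonic numbers of the logarithmic series. This derivative is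
  what the limit defining \<open>bessel_Y 0\<close> depends on.\<close>

lemma has_real_derivative_bessel_J_order:
  assumes x: "x > 0"
  shows "((\<lambda>\<beta>. bessel_J \<beta> x) has_real_derivative pi / 2 * Y0 x) (at 0)"
    and "bessel_J 0 x = J0 x"
proof -
  obtain C where C: "\<And>m \<beta>. \<bar>\<beta>\<bar> \<le> 1/2 \<Longrightarrow> \<bar>rGamma (real m + \<beta> + 1)\<bar> \<le> C"
    using rGamma_shift_bounded by blast
  obtain D where D: "D \<ge> 0" "\<And>m \<beta>. \<bar>\<beta>\<bar> \<le> 1/2 \<Longrightarrow> \<bar>Digamma (real m + \<beta> + 1)\<bar> \<le> D + real m"
    using Digamma_shift_bounded by blast
  have C0: "C \<ge> 0" using C[of 0 0] by linarith
  define a where "a m = (-1) ^ m * ((x / 2)\<^sup>2) ^ m / fact m" for m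
  define f where "f m \<beta> = a m * rGamma (real m + \<beta> + 1)" for m \<beta>
  define f' where "f' m \<beta> = a m * (- rGamma (real m + \<beta> + 1) * Digamma (real m + \<beta> + 1))" for m \<beta>
  let ?S = "{-1/2..1/2::real}"
  have a_abs: "\<bar>a m\<bar> = ((x / 2)\<^sup>2) ^ m / fact m" for m
    using x by (simp add: a_def abs_mult power_abs)
  have bound: "\<bar>f' m \<beta>\<bar> \<le> C * (D + 1) * ((2 * (x / 2)\<^sup>2) ^ m / fact m)" if "\<beta> \<in> ?S" for m \<beta>
  proof -
    have \<beta>: "\<bar>\<beta>\<bar> \<le> 1/2" using that by (auto simp: abs_le_iff)
    have m2: "real m + 1 \<le> 2 ^ m"
      by (induction m) auto
    have "D + real m \<le> (D + 1) * (real m + 1)" using D(1) by (simp add: algebra_simps)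
    also have "\<dots> \<le> (D + 1) * 2 ^ m" using D(1) m2 by (intro mult_left_mono) auto
    finally have "\<bar>Digamma (real m + \<beta> + 1)\<bar> \<le> (D + 1) * 2 ^ m" using D(2)[OF \<beta>, of m] by linarith
    then have "\<bar>a m\<bar> * (\<bar>rGamma (real m + \<beta> + 1)\<bar> * \<bar>Digamma (real m + \<beta> + 1)\<bar>) \<le> \<bar>a m\<bar> * (C * ((D + 1) * 2 ^ m))"
      using C[OF \<beta>, of m] C0 by (intro mult_left_mono mult_mono) auto
    then show ?thesis unfolding f'_def a_abs abs_mult abs_minus_cancel
      by (simp add: power_mult_distrib ac_simps)
  qed
  have S: "convex ?S" "(0::real) \<in> ?S" "(0::real) \<in> interior ?S" by auto
  have der: "(f m has_real_derivative f' m \<beta>) (at \<beta> within ?S)" if "\<beta> \<in> ?S" for m \<beta>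
  proof -
    have "real m + \<beta> + 1 > 0" using that by auto
    then have "real m + \<beta> + 1 \<notin> \<int>\<^sub>\<le>\<^sub>0" by (auto elim!: nonpos_Ints_cases)
    then have "(rGamma has_real_derivative - rGamma (real m + \<beta> + 1) * Digamma (real m + \<beta> + 1)) (at (real m + \<beta> + 1))"
      by (rule has_field_derivative_rGamma_no_nonpos_int)
    then have "((\<lambda>\<beta>. rGamma (real m + \<beta> + 1)) has_real_derivative
        - rGamma (real m + \<beta> + 1) * Digamma (real m + \<beta> + 1) * 1) (at \<beta> within ?S)"
      by (rule DERIV_chain2) (auto intro!: derivative_eq_intros)
    then show ?thesis unfolding f_def f'_def by (intro DERIV_cmult) simp
  qed
  have sm: "summable (\<lambda>m. C * (D + 1) * ((2 * (x / 2)\<^sup>2) ^ m / fact m))"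
    using summable_exp[of "2 * (x / 2)\<^sup>2"] by (intro summable_mult) (simp add: field_simps)
  have uc: "uniformly_convergent_on ?S (\<lambda>n \<beta>. \<Sum>i<n. f' i \<beta>)"
    by (rule Weierstrass_m_test'[OF _ sm]) (use bound in auto)
  have f0: "f m 0 = bessel_coeff m * (x\<^sup>2) ^ m" for m
  proof -
    have "rGamma (real m + 0 + 1) = inverse (fact m)"
      using Gamma_fact[of m, where ?'a = real] by (simp add: rGamma_inverse_Gamma add.commute)
    then show ?thesis
      by (simp add: f_def a_def bessel_coeff_def power_divide power2_eq_square power_mult_distrib field_simps)
  qed
  have sf0: "summable (\<lambda>m. f m 0)" unfolding f0 by (rule summable_bessel_coeff)
  note ser = has_field_derivative_series'[where f = f and f' = f' and S = ?S, OF S(1) der uc S(2) sf0]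
  define g where "g \<beta> = (\<Sum>m. f m \<beta>)" for \<beta>
  have dg: "(g has_real_derivative (\<Sum>m. f' m 0)) (at 0)"
    unfolding g_def[abs_def] using ser(2)[OF _ S(3)] by blast
  have g0: "g 0 = J0 x" unfolding g_def f0 by (simp add: J0_def even_series_def)
  \<comment> \<open>The summand with \<open>ln 2\<close> undoes the -ln 2 inside
    \<open>bessel_log_coeff\<close>. Later it turns \<open>ln (x / 2)\<close>, the derivative of the
    power factored out in \<open>J\<close>, into \<open>ln x\<close>.\<close>
  have f'0: "f' m 0 = bessel_log_coeff m * (x\<^sup>2) ^ m + ln 2 * (bessel_coeff m * (x\<^sup>2) ^ m)" for m
  proof -
    have "Digamma (real m + 0 + 1) = harm m - euler_mascheroni"
      using Digamma_of_nat[of m, where ?'a = real] by (simp add: add.commute)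
    then have "f' m 0 = f m 0 * (euler_mascheroni - harm m)" unfolding f'_def f_def by (simp only: ring_distribs)
    then show ?thesis unfolding f0 by (simp add: bessel_log_coeff_def algebra_simps)
  qed
  have s': "(\<Sum>m. f' m 0) = even_series bessel_log_coeff x + ln 2 * J0 x"
    unfolding f'0 J0_def even_series_def
    by (subst suminf_add[symmetric]) (auto intro!: summable_mult summable_bessel_coeff summable_bessel_log_coeff
        simp: suminf_mult[OF summable_bessel_coeff])
  \<comment> \<open>With \<open>(x / 2) powr \<beta>\<close> factored out, the remaining series
    depends on the order through rGamma only.\<close>
  have J: "bessel_J \<beta> x = (x / 2) powr \<beta> * g \<beta>" if "\<beta> \<in> {-1/2<..<1/2}" for \<beta>
  proof -
    have sum: "summable (\<lambda>m. f m \<beta>)" using ser(1)[of \<beta>] that by auto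
    have "(-1) ^ m * rGamma (real m + \<beta> + 1) / fact m * (x / 2) powr (2 * real m + \<beta>) = (x / 2) powr \<beta> * f m \<beta>" for m
    proof -
      have "(x / 2) powr (2 * real m + \<beta>) = (x / 2) powr (real (2 * m)) * (x / 2) powr \<beta>"
        by (simp add: powr_add)
      also have "(x / 2) powr (real (2 * m)) = ((x / 2)\<^sup>2) ^ m"
        using x by (subst powr_realpow) (auto simp: power_mult)
      finally show ?thesis by (simp add: f_def a_def)
    qed
    then show ?thesis unfolding bessel_J_def g_def using suminf_mult[OF sum] by simp
  qed
  show "bessel_J 0 x = J0 x" using J[of 0] g0 x by simp
  have "((\<lambda>\<beta>. (x / 2) powr \<beta> * g \<beta>) has_real_derivative
      (x / 2) powr 0 * ln (x / 2) * g 0 + (\<Sum>m. f' m 0) * (x / 2) powr 0) (at 0)"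
  proof (rule DERIV_mult[OF _ dg])
    show "((\<lambda>\<beta>. (x / 2) powr \<beta>) has_real_derivative (x / 2) powr 0 * ln (x / 2)) (at 0)"
      using x by (auto intro!: derivative_eq_intros)
  qed
  also have "(x / 2) powr 0 * ln (x / 2) * g 0 + (\<Sum>m. f' m 0) * (x / 2) powr 0 = pi / 2 * Y0 x"
    using x by (simp add: g0 s' Y0_def ln_div algebra_simps)
  finally show "((\<lambda>\<beta>. bessel_J \<beta> x) has_real_derivative pi / 2 * Y0 x) (at 0)"
    by (rule has_field_derivative_transform_within_open[where S = "{-1/2<..<1/2}"]) (auto simp: J)
qed

text \<open>The defining quotient is 0 / 0 at order 0. Dividing numerator and denominator by the
  order gives difference quotients with limits pi Y_0 and pi.\<close>

lemma bessel_Y_0: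
  assumes "x > 0"
  shows "bessel_Y 0 x = Y0 x"
proof -
  define j where "j \<beta> = bessel_J \<beta> x" for \<beta>
  have dj: "(j has_real_derivative pi / 2 * Y0 x) (at 0)"
    unfolding j_def[abs_def] using assms by (rule has_real_derivative_bessel_J_order)
  have dj': "((\<lambda>\<beta>. j (- \<beta>)) has_real_derivative pi / 2 * Y0 x * - 1) (at 0)"
    by (rule DERIV_chain2[where f = j and g = uminus]) (use dj in \<open>auto intro!: derivative_eq_intros\<close>)
  have "((\<lambda>\<beta>. j \<beta> * cos (\<beta> * pi) - j (- \<beta>)) has_real_derivative pi * Y0 x) (at 0)"
    by (rule derivative_eq_intros dj dj' refl)+ simp
  then have n: "((\<lambda>\<beta>. (j \<beta> * cos (\<beta> * pi) - j (- \<beta>)) / \<beta>) \<longlongrightarrow> pi * Y0 x) (at 0)"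
    by (simp add: DERIV_def)
  have "((\<lambda>\<beta>. sin (\<beta> * pi)) has_real_derivative pi) (at 0)"
    by (auto intro!: derivative_eq_intros)
  then have "((\<lambda>\<beta>. sin (\<beta> * pi) / \<beta>) \<longlongrightarrow> pi) (at 0)"
    by (simp add: DERIV_def)
  from tendsto_divide[OF n this]
  have "((\<lambda>\<beta>. ((j \<beta> * cos (\<beta> * pi) - j (- \<beta>)) / \<beta>) / (sin (\<beta> * pi) / \<beta>)) \<longlongrightarrow> Y0 x) (at 0)" by simp
  then have "((\<lambda>\<beta>. (j \<beta> * cos (\<beta> * pi) - j (- \<beta>)) / sin (\<beta> * pi)) \<longlongrightarrow> Y0 x) (at 0)"
    by (rule Lim_transform_eventually) (auto simp: eventually_at_filter)
  then show ?thesis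
    unfolding bessel_Y_def j_def by (auto intro!: tendsto_Lim)
qed

text \<open>Legendre's duplication formula at half-integers, m! Gamma(m + 1/2) = sqrt pi (2 m)! /
  4^m, turns the two series into those of sine and cosine. It is proved for the reciprocals by
  induction in \<open>r2'\<close>.\<close>

lemma
  assumes x: "x > 0"
  shows bessel_J_half: "bessel_J (1/2) x = sqrt (2 / (pi * x)) * sin x"
    and bessel_J_minus_half: "bessel_J (- (1/2)) x = sqrt (2 / (pi * x)) * cos x"
proof -
  have K: "2 / (sqrt pi * x) * sqrt (x / 2) = sqrt (2 / (pi * x))"
  proof (rule power2_eq_imp_eq)
    show "(2 / (sqrt pi * x) * sqrt (x / 2))\<^sup>2 = (sqrt (2 / (pi * x)))\<^sup>2"
      using x by (simp add: power_mult_distrib power_divide) (simp add: power2_eq_square)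
  qed (use x in auto)
  have K': "1 / sqrt pi * (x / 2) powr (- (1/2)) = sqrt (2 / (pi * x))"
    using x by (simp add: powr_minus powr_half_sqrt real_sqrt_divide real_sqrt_mult field_simps)
  have pw: "(x / 2) powr (2 * real m + \<alpha>) = (x / 2) ^ (2 * m) * (x / 2) powr \<alpha>" for m \<alpha>
    using x powr_realpow[of "x / 2" "2 * m"] by (simp add: powr_add)
  have half: "rGamma (1/2 :: real) = 1 / sqrt pi"
    by (simp add: rGamma_inverse_Gamma Gamma_one_half_real inverse_eq_divide)
  have step: "(real m + 1/2) * rGamma (real m + 1/2 + 1) = rGamma (real m + 1/2)" for m
    by (rule rGamma_plus1)
  have r2': "rGamma (real m + 1/2) / fact m = 2 ^ (2 * m) / (sqrt pi * fact (2 * m))" for m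
  proof (induction m)
    case (Suc m)
    have "rGamma (real (Suc m) + 1/2) = rGamma (real m + 1/2) / (real m + 1/2)"
      using step[of m] by (simp add: field_simps)
    then have "rGamma (real (Suc m) + 1/2) / fact (Suc m) = (rGamma (real m + 1/2) / fact m) / ((real m + 1/2) * (real m + 1))"
      by (simp add: ac_simps)
    also have "\<dots> = 2 ^ (2 * Suc m) / (sqrt pi * fact (2 * Suc m))"
      unfolding Suc.IH by (simp add: divide_simps) (simp add: algebra_simps)
    finally show ?case .
  qed (simp add: half)
  have r2: "rGamma (real m + - (1/2) + 1) / fact m = 2 ^ (2 * m) / (sqrt pi * fact (2 * m))" for m
  proof -
    have "real m + - (1/2) + 1 = real m + 1/2" by simp
    then show ?thesis by (simp only: r2')
  qed
  have r1: "rGamma (real m + 1/2 + 1) / fact m = 2 ^ (2 * m + 1) / (sqrt pi * fact (2 * m + 1))" for m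
  proof -
    have "rGamma (real m + 1/2 + 1) = rGamma (real m + 1/2) / (real m + 1/2)"
      using step[of m] by (simp add: field_simps)
    then have "rGamma (real m + 1/2 + 1) / fact m = (rGamma (real m + 1/2) / fact m) / (real m + 1/2)" by simp
    also have "\<dots> = 2 ^ (2 * m + 1) / (sqrt pi * fact (2 * m + 1))"
      unfolding r2' by (simp add: divide_simps)
    finally show ?thesis .
  qed
  have t1: "(-1) ^ m * rGamma (real m + 1/2 + 1) / fact m * (x / 2) powr (2 * real m + 1/2)
      = sqrt (2 / (pi * x)) * ((-1) ^ m / fact (2 * m + 1) * x ^ (2 * m + 1))" for m
  proof -
    have "(-1) ^ m * rGamma (real m + 1/2 + 1) / fact m * (x / 2) powr (2 * real m + 1/2)
      = (-1) ^ m * (rGamma (real m + 1/2 + 1) / fact m) * ((x / 2) ^ (2 * m) * sqrt (x / 2))"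
      unfolding pw using x by (simp add: powr_half_sqrt)
    also have "\<dots> = 2 / (sqrt pi * x) * sqrt (x / 2) * ((-1) ^ m / fact (2 * m + 1) * x ^ (2 * m + 1))"
      unfolding r1 using x by (simp add: power_divide divide_simps)
    finally show ?thesis unfolding K .
  qed
  have t2: "(-1) ^ m * rGamma (real m + - (1/2) + 1) / fact m * (x / 2) powr (2 * real m + - (1/2))
      = sqrt (2 / (pi * x)) * ((-1) ^ m / fact (2 * m) * x ^ (2 * m))" for m
  proof -
    have "(-1) ^ m * rGamma (real m + - (1/2) + 1) / fact m * (x / 2) powr (2 * real m + - (1/2))
      = (-1) ^ m * (rGamma (real m + - (1/2) + 1) / fact m) * ((x / 2) ^ (2 * m) * (x / 2) powr (- (1/2)))"
      unfolding pw by simp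
    also have "\<dots> = 1 / sqrt pi * (x / 2) powr (- (1/2)) * ((-1) ^ m / fact (2 * m) * x ^ (2 * m))"
      unfolding r2 using x by (simp add: power_divide divide_simps)
    finally show ?thesis unfolding K' .
  qed
  show "bessel_J (1/2) x = sqrt (2 / (pi * x)) * sin x"
    unfolding bessel_J_def t1 by (rule sums_unique[OF sums_mult[OF sin_paired], symmetric])
  show "bessel_J (- (1/2)) x = sqrt (2 / (pi * x)) * cos x"
    unfolding bessel_J_def t2 by (rule sums_unique[OF sums_mult[OF cos_paired], symmetric])
qed

section \<open>The functions J_0 and Y_0 at the origin\<close>

lemma even_series_minus_const_le:
  assumes c: "\<And>y. summable (\<lambda>n. c n * y ^ n)"
  obtains C where "C \<ge> 0" "\<And>x. x \<in> {0..X} \<Longrightarrow> \<bar>even_series c x - c 0\<bar> \<le> C * x\<^sup>2"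
proof -
  have c1: "summable (\<lambda>n. diffs c n * y ^ n)" for y
    using termdiff_converges_all[OF c] by simp
  define p where "p y = (\<Sum>n. c n * y ^ n)" for y
  define p1 where "p1 y = (\<Sum>n. diffs c n * y ^ n)" for y
  have d: "(p has_real_derivative p1 y) (at y)" for y
    unfolding p_def[abs_def] p1_def by (rule termdiffs_strong_converges_everywhere[OF c])
  have "isCont p1 y" for y
    unfolding p1_def[abs_def] using termdiffs_strong_converges_everywhere[OF c1] DERIV_isCont by blast
  then have "continuous_on {0..X\<^sup>2} p1" by (simp add: continuous_at_imp_continuous_on)
  then have "bounded (p1 ` {0..X\<^sup>2})" by (intro compact_imp_bounded compact_continuous_image) auto
  then obtain B where B: "\<And>y. y \<in> {0..X\<^sup>2} \<Longrightarrow> norm (p1 y) \<le> B"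
    unfolding bounded_iff by force
  have p0: "p 0 = c 0" unfolding p_def by (rule powser_zero)
  show ?thesis
  proof (rule that[of "\<bar>B\<bar>"])
    fix x assume x: "x \<in> {0..X}"
    have "norm (p (x\<^sup>2) - p 0) \<le> \<bar>B\<bar> * norm (x\<^sup>2 - 0)"
    proof (rule field_differentiable_bound[where S = "{0..X\<^sup>2}" and f' = p1])
      show "(p has_field_derivative p1 y) (at y within {0..X\<^sup>2})" for y
        by (rule has_field_derivative_at_within[OF d])
    qed (use B x in \<open>force simp: power_mono\<close>)+
    then show "\<bar>even_series c x - c 0\<bar> \<le> \<bar>B\<bar> * x\<^sup>2" by (simp add: p0 even_series_def p_def)
  qed simp
qed

lemma bessel_coeff_0 [simp]: "bessel_coeff 0 = 1"
  and bessel_log_coeff_0 [simp]: "bessel_log_coeff 0 = euler_mascheroni - ln 2"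
  by (simp_all add: bessel_log_coeff_def bessel_coeff_def harm_def)

lemma J0_near_0:
  obtains C where "C \<ge> 0" "\<And>x. x \<in> {0..X} \<Longrightarrow> \<bar>J0 x - 1\<bar> \<le> C * x\<^sup>2"
  using even_series_minus_const_le[OF summable_bessel_coeff, of X] unfolding J0_def by auto

text \<open>The expansion would give an error of order x^2 ln x; the linear bound is the form that
  \<open>arsinh_bound\<close> asks for, one factor x beyond the source.\<close>

lemma Y0_near_0:
  obtains C where "C \<ge> 0"
    "\<And>x. 0 < x \<Longrightarrow> x \<le> X \<Longrightarrow> \<bar>Y0 x - 2 / pi * (ln x + (euler_mascheroni - ln 2))\<bar> \<le> C * x"
proof -
  obtain C1 where C1: "C1 \<ge> 0" "\<And>x. x \<in> {0..X} \<Longrightarrow> \<bar>J0 x - 1\<bar> \<le> C1 * x\<^sup>2" using J0_near_0 by blast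
  obtain C2 where C2: "C2 \<ge> 0"
    "\<And>x. x \<in> {0..X} \<Longrightarrow> \<bar>even_series bessel_log_coeff x - (euler_mascheroni - ln 2)\<bar> \<le> C2 * x\<^sup>2"
    using even_series_minus_const_le[OF summable_bessel_log_coeff, of X] by auto
  show ?thesis
  proof (rule that[of "2 / pi * (C1 * (1 + X\<^sup>2) + C2 * \<bar>X\<bar>)"])
    fix x assume x: "0 < x" "x \<le> X"
    \<comment> \<open>The inequality ln t <= t - 1 at t = x and t = 1 / x bounds
      \<open>\<bar>ln x\<bar>\<close> by 1 / x + x; the term 1 / x costs one of the two available
      powers of x.\<close>
    have "ln x \<le> x - 1" "ln (1 / x) \<le> 1 / x - 1" using x by (auto intro: ln_le_minus_one)
    then have "\<bar>ln x\<bar> \<le> 1 / x + x" using x by (simp add: ln_div) (smt (verit) divide_pos_pos)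
    then have "\<bar>ln x\<bar> * (C1 * x\<^sup>2) \<le> (1 / x + x) * (C1 * x\<^sup>2)"
      using C1 by (intro mult_right_mono) auto
    also have "\<dots> = C1 * (1 + x\<^sup>2) * x" using x by (simp add: field_simps power2_eq_square)
    also have "\<dots> \<le> C1 * (1 + X\<^sup>2) * x"
      using C1 x by (intro mult_right_mono mult_left_mono add_left_mono power_mono) auto
    finally have 1: "\<bar>ln x\<bar> * (C1 * x\<^sup>2) \<le> C1 * (1 + X\<^sup>2) * x" .
    have 2: "C2 * x\<^sup>2 \<le> C2 * \<bar>X\<bar> * x"
      unfolding power2_eq_square mult.assoc using C2 x by (intro mult_left_mono mult_right_mono) auto
    have "\<bar>ln x * (J0 x - 1)\<bar> \<le> \<bar>ln x\<bar> * (C1 * x\<^sup>2)"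
      unfolding abs_mult using C1(2)[of x] x by (intro mult_left_mono) auto
    then have "\<bar>ln x * (J0 x - 1) + (even_series bessel_log_coeff x - (euler_mascheroni - ln 2))\<bar>
        \<le> (C1 * (1 + X\<^sup>2) + C2 * \<bar>X\<bar>) * x"
      using C2(2)[of x] x 1 2 unfolding ring_distribs by (smt (verit) atLeastAtMost_iff)
    then have "2 / pi * \<bar>ln x * (J0 x - 1) + (even_series bessel_log_coeff x - (euler_mascheroni - ln 2))\<bar>
        \<le> 2 / pi * ((C1 * (1 + X\<^sup>2) + C2 * \<bar>X\<bar>) * x)"
      by (intro mult_left_mono) auto
    moreover have "\<bar>Y0 x - 2 / pi * (ln x + (euler_mascheroni - ln 2))\<bar>
        = 2 / pi * \<bar>ln x * (J0 x - 1) + (even_series bessel_log_coeff x - (euler_mascheroni - ln 2))\<bar>"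
    proof -
      have e: "Y0 x - 2 / pi * (ln x + (euler_mascheroni - ln 2))
        = 2 / pi * (ln x * (J0 x - 1) + (even_series bessel_log_coeff x - (euler_mascheroni - ln 2)))"
        by (simp add: Y0_def algebra_simps)
      show ?thesis unfolding e abs_mult[of "2 / pi"] by simp
    qed
    ultimately show "\<bar>Y0 x - 2 / pi * (ln x + (euler_mascheroni - ln 2))\<bar>
        \<le> 2 / pi * (C1 * (1 + X\<^sup>2) + C2 * \<bar>X\<bar>) * x" by (simp only: mult.assoc)
  qed (use C1 C2 in simp)
qed

lemma isCont_even_series:
  assumes "\<And>y. summable (\<lambda>n. c n * y ^ n)"
  shows "isCont (even_series c) x"
  using has_real_derivative_even_series[OF assms] by (rule DERIV_isCont)

lemma isCont_J0: "isCont J0 x" and isCont_J0': "isCont J0' x"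
  unfolding J0_def J0'_def[abs_def]
  by (intro continuous_intros isCont_even_series summable_bessel_coeff summable_diffs_bessel_coeff)+

lemma J0_at_0 [simp]: "J0 0 = 1" and J0'_at_0 [simp]: "J0' 0 = 0"
  unfolding J0_def J0'_def even_series_def zero_power2 powser_zero by simp_all

lemma tendsto_mult_Y0_at_0:
  "((\<lambda>x. x * Y0 x) \<longlongrightarrow> 0) (at_right 0)" "((\<lambda>x. x * Y0' x) \<longlongrightarrow> 2 / pi) (at_right 0)"
proof -
  have J: "(J0 \<longlongrightarrow> 1) (at_right 0)"
    using isCont_J0[of 0] by (auto simp: isCont_def filterlim_at_split)
  have 1: "(even_series (diffs bessel_coeff) \<longlongrightarrow> even_series (diffs bessel_coeff) 0) (at_right 0)"
    using isCont_even_series[OF summable_diffs_bessel_coeff, of 0] by (auto simp: isCont_def filterlim_at_split)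
  have 2: "(even_series bessel_log_coeff \<longlongrightarrow> even_series bessel_log_coeff 0) (at_right 0)"
    using isCont_even_series[OF summable_bessel_log_coeff, of 0] by (auto simp: isCont_def filterlim_at_split)
  have 3: "(even_series (diffs bessel_log_coeff) \<longlongrightarrow> even_series (diffs bessel_log_coeff) 0) (at_right 0)"
    using isCont_even_series[OF summable_diffs_bessel_log_coeff, of 0] by (auto simp: isCont_def filterlim_at_split)
  have l: "((\<lambda>x::real. x * ln x) \<longlongrightarrow> 0) (at_right 0)" "((\<lambda>x::real. x\<^sup>2 * ln x) \<longlongrightarrow> 0) (at_right 0)"
    "((\<lambda>x::real. x) \<longlongrightarrow> 0) (at_right 0)" "((\<lambda>x::real. x\<^sup>2) \<longlongrightarrow> 0) (at_right 0)"
    by real_asymp+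
  have "((\<lambda>x. 2 / pi * (x * ln x * J0 x + x * even_series bessel_log_coeff x)) \<longlongrightarrow>
      2 / pi * (0 * 1 + 0 * even_series bessel_log_coeff 0)) (at_right 0)"
    by (intro tendsto_mult_left tendsto_add tendsto_mult l J 2)
  then show "((\<lambda>x. x * Y0 x) \<longlongrightarrow> 0) (at_right 0)" by (simp add: Y0_def algebra_simps)
  have "((\<lambda>x. 2 / pi * (J0 x + 2 * (x\<^sup>2 * ln x * even_series (diffs bessel_coeff) x) + 2 * (x\<^sup>2 * even_series (diffs bessel_log_coeff) x)))
      \<longlongrightarrow> 2 / pi * (1 + 2 * (0 * even_series (diffs bessel_coeff) 0) + 2 * (0 * even_series (diffs bessel_log_coeff) 0))) (at_right 0)"
    by (intro tendsto_mult_left tendsto_add tendsto_mult l J 1 3)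
  then have "((\<lambda>x. 2 / pi * (J0 x + 2 * (x\<^sup>2 * ln x * even_series (diffs bessel_coeff) x) + 2 * (x\<^sup>2 * even_series (diffs bessel_log_coeff) x)))
      \<longlongrightarrow> 2 / pi) (at_right 0)" by simp
  then show "((\<lambda>x. x * Y0' x) \<longlongrightarrow> 2 / pi) (at_right 0)"
  proof (rule Lim_transform_eventually)
    show "\<forall>\<^sub>F x in at_right 0. 2 / pi * (J0 x + 2 * (x\<^sup>2 * ln x * even_series (diffs bessel_coeff) x)
        + 2 * (x\<^sup>2 * even_series (diffs bessel_log_coeff) x)) = x * Y0' x"
      using eventually_at_right_less[of 0]
      by eventually_elim (simp add: Y0'_def J0'_def field_simps power2_eq_square)
  qed
qed

lemma constant_if_zero_derivative_and_limit:
  fixes f :: "real \<Rightarrow> 'a::real_normed_vector"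
  assumes d: "\<And>x. x > 0 \<Longrightarrow> (f has_vector_derivative 0) (at x)"
    and lim: "(f \<longlongrightarrow> l) (at_right 0)" and x: "x > 0"
  shows "f x = l"
proof -
  have "f y = f x" if "y \<in> {0<..<x}" for y
  proof (rule has_vector_derivative_zero_constant[of "{0<..}" f, THEN exE])
    show "(f has_vector_derivative 0) (at z within {0<..})" if "z \<in> {0<..}" for z
      using d that by (auto intro: has_vector_derivative_at_within)
  qed (use that x in auto)
  then have "\<forall>\<^sub>F y in at_right 0. f y = f x"
    using eventually_at_right_real[OF x] by (auto elim: eventually_mono)
  then have "(f \<longlongrightarrow> f x) (at_right 0)" by (rule tendsto_eventually)
  then show ?thesis using lim tendsto_unique by (metis trivial_limit_at_right_real)
qed

text \<open>By the self-adjoint equations the derivative vanishes, and the constant is read off at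
  the origin, where \<open>x * Y0' x\<close> tends to 2 / pi.\<close>

lemma bessel_wronskian:
  assumes "x > 0"
  shows "x * (J0 x * Y0' x - J0' x * Y0 x) = 2 / pi"
proof (rule constant_if_zero_derivative_and_limit[OF _ _ assms])
  fix x :: real assume x: "x > 0"
  have "((\<lambda>x. J0 x * (x * Y0' x) - (x * J0' x) * Y0 x) has_real_derivative
      (J0' x * (x * Y0' x) + - x * Y0 x * J0 x) - (- x * J0 x * Y0 x + Y0' x * (x * J0' x))) (at x)"
    by (intro DERIV_diff DERIV_mult has_real_derivative_J0 has_real_derivative_Y0 Y0_ode J0_ode x)
  then show "((\<lambda>x. x * (J0 x * Y0' x - J0' x * Y0 x)) has_vector_derivative 0) (at x)"
    by (simp add: algebra_simps flip: has_real_derivative_iff_has_vector_derivative)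
next
  have J: "(J0 \<longlongrightarrow> 1) (at_right 0)" "(J0' \<longlongrightarrow> 0) (at_right 0)"
    using isCont_J0[of 0] isCont_J0'[of 0] by (auto simp: isCont_def filterlim_at_split)
  have "((\<lambda>x. J0 x * (x * Y0' x) - J0' x * (x * Y0 x)) \<longlongrightarrow> 1 * (2 / pi) - 0 * 0) (at_right 0)"
    by (intro tendsto_intros J tendsto_mult_Y0_at_0)
  then show "((\<lambda>x. x * (J0 x * Y0' x - J0' x * Y0 x)) \<longlongrightarrow> 2 / pi) (at_right 0)"
    by (simp add: algebra_simps)
qed

section \<open>Bessel's equation with a concentrated source\<close>

lemma has_vector_derivative_integral_compose:
  fixes w :: "'b::euclidean_space \<Rightarrow> complex" and g g' :: "real \<Rightarrow> 'b \<Rightarrow> real" and h h' :: "real \<Rightarrow> complex"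
  assumes w: "continuous_on (cbox a b) w"
    and dg: "\<And>t p. ((\<lambda>t. g t p) has_real_derivative g' t p) (at t)"
    and g: "continuous_on (UNIV \<times> cbox a b) (\<lambda>(t, p). g t p)" and g': "continuous_on (UNIV \<times> cbox a b) (\<lambda>(t, p). g' t p)"
    and h: "\<And>t. (h has_vector_derivative h' t) (at t)" and h': "continuous_on UNIV h'"
  shows "((\<lambda>t. integral (cbox a b) (\<lambda>p. w p * h (g t p))) has_vector_derivative
      integral (cbox a b) (\<lambda>p. w p * (of_real (g' t p) * h' (g t p)))) (at t)"
proof -
  have ch: "continuous_on UNIV h"
    by (rule continuous_on_vector_derivative) (use h has_vector_derivative_at_within in blast)
  have "((\<lambda>t. integral (cbox a b) ((\<lambda>t p. w p * h (g t p)) t)) has_vector_derivative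
      integral (cbox a b) ((\<lambda>t p. w p * (of_real (g' t p) * h' (g t p))) t)) (at t within UNIV)"
  proof (rule leibniz_rule_vector_derivative)
    show "((\<lambda>t. w p * h (g t p)) has_vector_derivative w p * (of_real (g' t p) * h' (g t p))) (at t within UNIV)"
      for t p
    proof (rule has_vector_derivative_mult_right)
      have "((\<lambda>t. h (g t p)) has_vector_derivative g' t p *\<^sub>R h' (g t p)) (at t)"
        using vector_diff_chain_at[of "\<lambda>t. g t p" "g' t p" t h] h dg
        by (simp add: o_def has_real_derivative_iff_has_vector_derivative)
      then show "((\<lambda>t. h (g t p)) has_vector_derivative of_real (g' t p) * h' (g t p)) (at t within UNIV)"
        by (simp add: scaleR_conv_of_real)
    qed
    have gt: "continuous_on (cbox a b) (\<lambda>p. g t p)" for t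
    proof -
      have "continuous_on (cbox a b) (\<lambda>p. (\<lambda>(t, p). g t p) (t, p))"
        by (rule continuous_on_compose2[OF g]) (auto intro!: continuous_intros)
      then show ?thesis by simp
    qed
    show "(\<lambda>p. w p * h (g t p)) integrable_on cbox a b" for t
      by (intro integrable_continuous continuous_on_mult w continuous_on_compose2[OF ch] gt) auto
    have "continuous_on (UNIV \<times> cbox a b) (\<lambda>x :: real \<times> 'b. w (snd x))"
      by (rule continuous_on_compose2[OF w]) (auto intro: continuous_intros)
    moreover have "continuous_on (UNIV \<times> cbox a b) (\<lambda>x. h' (g (fst x) (snd x)))"
      using g by (intro continuous_on_compose2[OF h']) (auto simp: split_beta)
    ultimately have "continuous_on (UNIV \<times> cbox a b) (\<lambda>x. w (snd x) * (of_real (g' (fst x) (snd x)) * h' (g (fst x) (snd x))))"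
      using g' by (intro continuous_on_mult continuous_on_of_real) (auto simp: split_beta)
    then show "continuous_on (UNIV \<times> cbox a b) (\<lambda>(t, p). w p * (of_real (g' t p) * h' (g t p)))"
      by (simp add: split_beta)
  qed auto
  then show ?thesis by simp
qed

lemma has_vector_derivative_integral_affine:
  fixes w :: "'b::euclidean_space \<Rightarrow> complex" and s q :: "'b \<Rightarrow> real" and h h' :: "real \<Rightarrow> complex"
  assumes w: "continuous_on (cbox a b) w" and s: "continuous_on (cbox a b) s" and q: "continuous_on (cbox a b) q"
    and h: "\<And>t. (h has_vector_derivative h' t) (at t)" and h': "continuous_on UNIV h'"
  shows "((\<lambda>t. integral (cbox a b) (\<lambda>p. w p * h (s p + t * q p))) has_vector_derivative
      integral (cbox a b) (\<lambda>p. w p * (of_real (q p) * h' (s p + t * q p)))) (at t)"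
proof (rule has_vector_derivative_integral_compose[OF w _ _ _ h h', where g = "\<lambda>t p. s p + t * q p" and g' = "\<lambda>t p. q p"])
  have c: "continuous_on (UNIV \<times> cbox a b) (\<lambda>x :: real \<times> 'b. g (snd x))" if "continuous_on (cbox a b) g"
    for g :: "'b \<Rightarrow> real"
    by (rule continuous_on_compose2[OF that]) (auto intro: continuous_intros)
  show "continuous_on (UNIV \<times> cbox a b) (\<lambda>(t, p). s p + t * q p)"
    "continuous_on (UNIV \<times> cbox a b) (\<lambda>(t::real, p). q p)"
    unfolding split_beta by (intro continuous_intros c s q)+
  show "((\<lambda>t. s p + t * q p) has_real_derivative q p) (at t)" for t p
    by (auto intro!: derivative_eq_intros)
qed

text \<open>This is x times the integral of 2 / (\<eta> - i x cos \<phi>)^2 over the circle. Its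
  mass on the positive half-line is 4 pi for every \<eta> > 0.\<close>

definition bessel_source :: "real \<Rightarrow> real \<Rightarrow> real" where
  "bessel_source \<eta> x = 4 * pi * \<eta> * x / sqrt (\<eta>\<^sup>2 + x\<^sup>2) ^ 3"

text \<open>A factor x against the source leaves at most 4 pi \<eta> / sqrt(\<eta>^2 + x^2), whose
  primitive is 4 pi \<eta> arsinh(x / \<eta>) and tends to 0 with \<eta>. At the origin only a
  right-hand limit of f is assumed, because the functions inserted later contain Y_0 and ln
  x.\<close>

lemma arsinh_bound:
  fixes f f' :: "real \<Rightarrow> complex"
  assumes \<eta>: "\<eta> > 0" and X: "X > 0"
    and d: "\<And>x. 0 < x \<Longrightarrow> x \<le> X \<Longrightarrow> (f has_vector_derivative f' x) (at x)"
    and le: "\<And>x. 0 < x \<Longrightarrow> x \<le> X \<Longrightarrow> norm (f' x) \<le> bessel_source \<eta> x * (C * x)"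
    and C: "C \<ge> 0" and lim: "(f \<longlongrightarrow> l) (at_right 0)"
  shows "norm (f X - l) \<le> 4 * pi * C * (\<eta> * arsinh (X / \<eta>))"
proof -
  let ?\<phi> = "\<lambda>x. 4 * pi * C * (\<eta> * arsinh (x / \<eta>))"
  let ?\<phi>' = "\<lambda>x. 4 * pi * C * (\<eta> / sqrt (\<eta>\<^sup>2 + x\<^sup>2))"
  have d\<phi>: "(?\<phi> has_real_derivative ?\<phi>' x) (at x)" for x
  proof -
    have e: "sqrt ((x / \<eta>)\<^sup>2 + 1) = sqrt (\<eta>\<^sup>2 + x\<^sup>2) / \<eta>"
    proof -
      have "(x / \<eta>)\<^sup>2 + 1 = (\<eta>\<^sup>2 + x\<^sup>2) / \<eta>\<^sup>2" using \<eta> by (simp add: field_simps)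
      then show ?thesis using \<eta> by (simp add: real_sqrt_divide)
    qed
    have "((\<lambda>x. arsinh (x / \<eta>)) has_real_derivative 1 / sqrt ((x / \<eta>)\<^sup>2 + 1) * (1 / \<eta>)) (at x)"
      by (rule DERIV_chain2[OF arsinh_real_has_field_derivative]) (use \<eta> in \<open>auto intro!: derivative_eq_intros\<close>)
    then have "((\<lambda>x. arsinh (x / \<eta>)) has_real_derivative 1 / sqrt (\<eta>\<^sup>2 + x\<^sup>2)) (at x)"
      unfolding e using \<eta> by simp
    from DERIV_cmult[OF DERIV_cmult[OF this, of \<eta>], of "4 * pi * C"] show ?thesis by simp
  qed
  have le': "norm (f' x) \<le> ?\<phi>' x" if "0 < x" "x \<le> X" for x
  proof -
    let ?s = "sqrt (\<eta>\<^sup>2 + x\<^sup>2)"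
    have s: "?s > 0" using \<eta> by (simp add: add_pos_nonneg)
    have s2: "?s ^ 3 = ?s * (\<eta>\<^sup>2 + x\<^sup>2)" using \<eta> by (simp add: power3_eq_cube)
    have "x * x / (\<eta>\<^sup>2 + x\<^sup>2) \<le> 1" using \<eta> by (simp add: divide_simps power2_eq_square add_pos_nonneg)
    then have "4 * pi * C * (\<eta> / ?s) * (x * x / (\<eta>\<^sup>2 + x\<^sup>2)) \<le> 4 * pi * C * (\<eta> / ?s) * 1"
      using C \<eta> by (intro mult_left_mono) auto
    moreover have "bessel_source \<eta> x * (C * x) = 4 * pi * C * (\<eta> / ?s) * (x * x / (\<eta>\<^sup>2 + x\<^sup>2))"
      unfolding bessel_source_def s2 by simp
    ultimately show ?thesis using le[OF that] by simp
  qed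
  have *: "norm (f X - f a) \<le> ?\<phi> X" if "0 < a" "a < X" for a
  proof -
    have "norm (f X - f a) \<le> ?\<phi> X - ?\<phi> a"
    proof (rule differentiable_bound_general[OF that(2)])
      show "continuous_on {a..X} f"
        by (rule continuous_on_vector_derivative[where f' = f']) (rule has_vector_derivative_at_within[OF d], use \<open>0 < a\<close> in auto)
      show "continuous_on {a..X} ?\<phi>"
        by (rule DERIV_continuous_on[OF has_field_derivative_at_within[OF d\<phi>]])
      show "(f has_vector_derivative f' x) (at x)" if "a < x" "x < X" for x using d that \<open>0 < a\<close> by auto
      show "(?\<phi> has_vector_derivative ?\<phi>' x) (at x)" for x
        using d\<phi> by (simp add: has_real_derivative_iff_has_vector_derivative)
      show "norm (f' x) \<le> ?\<phi>' x" if "a < x" "x < X" for x using le' that \<open>0 < a\<close> by auto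
    qed
    moreover have "arsinh (a / \<eta>) \<ge> 0"
      unfolding arsinh_real_def using \<eta> that by (intro ln_ge_zero add_increasing) auto
    then have "?\<phi> a \<ge> 0" using C \<eta> by (intro mult_nonneg_nonneg) auto
    ultimately show ?thesis by linarith
  qed
  have "((\<lambda>a. norm (f X - f a)) \<longlongrightarrow> norm (f X - l)) (at_right 0)"
    by (intro tendsto_intros lim)
  moreover have "\<forall>\<^sub>F a in at_right 0. norm (f X - f a) \<le> ?\<phi> X"
    using eventually_at_right_real[OF X] by eventually_elim (use * in auto)
  ultimately show ?thesis by (rule tendsto_upperbound) simp
qed

lemma tendsto_eta_arsinh:
  assumes "X > 0"
  shows "((\<lambda>\<eta>. c * (\<eta> * arsinh (X / \<eta>))) \<longlongrightarrow> 0) (at_right (0::real))"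
proof -
  have "((\<lambda>\<eta>. \<eta> * arsinh (X / \<eta>)) \<longlongrightarrow> 0) (at_right (0::real))"
    unfolding arsinh_real_def using assms by real_asymp
  then show ?thesis by (rule tendsto_mult_right_zero)
qed

text \<open>The source tends to \<open>4\<pi>\<close> times a point mass at \<open>x = 0\<close>. Its effect is computed from the
  Wronskians with \<open>J0\<close> and \<open>Y0\<close>, whose derivatives only involve the source.\<close>

lemma bessel_limit:
  fixes u u' :: "real \<Rightarrow> real \<Rightarrow> complex"
  assumes du: "\<And>\<eta> x. \<eta> > 0 \<Longrightarrow> (u \<eta> has_vector_derivative u' \<eta> x) (at x)"
    and ode: "\<And>\<eta> x. \<eta> > 0 \<Longrightarrow>
      ((\<lambda>x. of_real x * u' \<eta> x) has_vector_derivative - of_real x * u \<eta> x - of_real (bessel_source \<eta> x)) (at x)"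
    and cont: "\<And>\<eta>. \<eta> > 0 \<Longrightarrow> isCont (u' \<eta>) 0"
    and init: "((\<lambda>\<eta>. of_real (2 / pi) * u \<eta> 0 + of_real (8 * ln \<eta> + 8 * euler_mascheroni)) \<longlongrightarrow> 4 * pi * \<i>) (at_right 0)"
    and X: "X > 0"
  shows "((\<lambda>\<eta>. u \<eta> X) \<longlongrightarrow> 2 * pi\<^sup>2 * (\<i> * J0 X - Y0 X)) (at_right 0)"
    and "((\<lambda>\<eta>. u' \<eta> X) \<longlongrightarrow> 2 * pi\<^sup>2 * (\<i> * J0' X - Y0' X)) (at_right 0)"
proof -
  define A where "A \<eta> x = u \<eta> x * of_real (x * Y0' x) - (of_real x * u' \<eta> x) * of_real (Y0 x)" for \<eta> x
  define B where "B \<eta> x = u \<eta> x * of_real (x * J0' x) - (of_real x * u' \<eta> x) * of_real (J0 x)" for \<eta> x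
  \<comment> \<open>An exact primitive of the source times the leading part
    \<open>2 / pi * (ln x + (euler_mascheroni - ln 2))\<close> of Y_0; \<open>Q\<close> is a
    primitive of the source itself. At fixed x > 0 both vanish as \<eta> tends to 0.\<close>
  define P where "P \<eta> x = - 8 * (\<eta> * ln x / sqrt (\<eta>\<^sup>2 + x\<^sup>2) + arsinh (\<eta> / x)
      + (euler_mascheroni - ln 2) * (\<eta> / sqrt (\<eta>\<^sup>2 + x\<^sup>2)))" for \<eta> x :: real
  define Q where "Q \<eta> x = - 4 * pi * (\<eta> / sqrt (\<eta>\<^sup>2 + x\<^sup>2))" for \<eta> x :: real
  have dv: "((\<lambda>x. complex_of_real (g x)) has_vector_derivative of_real g') (at x)"
    if "(g has_real_derivative g') (at x)" for g g' x
    using that by (simp add: has_vector_derivative_of_real has_real_derivative_iff_has_vector_derivative)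
  have dA: "(A \<eta> has_vector_derivative of_real (bessel_source \<eta> x * Y0 x)) (at x)" if "\<eta> > 0" "x > 0" for \<eta> x
  proof -
    have "(A \<eta> has_vector_derivative
        (u \<eta> x * of_real (- x * Y0 x) + u' \<eta> x * of_real (x * Y0' x))
        - ((of_real x * u' \<eta> x) * of_real (Y0' x) + (- of_real x * u \<eta> x - of_real (bessel_source \<eta> x)) * of_real (Y0 x))) (at x)"
      unfolding A_def[abs_def]
      by (intro has_vector_derivative_diff has_vector_derivative_mult dv Y0_ode has_real_derivative_Y0 du ode that)
    then show ?thesis by (simp add: algebra_simps)
  qed
  have dB: "(B \<eta> has_vector_derivative of_real (bessel_source \<eta> x * J0 x)) (at x)" if "\<eta> > 0" for \<eta> x
  proof -
    have "(B \<eta> has_vector_derivative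
        (u \<eta> x * of_real (- x * J0 x) + u' \<eta> x * of_real (x * J0' x))
        - ((of_real x * u' \<eta> x) * of_real (J0' x) + (- of_real x * u \<eta> x - of_real (bessel_source \<eta> x)) * of_real (J0 x))) (at x)"
      unfolding B_def[abs_def]
      by (intro has_vector_derivative_diff has_vector_derivative_mult dv J0_ode has_real_derivative_J0 du ode that)
    then show ?thesis by (simp add: algebra_simps)
  qed
  have ds: "((\<lambda>x. 1 / sqrt (\<eta>\<^sup>2 + x\<^sup>2)) has_real_derivative - x / sqrt (\<eta>\<^sup>2 + x\<^sup>2) ^ 3) (at x)"
    if "\<eta> > 0" for \<eta> x :: real
  proof -
    have p: "\<eta>\<^sup>2 + x\<^sup>2 > 0" using that by (simp add: add_pos_nonneg)
    then show ?thesis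
      by (auto intro!: derivative_eq_intros simp: field_simps power2_eq_square power3_eq_cube)
  qed
  have dQ: "(Q \<eta> has_real_derivative bessel_source \<eta> x) (at x)" if "\<eta> > 0" for \<eta> x
  proof -
    have "((\<lambda>x. - 4 * pi * \<eta> * (1 / sqrt (\<eta>\<^sup>2 + x\<^sup>2))) has_real_derivative
        - 4 * pi * \<eta> * (- x / sqrt (\<eta>\<^sup>2 + x\<^sup>2) ^ 3)) (at x)"
      by (intro DERIV_cmult ds that)
    then show ?thesis by (simp add: Q_def[abs_def] bessel_source_def)
  qed
  have dP: "(P \<eta> has_real_derivative bessel_source \<eta> x * (2 / pi * (ln x + (euler_mascheroni - ln 2)))) (at x)"
    if \<eta>: "\<eta> > 0" and x: "x > 0" for \<eta> x
  proof -
    let ?s = "sqrt (\<eta>\<^sup>2 + x\<^sup>2)"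
    have s: "?s > 0" using \<eta> by (simp add: add_pos_nonneg)
    have e: "sqrt ((\<eta> / x)\<^sup>2 + 1) = ?s / x"
    proof -
      have "(\<eta> / x)\<^sup>2 + 1 = (\<eta>\<^sup>2 + x\<^sup>2) / x\<^sup>2" using x by (simp add: field_simps)
      then show ?thesis using x by (simp add: real_sqrt_divide)
    qed
    have "((\<lambda>x. arsinh (\<eta> / x)) has_real_derivative 1 / sqrt ((\<eta> / x)\<^sup>2 + 1) * - (\<eta> / x\<^sup>2)) (at x)"
      by (rule DERIV_chain2[OF arsinh_real_has_field_derivative])
        (use x in \<open>auto intro!: derivative_eq_intros simp: power2_eq_square\<close>)
    then have da: "((\<lambda>x. arsinh (\<eta> / x)) has_real_derivative - (\<eta> / (x * ?s))) (at x)"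
      unfolding e using x s by (simp add: field_simps power2_eq_square)
    have dl: "((\<lambda>x. \<eta> * ln x * (1 / sqrt (\<eta>\<^sup>2 + x\<^sup>2))) has_real_derivative
        \<eta> * (1 / x) * (1 / ?s) + (- x / ?s ^ 3) * (\<eta> * ln x)) (at x)"
      by (intro DERIV_mult DERIV_cmult DERIV_ln_divide x ds \<eta>)
    have "((\<lambda>x. - 8 * (\<eta> * ln x * (1 / sqrt (\<eta>\<^sup>2 + x\<^sup>2)) + arsinh (\<eta> / x)
        + (euler_mascheroni - ln 2) * (\<eta> * (1 / sqrt (\<eta>\<^sup>2 + x\<^sup>2))))) has_real_derivative
      - 8 * ((\<eta> * (1 / x) * (1 / ?s) + (- x / ?s ^ 3) * (\<eta> * ln x)) + - (\<eta> / (x * ?s))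
        + (euler_mascheroni - ln 2) * (\<eta> * (- x / ?s ^ 3)))) (at x)"
      by (intro DERIV_cmult DERIV_add dl da ds \<eta>)
    moreover have "- 8 * ((\<eta> * (1 / x) * (1 / s) + (- x / s ^ 3) * (\<eta> * ln x)) + - (\<eta> / (x * s))
        + K * (\<eta> * (- x / s ^ 3))) = 4 * pi * \<eta> * x / s ^ 3 * (2 / pi * (ln x + K))" if "s > 0" for s K :: real
      using that x by (simp add: field_simps)
    from this[OF s, of "euler_mascheroni - ln 2"]
    have "- 8 * ((\<eta> * (1 / x) * (1 / ?s) + (- x / ?s ^ 3) * (\<eta> * ln x)) + - (\<eta> / (x * ?s))
        + (euler_mascheroni - ln 2) * (\<eta> * (- x / ?s ^ 3))) = bessel_source \<eta> x * (2 / pi * (ln x + (euler_mascheroni - ln 2)))"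
      unfolding bessel_source_def .
    ultimately show ?thesis by (simp add: P_def[abs_def])
  qed
  obtain C where C: "C \<ge> 0"
    "\<And>x. 0 < x \<Longrightarrow> x \<le> X \<Longrightarrow> \<bar>Y0 x - 2 / pi * (ln x + (euler_mascheroni - ln 2))\<bar> \<le> C * x"
    using Y0_near_0 by blast
  obtain C' where C': "C' \<ge> 0" "\<And>x. x \<in> {0..X} \<Longrightarrow> \<bar>J0 x - 1\<bar> \<le> C' * x\<^sup>2"
    using J0_near_0 by blast
  have lu: "(u \<eta> \<longlongrightarrow> u \<eta> 0) (at_right 0)" "(u' \<eta> \<longlongrightarrow> u' \<eta> 0) (at_right 0)" if "\<eta> > 0" for \<eta>
  proof -
    have "isCont (u \<eta>) 0" using du[OF that] by (rule has_vector_derivative_continuous)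
    then show "(u \<eta> \<longlongrightarrow> u \<eta> 0) (at_right 0)" by (auto simp: isCont_def filterlim_at_split)
    show "(u' \<eta> \<longlongrightarrow> u' \<eta> 0) (at_right 0)" using cont[OF that] by (auto simp: isCont_def filterlim_at_split)
  qed
  have bA: "norm ((A \<eta> X - of_real (P \<eta> X)) - (of_real (2 / pi) * u \<eta> 0 + of_real (8 * ln \<eta> + 8 * euler_mascheroni)))
      \<le> 4 * pi * C * (\<eta> * arsinh (X / \<eta>))" if \<eta>: "\<eta> > 0" for \<eta>
  proof (rule arsinh_bound[OF \<eta> X _ _ C(1)])
    fix x assume x: "0 < x" "x \<le> X"
    have "((\<lambda>x. A \<eta> x - of_real (P \<eta> x)) has_vector_derivative of_real (bessel_source \<eta> x * Y0 x)
        - of_real (bessel_source \<eta> x * (2 / pi * (ln x + (euler_mascheroni - ln 2))))) (at x)"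
      by (intro has_vector_derivative_diff dA dv dP \<eta> x)
    then show "((\<lambda>x. A \<eta> x - of_real (P \<eta> x)) has_vector_derivative
        of_real (bessel_source \<eta> x * (Y0 x - 2 / pi * (ln x + (euler_mascheroni - ln 2))))) (at x)"
      unfolding right_diff_distrib of_real_diff .
    have "bessel_source \<eta> x \<ge> 0" using \<eta> x by (simp add: bessel_source_def)
    then show "norm (complex_of_real (bessel_source \<eta> x * (Y0 x - 2 / pi * (ln x + (euler_mascheroni - ln 2)))))
        \<le> bessel_source \<eta> x * (C * x)"
      unfolding norm_of_real abs_mult using C(2)[OF x] by (simp add: mult_left_mono)
  next
    \<comment> \<open>Near x = 0 the term \<open>arsinh (\<eta> / x)\<close> behaves like ln(2
      \<eta> / x), so ln x cancels. The remaining ln 2 cancels against the constant in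
      \<open>P\<close>, and what is left, -8 ln \<eta> - 8 gamma, is compensated in
      \<open>init\<close>.\<close>
    have 1: "((\<lambda>x. \<eta> * ln x / sqrt (\<eta>\<^sup>2 + x\<^sup>2) + arsinh (\<eta> / x)) \<longlongrightarrow> ln (2 * \<eta>)) (at_right 0)"
      unfolding arsinh_real_def using \<eta> by real_asymp
    have 2: "((\<lambda>x. \<eta> / sqrt (\<eta>\<^sup>2 + x\<^sup>2)) \<longlongrightarrow> 1) (at_right 0)"
      using \<eta> by real_asymp
    have "((\<lambda>x. - 8 * (\<eta> * ln x / sqrt (\<eta>\<^sup>2 + x\<^sup>2) + arsinh (\<eta> / x)
        + (euler_mascheroni - ln 2) * (\<eta> / sqrt (\<eta>\<^sup>2 + x\<^sup>2)))) \<longlongrightarrow>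
        - 8 * (ln (2 * \<eta>) + (euler_mascheroni - ln 2) * 1)) (at_right 0)"
      by (rule tendsto_mult_left[OF tendsto_add[OF 1 tendsto_mult_left[OF 2]]])
    then have "(P \<eta> \<longlongrightarrow> - (8 * ln \<eta> + 8 * euler_mascheroni)) (at_right 0)"
      using \<eta> by (simp add: P_def[abs_def] ln_mult algebra_simps)
    then have "((\<lambda>x. u \<eta> x * of_real (x * Y0' x) - u' \<eta> x * of_real (x * Y0 x) - of_real (P \<eta> x)) \<longlongrightarrow>
        u \<eta> 0 * of_real (2 / pi) - u' \<eta> 0 * of_real 0 - of_real (- (8 * ln \<eta> + 8 * euler_mascheroni))) (at_right 0)"
      by (intro tendsto_diff tendsto_mult tendsto_of_real lu \<eta> tendsto_mult_Y0_at_0)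
    then show "((\<lambda>x. A \<eta> x - of_real (P \<eta> x)) \<longlongrightarrow>
        of_real (2 / pi) * u \<eta> 0 + of_real (8 * ln \<eta> + 8 * euler_mascheroni)) (at_right 0)"
      by (simp add: A_def[abs_def] algebra_simps)
  qed
  have bB: "norm ((B \<eta> X - of_real (Q \<eta> X)) - of_real (4 * pi)) \<le> 4 * pi * (C' * X) * (\<eta> * arsinh (X / \<eta>))"
    if \<eta>: "\<eta> > 0" for \<eta>
  proof (rule arsinh_bound[OF \<eta> X])
    fix x assume x: "0 < x" "x \<le> X"
    have "((\<lambda>x. B \<eta> x - of_real (Q \<eta> x)) has_vector_derivative of_real (bessel_source \<eta> x * J0 x)
        - of_real (bessel_source \<eta> x)) (at x)"
      by (intro has_vector_derivative_diff dB dv dQ \<eta> x)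
    then show "((\<lambda>x. B \<eta> x - of_real (Q \<eta> x)) has_vector_derivative
        of_real (bessel_source \<eta> x * (J0 x - 1))) (at x)"
      by (simp add: right_diff_distrib)
    have "C' * x\<^sup>2 \<le> C' * X * x"
      unfolding power2_eq_square mult.assoc using C' x by (intro mult_left_mono mult_right_mono) auto
    moreover have "bessel_source \<eta> x \<ge> 0" using \<eta> x by (simp add: bessel_source_def)
    ultimately show "norm (complex_of_real (bessel_source \<eta> x * (J0 x - 1))) \<le> bessel_source \<eta> x * (C' * X * x)"
      unfolding norm_of_real abs_mult using C'(2)[of x] x by (simp add: mult_left_mono)
  next
    show "C' * X \<ge> 0" using C' X by simp
    have "((\<lambda>x. \<eta> / sqrt (\<eta>\<^sup>2 + x\<^sup>2)) \<longlongrightarrow> 1) (at_right 0)"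
      using \<eta> by real_asymp
    then have Q: "(Q \<eta> \<longlongrightarrow> - 4 * pi * 1) (at_right 0)"
      unfolding Q_def[abs_def] by (rule tendsto_mult_left)
    have J: "(J0 \<longlongrightarrow> 1) (at_right 0)" "(J0' \<longlongrightarrow> 0) (at_right 0)" "((\<lambda>x::real. x) \<longlongrightarrow> 0) (at_right 0)"
      using isCont_J0[of 0] isCont_J0'[of 0] by (auto simp: isCont_def filterlim_at_split)
    have "((\<lambda>x. u \<eta> x * of_real (x * J0' x) - (of_real x * u' \<eta> x) * of_real (J0 x) - of_real (Q \<eta> x)) \<longlongrightarrow>
        u \<eta> 0 * of_real (0 * 0) - (of_real 0 * u' \<eta> 0) * of_real 1 - of_real (- 4 * pi * 1)) (at_right 0)"
      by (intro tendsto_diff tendsto_mult tendsto_of_real lu \<eta> J Q)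
    then show "((\<lambda>x. B \<eta> x - of_real (Q \<eta> x)) \<longlongrightarrow> of_real (4 * pi)) (at_right 0)"
      by (simp add: B_def[abs_def])
  qed
  have P0: "((\<lambda>\<eta>. P \<eta> X) \<longlongrightarrow> 0) (at_right 0)" "((\<lambda>\<eta>. Q \<eta> X) \<longlongrightarrow> 0) (at_right 0)"
  proof -
    have 1: "((\<lambda>\<eta>. \<eta> / sqrt (\<eta>\<^sup>2 + X\<^sup>2)) \<longlongrightarrow> 0) (at_right 0)" using X by real_asymp
    have 2: "((\<lambda>\<eta>. arsinh (\<eta> / X)) \<longlongrightarrow> 0) (at_right 0)" 
      unfolding arsinh_real_def using X by real_asymp
    have "((\<lambda>\<eta>. - 8 * (ln X * (\<eta> / sqrt (\<eta>\<^sup>2 + X\<^sup>2)) + arsinh (\<eta> / X)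
      + (euler_mascheroni - ln 2) * (\<eta> / sqrt (\<eta>\<^sup>2 + X\<^sup>2)))) \<longlongrightarrow> - 8 * (ln X * 0 + 0 + (euler_mascheroni - ln 2) * 0)) (at_right 0)"
      by (intro tendsto_mult_left tendsto_add 1 2)
    then show "((\<lambda>\<eta>. P \<eta> X) \<longlongrightarrow> 0) (at_right 0)" by (simp add: P_def[abs_def] mult.commute)
    show "((\<lambda>\<eta>. Q \<eta> X) \<longlongrightarrow> 0) (at_right 0)"
      unfolding Q_def[abs_def] using 1 by (rule tendsto_mult_right_zero)
  qed
  have ev: "\<forall>\<^sub>F \<eta> in at_right 0. (0::real) < \<eta>" by (rule eventually_at_right_less)
  have "((\<lambda>\<eta>. (A \<eta> X - of_real (P \<eta> X)) - (of_real (2 / pi) * u \<eta> 0 + of_real (8 * ln \<eta> + 8 * euler_mascheroni))) \<longlongrightarrow> 0) (at_right 0)"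
    by (rule Lim_null_comparison[OF eventually_mono[OF ev bA] tendsto_eta_arsinh[OF X]])
  from tendsto_add[OF tendsto_add[OF this init] tendsto_of_real[OF P0(1)]]
  have limA: "((\<lambda>\<eta>. A \<eta> X) \<longlongrightarrow> 4 * pi * \<i>) (at_right 0)" by simp
  have "((\<lambda>\<eta>. (B \<eta> X - of_real (Q \<eta> X)) - of_real (4 * pi)) \<longlongrightarrow> 0) (at_right 0)"
    by (rule Lim_null_comparison[OF eventually_mono[OF ev bB] tendsto_eta_arsinh[OF X]])
  from tendsto_add[OF tendsto_add[OF this tendsto_const[of "of_real (4 * pi)"]] tendsto_of_real[OF P0(2)]]
  have limB: "((\<lambda>\<eta>. B \<eta> X) \<longlongrightarrow> of_real (4 * pi)) (at_right 0)" by simp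
  have W: "complex_of_real (X * (J0 X * Y0' X - J0' X * Y0 X)) = of_real (2 / pi)"
    unfolding bessel_wronskian[OF X] ..
  \<comment> \<open>\<open>A\<close> and \<open>B\<close> are two linear equations for u and u';
    solving them divides by the Wronskian of J_0 and Y_0.\<close>
  have "u \<eta> X * of_real (X * (J0 X * Y0' X - J0' X * Y0 X)) = J0 X * A \<eta> X - Y0 X * B \<eta> X"
    "u' \<eta> X * of_real (X * (J0 X * Y0' X - J0' X * Y0 X)) = J0' X * A \<eta> X - Y0' X * B \<eta> X" for \<eta>
    by (simp_all add: A_def B_def algebra_simps)
  then have u: "u \<eta> X = of_real (pi / 2) * (J0 X * A \<eta> X - Y0 X * B \<eta> X)"
    "u' \<eta> X = of_real (pi / 2) * (J0' X * A \<eta> X - Y0' X * B \<eta> X)" for \<eta>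
    unfolding W by (simp_all add: field_simps)
  have "((\<lambda>\<eta>. of_real (pi / 2) * (J0 X * A \<eta> X - Y0 X * B \<eta> X)) \<longlongrightarrow>
      of_real (pi / 2) * (of_real (J0 X) * (4 * pi * \<i>) - of_real (Y0 X) * complex_of_real (4 * pi))) (at_right 0)"
    by (intro tendsto_mult_left tendsto_diff limA limB)
  then show "((\<lambda>\<eta>. u \<eta> X) \<longlongrightarrow> 2 * pi\<^sup>2 * (\<i> * J0 X - Y0 X)) (at_right 0)"
    unfolding u by (simp add: algebra_simps power2_eq_square)
  have "((\<lambda>\<eta>. of_real (pi / 2) * (J0' X * A \<eta> X - Y0' X * B \<eta> X)) \<longlongrightarrow>
      of_real (pi / 2) * (of_real (J0' X) * (4 * pi * \<i>) - of_real (Y0' X) * complex_of_real (4 * pi))) (at_right 0)"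
    by (intro tendsto_mult_left tendsto_diff limA limB)
  then show "((\<lambda>\<eta>. u' \<eta> X) \<longlongrightarrow> 2 * pi\<^sup>2 * (\<i> * J0' X - Y0' X)) (at_right 0)"
    unfolding u by (simp add: algebra_simps power2_eq_square)
qed

section \<open>Spherical integrals\<close>

lemma has_vector_derivative_compose_real:
  fixes h :: "real \<Rightarrow> complex"
  assumes "(f has_real_derivative f') (at x)" and "(h has_vector_derivative h') (at (f x))"
  shows "((\<lambda>x. h (f x)) has_vector_derivative of_real f' * h') (at x within S)"
proof (rule has_vector_derivative_at_within)
  show "((\<lambda>x. h (f x)) has_vector_derivative of_real f' * h') (at x)"
    using vector_diff_chain_at[of f f' x h h'] assms
    by (simp add: o_def scaleR_conv_of_real has_real_derivative_iff_has_vector_derivative)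
qed

definition circle_pt :: "real \<Rightarrow> real^3" where
  "circle_pt \<phi> = vector [cos \<phi>, sin \<phi>, 0]"

definition sphere_pt :: "real \<times> real \<Rightarrow> real^3" where
  "sphere_pt p = vector [sin (fst p) * cos (snd p), sin (fst p) * sin (snd p), cos (fst p)]"

lemma vector_3_conv: "vector [a, b, c] = a *\<^sub>R axis 1 1 + b *\<^sub>R axis 2 1 + (c *\<^sub>R axis 3 1 :: real^3)"
  by (simp add: vec_eq_iff forall_3 axis_def)

lemma continuous_on_circle_pt: "continuous_on S circle_pt"
  unfolding circle_pt_def[abs_def] vector_3_conv by (intro continuous_intros)

lemma continuous_on_sphere_pt: "continuous_on S sphere_pt"
  unfolding sphere_pt_def[abs_def] vector_3_conv by (intro continuous_intros)

lemma sphere_int_1: "sphere_int 1 f = f (axis 1 1) + f (- axis 1 1)"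
  by (simp add: sphere_int_def)

text \<open>The factor \<open>1 *\<close> here, and the summand \<open>0 +\<close> in the circle integrals below, give the integrands
  the shape of \<open>has_vector_derivative_integral_affine\<close>.\<close>

lemma sphere_int_2: "sphere_int 2 f = integral (cbox 0 (2 * pi)) (\<lambda>\<phi>. 1 * f (circle_pt \<phi>))"
  by (simp add: sphere_int_def circle_pt_def cbox_interval)

lemma sphere_int_3:
  assumes "continuous_on UNIV f"
  shows "sphere_int 3 f = integral (cbox (0, 0) (pi, 2 * pi)) (\<lambda>p. of_real (sin (fst p)) * f (sphere_pt p))"
proof -
  have "continuous_on (cbox (0, 0) (pi, 2 * pi)) (\<lambda>p. complex_of_real (sin (fst p)) * f (sphere_pt p))"
    by (intro continuous_on_mult continuous_on_of_real continuous_intros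
        continuous_on_compose2[OF assms continuous_on_sphere_pt]) auto
  from integral_prod_continuous[OF this] show ?thesis
    by (simp add: sphere_int_def sphere_pt_def cbox_interval)
qed

lemma sphere_int_add:
  assumes d: "d \<in> {1, 2, 3}" and f: "continuous_on UNIV f" and g: "continuous_on UNIV g"
  shows "sphere_int d (\<lambda>k. f k + g k) = sphere_int d f + sphere_int d g"
proof -
  have fg: "continuous_on UNIV (\<lambda>k. f k + g k)" by (intro continuous_intros f g)
  have i2: "(\<lambda>\<phi>. 1 * F (circle_pt \<phi>)) integrable_on cbox 0 (2 * pi)" if "continuous_on UNIV F" for F :: "real^3 \<Rightarrow> complex"
    by (intro integrable_continuous continuous_intros continuous_on_compose2[OF that continuous_on_circle_pt]) auto
  have i3: "(\<lambda>p. of_real (sin (fst p)) * F (sphere_pt p)) integrable_on cbox (0, 0) (pi, 2 * pi)" if "continuous_on UNIV F" for F :: "real^3 \<Rightarrow> complex"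
    by (intro integrable_continuous continuous_on_mult continuous_on_of_real continuous_intros
        continuous_on_compose2[OF that continuous_on_sphere_pt]) auto
  from d consider "d = 1" | "d = 2" | "d = 3" by auto
  then show ?thesis
  proof cases
    case 1
    then show ?thesis unfolding 1 sphere_int_1 by simp
  next
    case 2
    show ?thesis unfolding 2 sphere_int_2 distrib_left by (rule integral_add[OF i2[OF f] i2[OF g]])
  next
    case 3
    show ?thesis
      unfolding 3 sphere_int_3[OF f] sphere_int_3[OF g] sphere_int_3[OF fg] distrib_left
      by (rule integral_add[OF i3[OF f] i3[OF g]])
  qed
qed

lemma sphere_int_cmult: "sphere_int d (\<lambda>k. c * f k) = c * sphere_int d f"
  by (simp add: sphere_int_def ring_distribs mult.left_commute[of _ c])

lemma sphere_int_sum: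
  assumes d: "d \<in> {1, 2, 3}" and "finite S" and "\<And>i. i \<in> S \<Longrightarrow> continuous_on UNIV (f i)"
  shows "sphere_int d (\<lambda>k. \<Sum>i\<in>S. f i k) = (\<Sum>i\<in>S. sphere_int d (f i))"
  using assms(2,3)
proof (induction S rule: finite_induct)
  case empty
  show ?case using sphere_int_cmult[of d 0 "\<lambda>_. 0"] by simp
next
  case (insert i S)
  then show ?case by (simp add: sphere_int_add[OF d] continuous_on_sum)
qed

lemma sphere_int_cong:
  assumes d: "d \<in> {1, 2, 3}" and eq: "\<And>k. k \<in> Rd d \<Longrightarrow> f k = g k"
  shows "sphere_int d f = sphere_int d g"
proof -
  have 1: "axis 1 1 \<in> Rd 1" "- axis 1 1 \<in> Rd 1" by (auto simp: Rd_def dim_idx_def axis_def)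
  have 2: "vector [x, y, 0] \<in> Rd 2" for x y
  proof -
    have "vector [x, y, 0] $ i = (0::real)" if "i \<noteq> 1" "i \<noteq> 2" for i :: 3
      using exhaust_3[of i] that by auto
    then show ?thesis by (auto simp: Rd_def dim_idx_def)
  qed
  have 3: "k \<in> Rd 3" for k by (simp add: Rd_def dim_idx_def)
  show ?thesis using d eq 1 2 3 unfolding sphere_int_def by auto
qed

lemma continuous_on_ridge:
  assumes "continuous_on UNIV (h :: real \<Rightarrow> complex)"
  shows "continuous_on UNIV (\<lambda>k. h (c * (k \<bullet> r)))"
  by (rule continuous_on_compose2[OF assms]) (auto intro!: continuous_intros)

lemma has_vector_derivative_sphere_int:
  assumes d: "d \<in> {2, 3}" and w: "continuous_on UNIV w"
    and h: "\<And>t. (h has_vector_derivative h' t) (at t)" and h': "continuous_on UNIV h'"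
  shows "((\<lambda>t. sphere_int d (\<lambda>k. w k * h (c * (k \<bullet> (r + t *\<^sub>R axis l 1))))) has_vector_derivative
     sphere_int d (\<lambda>k. w k * (of_real (c * k $ l) * h' (c * (k \<bullet> r))))) (at 0)"
proof -
  have ch: "continuous_on UNIV h"
    by (rule continuous_on_vector_derivative) (use h has_vector_derivative_at_within in blast)
  have arg: "c * (k \<bullet> (r + t *\<^sub>R axis l 1)) = c * (k \<bullet> r) + t * (c * k $ l)" for k :: "real^3" and t
    by (simp add: inner_add_right inner_axis algebra_simps)
  have cont: "continuous_on UNIV (\<lambda>k. w k * h (c * (k \<bullet> r) + t * (c * k $ l)))"
    "continuous_on UNIV (\<lambda>k. w k * (of_real (c * k $ l) * h' (c * (k \<bullet> r))))" for t
    by (intro continuous_on_mult w continuous_on_compose2[OF ch] continuous_on_compose2[OF h'] continuous_on_of_real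
        continuous_intros; simp)+
  from d consider "d = 2" | "d = 3" by auto
  then show ?thesis
  proof cases
    case 1
    have "((\<lambda>t. integral (cbox 0 (2 * pi)) (\<lambda>p. w (circle_pt p) * h (c * (circle_pt p \<bullet> r) + t * (c * circle_pt p $ l)))) has_vector_derivative
      integral (cbox 0 (2 * pi)) (\<lambda>p. w (circle_pt p) * (of_real (c * circle_pt p $ l) * h' (c * (circle_pt p \<bullet> r) + 0 * (c * circle_pt p $ l))))) (at 0)"
      by (rule has_vector_derivative_integral_affine)
        (intro continuous_on_compose2[OF w] continuous_intros continuous_on_circle_pt h h'; simp)+
    then show ?thesis unfolding 1 sphere_int_2 arg by simp
  next
    case 2
    have "((\<lambda>t. integral (cbox (0, 0) (pi, 2 * pi)) (\<lambda>p. (of_real (sin (fst p)) * w (sphere_pt p)) * h (c * (sphere_pt p \<bullet> r) + t * (c * sphere_pt p $ l)))) has_vector_derivative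
      integral (cbox (0, 0) (pi, 2 * pi)) (\<lambda>p. (of_real (sin (fst p)) * w (sphere_pt p)) * (of_real (c * sphere_pt p $ l) * h' (c * (sphere_pt p \<bullet> r) + 0 * (c * sphere_pt p $ l))))) (at 0)"
      by (rule has_vector_derivative_integral_affine)
        (intro continuous_on_compose2[OF w] continuous_on_of_real continuous_intros continuous_on_sphere_pt h h'; simp)+
    then show ?thesis unfolding 2 arg sphere_int_3[OF cont(1)] sphere_int_3[OF cont(2)] by (simp add: mult.assoc)
  qed
qed

lemma pdiff_pdiff_sphere_int:
  assumes d: "d \<in> {2, 3}"
    and h: "\<And>t. (h has_vector_derivative h' t) (at t)" and h': "\<And>t. (h' has_vector_derivative h'' t) (at t)"
    and h'': "continuous_on UNIV h''"
  shows "pdiff l (pdiff m (\<lambda>r. sphere_int d (\<lambda>k. h (c * (k \<bullet> r))))) r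
    = of_real (c\<^sup>2) * sphere_int d (\<lambda>k. of_real (k $ l * k $ m) * h'' (c * (k \<bullet> r)))"
proof -
  have ch': "continuous_on UNIV h'"
    by (rule continuous_on_vector_derivative) (use h' has_vector_derivative_at_within in blast)
  have "pdiff m (\<lambda>r. sphere_int d (\<lambda>k. h (c * (k \<bullet> r)))) = (\<lambda>r. sphere_int d (\<lambda>k. of_real (c * k $ m) * h' (c * (k \<bullet> r))))"
    unfolding pdiff_def using has_vector_derivative_sphere_int[OF d continuous_on_const[of _ 1] h ch']
    by (intro ext vector_derivative_at) simp
  moreover have "pdiff l (\<lambda>r. sphere_int d (\<lambda>k. of_real (c * k $ m) * h' (c * (k \<bullet> r)))) r
      = sphere_int d (\<lambda>k. of_real (c * k $ m) * (of_real (c * k $ l) * h'' (c * (k \<bullet> r))))"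
    unfolding pdiff_def
    by (intro vector_derivative_at has_vector_derivative_sphere_int[OF d _ h' h''] continuous_on_of_real continuous_intros)
  moreover have "(\<lambda>k::real^3. of_real (c * k $ m) * (of_real (c * k $ l) * h'' (c * (k \<bullet> r))))
      = (\<lambda>k. of_real (c\<^sup>2) * (of_real (k $ l * k $ m) * h'' (c * (k \<bullet> r))))"
    by (simp add: power2_eq_square ac_simps)
  ultimately show ?thesis by (simp only: sphere_int_cmult)
qed

text \<open>The derivative with respect to the shift is the integral of -g' over a full period,
  hence 0.\<close>

lemma integral_periodic_shift:
  fixes g g' :: "real \<Rightarrow> complex"
  assumes d: "\<And>t. (g has_vector_derivative g' t) (at t)" and c: "continuous_on UNIV g'"
    and per: "\<And>t. g (t + 2 * pi) = g t"
  shows "integral {0..2 * pi} (\<lambda>\<phi>. g (\<phi> - \<beta>)) = integral {0..2 * pi} g"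
proof -
  have "((\<lambda>t. integral (cbox 0 (2 * pi)) (\<lambda>p. 1 * g (p + t * - 1))) has_vector_derivative 0) (at t)" for t
  proof -
    have D: "((\<lambda>t. integral (cbox 0 (2 * pi)) (\<lambda>p. 1 * g (p + t * - 1))) has_vector_derivative
        integral (cbox 0 (2 * pi)) (\<lambda>p. 1 * (of_real (- 1) * g' (p + t * - 1)))) (at t)"
      by (rule has_vector_derivative_integral_affine[OF _ _ _ d c]) (intro continuous_intros)+
    have "((\<lambda>p. - g' (p - t)) has_integral (- g (2 * pi - t) - (- g (0 - t)))) {0..2 * pi}"
    proof (rule fundamental_theorem_of_calculus)
      show "((\<lambda>p. - g (p - t)) has_vector_derivative - g' (p - t)) (at p within {0..2 * pi})" for p
      proof -
        have "((\<lambda>p. p - t) has_vector_derivative 1) (at p)"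
          by (auto intro!: derivative_eq_intros)
        from vector_diff_chain_at[OF this d] have "((\<lambda>p. g (p - t)) has_vector_derivative g' (p - t)) (at p)"
          by (simp add: o_def)
        then show ?thesis by (rule has_vector_derivative_at_within[OF has_vector_derivative_minus])
      qed
    qed simp
    moreover have "g (2 * pi - t) = g (0 - t)" using per[of "- t"] by (simp add: add.commute)
    ultimately have "((\<lambda>p. - g' (p - t)) has_integral 0) {0..2 * pi}" by simp
    from integral_unique[OF this] have "integral (cbox 0 (2 * pi)) (\<lambda>p. 1 * (of_real (- 1) * g' (p + t * - 1))) = 0"
      by (simp add: cbox_interval)
    with D show ?thesis by (simp only:)
  qed
  then have "(\<lambda>t. integral (cbox 0 (2 * pi)) (\<lambda>p. 1 * g (p + t * - 1))) \<beta> = (\<lambda>t. integral (cbox 0 (2 * pi)) (\<lambda>p. 1 * g (p + t * - 1))) 0"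
    using has_vector_derivative_zero_constant[of UNIV "\<lambda>t. integral (cbox 0 (2 * pi)) (\<lambda>p. 1 * g (p + t * - 1))"]
    by (metis UNIV_I convex_UNIV)
  then show ?thesis by (simp add: cbox_interval)
qed

lemma polar_nonneg:
  fixes x y :: real
  shows "\<exists>\<rho> a. \<rho> \<ge> 0 \<and> x = \<rho> * cos a \<and> y = \<rho> * sin a"
proof -
  obtain \<rho> a where "x = \<rho> * cos a" "y = \<rho> * sin a" using polar_Ex by blast
  then have "\<bar>\<rho>\<bar> \<ge> 0 \<and> x = \<bar>\<rho>\<bar> * cos (if \<rho> \<ge> 0 then a else a + pi) \<and> y = \<bar>\<rho>\<bar> * sin (if \<rho> \<ge> 0 then a else a + pi)"
    by auto
  then show ?thesis by blast
qed

lemma inner_3: "(x::real^3) \<bullet> y = x $ 1 * y $ 1 + x $ 2 * y $ 2 + x $ 3 * y $ 3"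
  by (simp add: inner_vec_def sum_3)

text \<open>Polar coordinates for r turn the phase into a cosine of a shifted angle. Since r lies in
  the plane, the planar radius is the full norm of r.\<close>

lemma sphere_int_2_radial:
  fixes h h' :: "real \<Rightarrow> complex"
  assumes h: "\<And>t. (h has_vector_derivative h' t) (at t)" and h': "continuous_on UNIV h'" and r: "r \<in> Rd 2"
  shows "sphere_int 2 (\<lambda>k. h (c * (k \<bullet> r))) = integral (cbox 0 (2 * pi)) (\<lambda>\<phi>. 1 * h (0 + (c * norm r) * cos \<phi>))"
proof -
  obtain \<rho> a where a: "\<rho> \<ge> 0" "r $ 1 = \<rho> * cos a" "r $ 2 = \<rho> * sin a" using polar_nonneg by blast
  have r3: "r $ 3 = 0" using r by (simp add: Rd_def dim_idx_def)
  have "(norm r)\<^sup>2 = (\<rho> * cos a)\<^sup>2 + (\<rho> * sin a)\<^sup>2"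
    unfolding power2_norm_eq_inner inner_3 a r3 by (simp add: power2_eq_square)
  also have "\<dots> = \<rho>\<^sup>2" by (simp add: power_mult_distrib flip: distrib_left)
  finally have n: "norm r = \<rho>" using a by (simp add: power2_eq_iff_nonneg)
  have e: "c * (circle_pt \<phi> \<bullet> r) = c * \<rho> * cos (\<phi> - a)" for \<phi>
    by (simp add: circle_pt_def inner_3 a r3 cos_diff algebra_simps)
  have "sphere_int 2 (\<lambda>k. h (c * (k \<bullet> r))) = integral {0..2 * pi} (\<lambda>\<phi>. h (c * \<rho> * cos (\<phi> - a)))"
    by (simp only: sphere_int_2 cbox_interval mult_1_left e)
  also have "\<dots> = integral {0..2 * pi} (\<lambda>\<phi>. h (c * \<rho> * cos \<phi>))"
  proof (rule integral_periodic_shift)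
    show "((\<lambda>\<phi>. h (c * \<rho> * cos \<phi>)) has_vector_derivative of_real (c * \<rho> * - sin t) * h' (c * \<rho> * cos t)) (at t)" for t
      by (rule has_vector_derivative_compose_real[OF _ h]) (auto intro!: derivative_eq_intros)
    show "continuous_on UNIV (\<lambda>t. of_real (c * \<rho> * - sin t) * h' (c * \<rho> * cos t))"
      by (intro continuous_intros continuous_on_compose2[OF h']) auto
  qed simp
  finally show ?thesis by (simp add: n cbox_interval)
qed

text \<open>Rotation invariance of the surface measure: the derivative of the integral along a rotation of
  the axis is the integral of a divergence in the coordinates \<open>(\<theta>, \<phi>)\<close>.\<close>

lemma sphere_int_rotate:
  fixes h h' :: "real \<Rightarrow> complex"
  assumes h: "\<And>t. (h has_vector_derivative h' t) (at t)" and h': "continuous_on UNIV h'"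
  shows "integral (cbox (0, 0) (pi, 2 * pi)) (\<lambda>(\<theta>, \<phi>). of_real (sin \<theta>) * h (\<rho> * (sin \<alpha> * (sin \<theta> * cos \<phi>) + cos \<alpha> * cos \<theta>)))
    = integral (cbox (0, 0) (pi, 2 * pi)) (\<lambda>(\<theta>, \<phi>). of_real (sin \<theta>) * h (\<rho> * cos \<theta>))"
proof -
  have ch: "continuous_on UNIV h"
    by (rule continuous_on_vector_derivative) (use h has_vector_derivative_at_within in blast)
  let ?Q = "cbox (0, 0) (pi, 2 * pi)"
  let ?U = "\<lambda>t p. \<rho> * (sin t * (sin (fst p) * cos (snd p)) + cos t * cos (fst p))"
  let ?U' = "\<lambda>t p. \<rho> * (cos t * (sin (fst p) * cos (snd p)) - sin t * cos (fst p))"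
  define I where "I t = integral ?Q (\<lambda>p. of_real (sin (fst p)) * h (?U t p))" for t
  have dm: "((\<lambda>x. of_real (g x) * h (f x)) has_vector_derivative (of_real (g x) * (of_real f' * h' (f x)) + of_real g' * h (f x))) (at x within S)"
    if g: "(g has_real_derivative g') (at x)" and f: "(f has_real_derivative f') (at x)" for f f' g g' x S
  proof (rule has_vector_derivative_mult)
    show "((\<lambda>x. complex_of_real (g x)) has_vector_derivative of_real g') (at x within S)"
      using has_vector_derivative_at_within[of g g' x S] g
      by (intro has_vector_derivative_of_real) (simp add: has_real_derivative_iff_has_vector_derivative)
    show "((\<lambda>x. h (f x)) has_vector_derivative of_real f' * h' (f x)) (at x within S)"
      by (rule has_vector_derivative_compose_real[OF f h])
  qed
  have "(I has_vector_derivative 0) (at t)" for t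
  proof -
    \<comment> \<open>\<open>A\<close> is the \<phi>-derivative of
      \<open>cos \<theta> * sin \<phi> * h\<close> and \<open>B\<close> the \<theta>-derivative of
      \<open>sin \<theta> * cos \<phi> * h\<close>. Their integrals vanish because the sine is 0 at
      0 and 2 pi, and at 0 and pi. The difference \<open>A - B\<close> is the integrand of the
      derivative of \<open>I\<close>.\<close>
    define A where "A \<theta> \<phi> = of_real (cos \<theta> * sin \<phi>) * (of_real (\<rho> * (sin t * (sin \<theta> * - sin \<phi>))) * h' (?U t (\<theta>, \<phi>)))
        + of_real (cos \<theta> * cos \<phi>) * h (?U t (\<theta>, \<phi>))" for \<theta> \<phi>
    define B where "B \<theta> \<phi> = of_real (sin \<theta> * cos \<phi>) * (of_real (\<rho> * (sin t * (cos \<theta> * cos \<phi>) - cos t * sin \<theta>)) * h' (?U t (\<theta>, \<phi>)))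
        + of_real (cos \<theta> * cos \<phi>) * h (?U t (\<theta>, \<phi>))" for \<theta> \<phi>
    have cA: "continuous_on S (\<lambda>p. A (fst p) (snd p))" and cB: "continuous_on S (\<lambda>p. B (fst p) (snd p))" for S
      unfolding A_def B_def
      by (intro continuous_on_add continuous_on_mult continuous_on_of_real continuous_intros
          continuous_on_compose2[OF ch] continuous_on_compose2[OF h']; simp)+
    have "((\<lambda>\<phi>. A \<theta> \<phi>) has_integral (of_real (cos \<theta> * sin (2 * pi)) * h (?U t (\<theta>, 2 * pi))
        - of_real (cos \<theta> * sin 0) * h (?U t (\<theta>, 0)))) {0..2 * pi}" for \<theta>
      unfolding A_def by (rule fundamental_theorem_of_calculus, simp, rule dm) (auto intro!: derivative_eq_intros)
    then have iA: "integral {0..2 * pi} (A \<theta>) = 0" for \<theta> by (simp add: integral_unique)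
    have "((\<lambda>\<theta>. B \<theta> \<phi>) has_integral (of_real (sin pi * cos \<phi>) * h (?U t (pi, \<phi>))
        - of_real (sin 0 * cos \<phi>) * h (?U t (0, \<phi>)))) {0..pi}" for \<phi>
      unfolding B_def by (rule fundamental_theorem_of_calculus, simp, rule dm) (auto intro!: derivative_eq_intros)
    then have iB: "integral {0..pi} (\<lambda>\<theta>. B \<theta> \<phi>) = 0" for \<phi> by (simp add: integral_unique)
    have "integral ?Q (\<lambda>p. A (fst p) (snd p)) = 0"
      using iA by (subst integral_prod_continuous[OF cA]) (simp add: cbox_interval)
    moreover have "integral ?Q (\<lambda>p. B (fst p) (snd p)) = 0"
    proof -
      have "continuous_on (cbox (0, 0) (pi, 2 * pi)) (\<lambda>(\<theta>, \<phi>). B \<theta> \<phi>)"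
        using cB by (simp add: split_beta)
      from integral_swap_continuous[OF this] show ?thesis
        using iB by (subst integral_prod_continuous[OF cB]) (simp add: cbox_interval)
    qed
    ultimately have "integral ?Q (\<lambda>p. A (fst p) (snd p) - B (fst p) (snd p)) = 0"
      by (subst integral_diff) (auto intro: integrable_continuous cA cB)
    moreover have "of_real (sin (fst p)) * (of_real (?U' t p) * h' (?U t p)) = A (fst p) (snd p) - B (fst p) (snd p)" for p
    proof -
      have "sin (fst p) * ?U' t p = cos (fst p) * sin (snd p) * (\<rho> * (sin t * (sin (fst p) * - sin (snd p))))
          - sin (fst p) * cos (snd p) * (\<rho> * (sin t * (cos (fst p) * cos (snd p)) - cos t * sin (fst p)))"
        using sin_cos_squared_add[of "snd p"] by algebra
      then have "complex_of_real (sin (fst p) * ?U' t p) = of_real (cos (fst p) * sin (snd p) * (\<rho> * (sin t * (sin (fst p) * - sin (snd p))))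
          - sin (fst p) * cos (snd p) * (\<rho> * (sin t * (cos (fst p) * cos (snd p)) - cos t * sin (fst p))))"
        by (simp only:)
      then have "complex_of_real (sin (fst p)) * of_real (?U' t p) * h' (?U t p) =
          (of_real (cos (fst p) * sin (snd p)) * of_real (\<rho> * (sin t * (sin (fst p) * - sin (snd p))))
          - of_real (sin (fst p) * cos (snd p)) * of_real (\<rho> * (sin t * (cos (fst p) * cos (snd p)) - cos t * sin (fst p)))) * h' (?U t p)"
        by (simp only: of_real_mult of_real_diff)
      then show ?thesis unfolding A_def B_def by (simp only: left_diff_distrib mult.assoc fst_conv snd_conv prod.collapse) simp
    qed
    moreover have "(I has_vector_derivative integral ?Q (\<lambda>p. of_real (sin (fst p)) * (of_real (?U' t p) * h' (?U t p)))) (at t)"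
      unfolding I_def[abs_def]
    proof (rule has_vector_derivative_integral_compose[where g = ?U and g' = ?U'])
      show "continuous_on ?Q (\<lambda>p. complex_of_real (sin (fst p)))"
        by (intro continuous_intros)
      show "((\<lambda>t. ?U t p) has_real_derivative ?U' t p) (at t)" for t p
        by (auto intro!: derivative_eq_intros simp: algebra_simps)
      show "continuous_on (UNIV \<times> ?Q) (\<lambda>(t, p). ?U t p)" "continuous_on (UNIV \<times> ?Q) (\<lambda>(t, p). ?U' t p)"
        unfolding split_beta by (intro continuous_intros)+
    qed (use h h' in auto)
    ultimately show ?thesis by simp
  qed
  then have "I \<alpha> = I 0"
    using has_vector_derivative_zero_constant[of UNIV I] by (metis UNIV_I convex_UNIV)
  then show ?thesis by (simp add: I_def case_prod_unfold)
qed

text \<open>The azimuth of r is removed by periodicity and its polar angle by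
  \<open>sphere_int_rotate\<close>. With r on the polar axis, sin \<theta> d\<theta> is minus the
  differential of cos \<theta>, and the primitive \<open>H\<close> is evaluated at the two
  poles.\<close>

lemma sphere_int_3_radial:
  fixes H h h' :: "real \<Rightarrow> complex"
  assumes H: "\<And>t. (H has_vector_derivative h t) (at t)"
    and h: "\<And>t. (h has_vector_derivative h' t) (at t)" and h': "continuous_on UNIV h'"
    and c: "c \<noteq> 0" and r: "r \<noteq> 0"
  shows "sphere_int 3 (\<lambda>k. h (c * (k \<bullet> r))) = 2 * pi / (c * norm r) * (H (c * norm r) - H (- (c * norm r)))"
proof -
  have ch: "continuous_on UNIV h"
    by (rule continuous_on_vector_derivative) (use h has_vector_derivative_at_within in blast)
  obtain \<rho>' b where b: "r $ 1 = \<rho>' * cos b" "r $ 2 = \<rho>' * sin b" using polar_Ex by blast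
  obtain \<rho> a where a: "\<rho> \<ge> 0" "r $ 3 = \<rho> * cos a" "\<rho>' = \<rho> * sin a" using polar_nonneg by blast
  have "(norm r)\<^sup>2 = (\<rho> * sin a * cos b)\<^sup>2 + (\<rho> * sin a * sin b)\<^sup>2 + (\<rho> * cos a)\<^sup>2"
    unfolding power2_norm_eq_inner inner_3 a b by (simp add: power2_eq_square)
  also have "\<dots> = \<rho>\<^sup>2 * (sin a)\<^sup>2 * ((cos b)\<^sup>2 + (sin b)\<^sup>2) + \<rho>\<^sup>2 * (cos a)\<^sup>2"
    unfolding power_mult_distrib by (simp only: distrib_left)
  also have "\<dots> = \<rho>\<^sup>2 * ((sin a)\<^sup>2 + (cos a)\<^sup>2)"
    by (simp only: distrib_left sin_cos_squared_add2 mult_1_right)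
  finally have n: "norm r = \<rho>" using a by (simp add: power2_eq_iff_nonneg)
  have \<rho>: "c * \<rho> \<noteq> 0" using c r n by auto
  have "sphere_int 3 (\<lambda>k. h (c * (k \<bullet> r))) = integral {0..pi} (\<lambda>\<theta>. integral {0..2*pi} (\<lambda>\<phi>.
      of_real (sin \<theta>) * h (c * \<rho> * (sin a * (sin \<theta> * cos (\<phi> - b)) + cos a * cos \<theta>))))"
    unfolding sphere_int_def inner_3 by (simp add: a b cos_diff algebra_simps)
  also have "\<dots> = integral {0..pi} (\<lambda>\<theta>. integral {0..2*pi} (\<lambda>\<phi>.
      of_real (sin \<theta>) * h (c * \<rho> * (sin a * (sin \<theta> * cos \<phi>) + cos a * cos \<theta>))))"
  proof (rule integral_cong)
    fix \<theta> :: real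
    let ?f = "\<lambda>\<phi>. c * \<rho> * (sin a * (sin \<theta> * cos \<phi>) + cos a * cos \<theta>)"
    have "integral {0..2*pi} (\<lambda>\<phi>. h (?f (\<phi> - b))) = integral {0..2*pi} (\<lambda>\<phi>. h (?f \<phi>))"
    proof (rule integral_periodic_shift)
      show "((\<lambda>\<phi>. h (?f \<phi>)) has_vector_derivative of_real (c * \<rho> * (sin a * (sin \<theta> * - sin t))) * h' (?f t)) (at t)" for t
        by (rule has_vector_derivative_compose_real[OF _ h]) (auto intro!: derivative_eq_intros)
      show "continuous_on UNIV (\<lambda>t. of_real (c * \<rho> * (sin a * (sin \<theta> * - sin t))) * h' (?f t))"
        by (intro continuous_intros continuous_on_compose2[OF h']) auto
    qed simp
    then show "integral {0..2*pi} (\<lambda>\<phi>. of_real (sin \<theta>) * h (?f (\<phi> - b))) = integral {0..2*pi} (\<lambda>\<phi>. of_real (sin \<theta>) * h (?f \<phi>))"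
      by simp
  qed
  also have "\<dots> = integral (cbox (0, 0) (pi, 2 * pi)) (\<lambda>(\<theta>, \<phi>). of_real (sin \<theta>) * h (c * \<rho> * (sin a * (sin \<theta> * cos \<phi>) + cos a * cos \<theta>)))"
  proof -
    have "continuous_on (cbox (0, 0) (pi, 2 * pi)) (\<lambda>(\<theta>, \<phi>). of_real (sin \<theta>) * h (c * \<rho> * (sin a * (sin \<theta> * cos \<phi>) + cos a * cos \<theta>)))"
      unfolding split_beta by (intro continuous_on_mult continuous_on_of_real continuous_intros continuous_on_compose2[OF ch]) auto
    from integral_prod_continuous[OF this] show ?thesis by (simp add: cbox_interval)
  qed
  also have "\<dots> = integral (cbox (0, 0) (pi, 2 * pi)) (\<lambda>(\<theta>, \<phi>). of_real (sin \<theta>) * h (c * \<rho> * cos \<theta>))"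
    by (rule sphere_int_rotate[OF h h'])
  also have "\<dots> = integral {0..pi} (\<lambda>\<theta>. 2 * pi * (of_real (sin \<theta>) * h (c * \<rho> * cos \<theta>)))"
  proof -
    have "continuous_on (cbox (0, 0) (pi, 2 * pi)) (\<lambda>(\<theta>, \<phi>::real). of_real (sin \<theta>) * h (c * \<rho> * cos \<theta>))"
      unfolding split_beta by (intro continuous_on_mult continuous_on_of_real continuous_intros continuous_on_compose2[OF ch]) auto
    from integral_prod_continuous[OF this]
    have "integral (cbox (0, 0) (pi, 2 * pi)) (\<lambda>(\<theta>, \<phi>::real). of_real (sin \<theta>) * h (c * \<rho> * cos \<theta>))
        = integral {0..pi} (\<lambda>\<theta>. integral {0..2*pi} (\<lambda>\<phi>. of_real (sin \<theta>) * h (c * \<rho> * cos \<theta>)))"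
      by (simp only: cbox_interval prod.case)
    also have "\<dots> = integral {0..pi} (\<lambda>\<theta>. 2 * pi * (of_real (sin \<theta>) * h (c * \<rho> * cos \<theta>)))"
    proof (rule integral_cong)
      show "integral {0..2*pi} (\<lambda>\<phi>. y) = 2 * pi * y" for y :: complex
        by (simp add: scaleR_conv_of_real)
    qed
    finally show ?thesis .
  qed
  also have "\<dots> = 2 * pi * integral {0..pi} (\<lambda>\<theta>. of_real (sin \<theta>) * h (c * \<rho> * cos \<theta>))"
    by (rule integral_mult_right)
  finally have e: "sphere_int 3 (\<lambda>k. h (c * (k \<bullet> r))) = 2 * pi * integral {0..pi} (\<lambda>\<theta>. of_real (sin \<theta>) * h (c * \<rho> * cos \<theta>))" .
  have "((\<lambda>\<theta>. of_real (sin \<theta>) * h (c * \<rho> * cos \<theta>)) has_integral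
      (of_real (- 1 / (c * \<rho>)) * H (c * \<rho> * cos pi) - of_real (- 1 / (c * \<rho>)) * H (c * \<rho> * cos 0))) {0..pi}"
  proof (rule fundamental_theorem_of_calculus)
    fix t :: real
    have "((\<lambda>\<theta>. H (c * \<rho> * cos \<theta>)) has_vector_derivative of_real (c * \<rho> * - sin t) * h (c * \<rho> * cos t)) (at t)"
      by (rule has_vector_derivative_compose_real[OF _ H]) (auto intro!: derivative_eq_intros)
    from has_vector_derivative_mult_right[OF this, of "of_real (- 1 / (c * \<rho>))"]
    have "((\<lambda>\<theta>. of_real (- 1 / (c * \<rho>)) * H (c * \<rho> * cos \<theta>)) has_vector_derivative
        of_real (- 1 / (c * \<rho>) * (c * \<rho> * - sin t)) * h (c * \<rho> * cos t)) (at t)"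
      by (simp only: of_real_mult mult.assoc)
    moreover have "- 1 / (c * \<rho>) * (c * \<rho> * - sin t) = sin t" using \<rho> by simp
    ultimately show "((\<lambda>\<theta>. of_real (- 1 / (c * \<rho>)) * H (c * \<rho> * cos \<theta>)) has_vector_derivative
        of_real (sin t) * h (c * \<rho> * cos t)) (at t within {0..pi})"
      by (simp only: has_vector_derivative_at_within)
  qed simp
  then have i: "integral {0..pi} (\<lambda>\<theta>. of_real (sin \<theta>) * h (c * \<rho> * cos \<theta>)) =
      of_real (- 1 / (c * \<rho>)) * H (c * \<rho> * cos pi) - of_real (- 1 / (c * \<rho>)) * H (c * \<rho> * cos 0)"
    by (rule integral_unique)
  show ?thesis unfolding e n i using \<rho> by (simp add: field_simps)
qed

section \<open>Green functions and radial Hessians\<close>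

lemma half_not_Ints: "(1/2 :: real) \<notin> \<int>" "- (1/2 :: real) \<notin> \<int>"
proof -
  show a: "(1/2 :: real) \<notin> \<int>"
  proof
    assume "(1/2 :: real) \<in> \<int>"
    then obtain n where "(1/2 :: real) = of_int n" by (auto elim: Ints_cases)
    then have "of_int (2 * n) = (1 :: real)" by simp
    then have "2 * n = 1" by linarith
    then show False by presburger
  qed
  show "- (1/2 :: real) \<notin> \<int>" using a minus_in_Ints_iff by blast
qed

lemma
  assumes x: "x > 0"
  shows hankel1_check_minus_half: "hankel1_check (- (1/2)) x = sqrt (2 / pi) * exp (\<i> * x)"
    and hankel1_check_half: "hankel1_check (1/2) x = sqrt (2 / pi) * (- \<i> * exp (\<i> * x) / x)"
    and hankel1_check_0: "hankel1_check 0 x = J0 x + \<i> * Y0 x"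
proof -
  have e: "exp (\<i> * of_real x) = Complex (cos x) (sin x)" by (simp add: cis_conv_exp[symmetric] cis.ctr)
  have s: "sqrt (2 / (pi * x)) = sqrt (2 / pi) / sqrt x" by (simp add: real_sqrt_divide real_sqrt_mult)
  have p: "x powr (- (1/2)) = 1 / sqrt x" "x powr (1/2) = sqrt x"
    using x by (simp_all add: powr_minus powr_half_sqrt inverse_eq_divide)
  \<comment> \<open>At the orders -1/2 and 1/2 the cosine in the definition vanishes and the sine is
    -1 or 1, so a single J of opposite order remains.\<close>
  have Ym: "bessel_Y (- (1/2)) x = bessel_J (1/2) x"
    using half_not_Ints by (simp add: bessel_Y_def mult.commute[of _ pi] cos_minus)
  have Yp: "bessel_Y (1/2) x = - bessel_J (- (1/2)) x"
    using half_not_Ints by (simp add: bessel_Y_def mult.commute[of _ pi])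
  have "hankel1 (- (1/2)) x = sqrt (2 / (pi * x)) * exp (\<i> * x)"
    unfolding hankel1_def Ym bessel_J_half[OF x] bessel_J_minus_half[OF x] e by (simp add: complex_eq_iff)
  then show "hankel1_check (- (1/2)) x = sqrt (2 / pi) * exp (\<i> * x)"
    unfolding hankel1_check_def p s using x by simp
  have "hankel1 (1/2) x = sqrt (2 / (pi * x)) * (- \<i> * exp (\<i> * x))"
    unfolding hankel1_def Yp bessel_J_half[OF x] bessel_J_minus_half[OF x] e by (simp add: complex_eq_iff)
  then have "hankel1_check (1/2) x = sqrt (2 / pi) * (- \<i> * exp (\<i> * x) / (complex_of_real (sqrt x) * complex_of_real (sqrt x)))"
    unfolding hankel1_check_def p s by simp
  also have "complex_of_real (sqrt x) * complex_of_real (sqrt x) = x" using x by (simp flip: of_real_mult)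
  finally show "hankel1_check (1/2) x = sqrt (2 / pi) * (- \<i> * exp (\<i> * x) / x)" .
  show "hankel1_check 0 x = J0 x + \<i> * Y0 x"
    using x has_real_derivative_bessel_J_order(2)[OF x] bessel_Y_0[OF x]
    by (simp add: hankel1_check_def hankel1_def complex_eq_iff)
qed

lemma
  fixes k :: real and r :: "real^3"
  assumes k: "k > 0" and r: "r \<noteq> 0"
  shows green_1: "green 1 k r = \<i> / (2 * k) * exp (\<i> * (k * norm r))"
    and green_2: "green 2 k r = \<i> / 4 * (J0 (k * norm r) + \<i> * Y0 (k * norm r))"
    and green_3: "green 3 k r = exp (\<i> * (k * norm r)) / (4 * pi * norm r)"
proof -
  have x: "k * norm r > 0" using k r by simp
  have b: "k\<^sup>2 / (2 * pi) > 0" using k by simp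
  have "(k\<^sup>2 / (2 * pi)) powr (- (1/2)) = 1 / sqrt (k\<^sup>2 / (2 * pi))"
    using b by (simp add: powr_minus powr_half_sqrt inverse_eq_divide)
  also have "\<dots> = sqrt (2 * pi) / k" using k by (simp add: real_sqrt_divide)
  finally have p1: "(k\<^sup>2 / (2 * pi)) powr (- (1/2)) = sqrt (2 * pi) / k" .
  have p3: "(k\<^sup>2 / (2 * pi)) powr (1/2) = k / sqrt (2 * pi)"
    using b k by (simp add: powr_half_sqrt real_sqrt_divide)
  have s: "sqrt (2 * pi) * sqrt (2 / pi) = 2" "sqrt (2 / pi) / sqrt (2 * pi) = 1 / pi"
  proof -
    have "sqrt (2 * pi) * sqrt (2 / pi) = sqrt 4" by (simp flip: real_sqrt_mult)
    then show "sqrt (2 * pi) * sqrt (2 / pi) = 2" by simp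
    have "sqrt (2 / pi) / sqrt (2 * pi) = sqrt ((1 / pi)\<^sup>2)"
      by (simp add: power2_eq_square flip: real_sqrt_divide)
    then show "sqrt (2 / pi) / sqrt (2 * pi) = 1 / pi" by simp
  qed
  have "green 1 k r = \<i> / 4 * of_real (sqrt (2 * pi) / k) * (sqrt (2 / pi) * exp (\<i> * (k * norm r)))"
    using hankel1_check_minus_half[OF x] p1 by (simp add: green_def)
  also have "\<dots> = \<i> / 4 * of_real (sqrt (2 * pi) * sqrt (2 / pi) / k) * exp (\<i> * (k * norm r))" by simp
  finally show "green 1 k r = \<i> / (2 * k) * exp (\<i> * (k * norm r))" unfolding s by simp
  show "green 2 k r = \<i> / 4 * (J0 (k * norm r) + \<i> * Y0 (k * norm r))"
    using hankel1_check_0[OF x] b k by (simp add: green_def)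
  have "green 3 k r = \<i> / 4 * of_real (k / sqrt (2 * pi)) * (sqrt (2 / pi) * (- \<i> * exp (\<i> * (k * norm r)) / (k * norm r)))"
    using hankel1_check_half[OF x] p3 by (simp add: green_def)
  also have "\<dots> = of_real (sqrt (2 / pi) / sqrt (2 * pi)) * exp (\<i> * (k * norm r)) / (4 * norm r)"
    using k r by (simp add: field_simps)
  finally show "green 3 k r = exp (\<i> * (k * norm r)) / (4 * pi * norm r)" unfolding s by simp
qed

lemma has_real_derivative_norm_line:
  fixes r :: "real^3"
  assumes "r \<noteq> 0"
  shows "((\<lambda>t. norm (r + t *\<^sub>R axis l 1)) has_real_derivative r $ l / norm r) (at 0)"
proof -
  have n: "norm (r + t *\<^sub>R axis l 1) = sqrt ((norm r)\<^sup>2 + 2 * t * r $ l + t\<^sup>2)" for t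
    by (simp add: norm_eq_sqrt_inner inner_add_left inner_add_right inner_axis inner_axis' power2_eq_square algebra_simps)
  show ?thesis unfolding n using assms by (auto intro!: derivative_eq_intros simp: field_simps)
qed

text \<open>Entry l, m of the Hessian of f(|r|). Its last two arguments are the values of f' and f''
  at |r|, so the expression is linear in them and limits and common factors pass through.\<close>

definition radial_hessian :: "real^3 \<Rightarrow> 3 \<Rightarrow> 3 \<Rightarrow> complex \<Rightarrow> complex \<Rightarrow> complex" where
  "radial_hessian r l m f' f'' = of_real (r $ l * r $ m / (norm r)\<^sup>2) * f''
    + of_real ((if l = m then 1 else 0) / norm r - r $ l * r $ m / norm r ^ 3) * f'"

lemma radial_hessian_mult: "radial_hessian r l m (c * a) (c * b) = c * radial_hessian r l m a b"
  by (simp add: radial_hessian_def distrib_left mult.left_commute)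

lemma tendsto_radial_hessian:
  assumes "(f \<longlongrightarrow> a) F" "(g \<longlongrightarrow> b) F"
  shows "((\<lambda>x. radial_hessian r l m (f x) (g x)) \<longlongrightarrow> radial_hessian r l m a b) F"
  unfolding radial_hessian_def by (intro tendsto_add tendsto_mult_left assms)

text \<open>\<open>F\<close> is known to be radial on \<open>Rd d\<close> only, but lines along the
  axes in \<open>dim_idx d\<close> stay inside. The first derivative has to be known at all nonzero
  points of \<open>Rd d\<close>, since the second differentiates it along such a line.\<close>

lemma pdiff_pdiff_radial:
  fixes f f1 f2 :: "real \<Rightarrow> complex"
  assumes F: "\<And>r. r \<in> Rd d \<Longrightarrow> r \<noteq> 0 \<Longrightarrow> F r = f (norm r)"
    and f: "\<And>x. x > 0 \<Longrightarrow> (f has_vector_derivative f1 x) (at x)"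
    and f1: "\<And>x. x > 0 \<Longrightarrow> (f1 has_vector_derivative f2 x) (at x)"
    and r: "r \<in> Rd d" "r \<noteq> 0" and lm: "l \<in> dim_idx d" "m \<in> dim_idx d"
  shows "pdiff l (pdiff m F) r = radial_hessian r l m (f1 (norm r)) (f2 (norm r))"
proof -
  have line: "r + t *\<^sub>R axis j 1 \<in> Rd d" if "r \<in> Rd d" "j \<in> dim_idx d" for r t j
    using that by (auto simp: Rd_def axis_def)
  have op: "open {t. r + t *\<^sub>R axis j 1 \<noteq> 0}" for r :: "real^3" and j
  proof -
    have "open ((\<lambda>t. r + t *\<^sub>R axis j 1) -` (- {0}))"
      by (intro open_vimage continuous_intros)
    then show ?thesis by (simp add: vimage_def)
  qed
  have 1: "pdiff m F r = of_real (r $ m / norm r) * f1 (norm r)" if r: "r \<in> Rd d" "r \<noteq> 0" for r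
    unfolding pdiff_def
  proof (rule vector_derivative_at, rule has_vector_derivative_transform_within_open[OF _ op])
    show "((\<lambda>t. f (norm (r + t *\<^sub>R axis m 1))) has_vector_derivative of_real (r $ m / norm r) * f1 (norm r)) (at 0)"
      using has_vector_derivative_compose_real[OF has_real_derivative_norm_line[OF r(2)], of f "f1 (norm r)" m UNIV] r f by simp
    show "f (norm (r + t *\<^sub>R axis m 1)) = F (r + t *\<^sub>R axis m 1)" if "t \<in> {t. r + t *\<^sub>R axis m 1 \<noteq> 0}" for t
      using F[OF line[OF r(1) lm(2)]] that by simp
  qed (use r in simp)
  let ?D = "(if l = m then 1 else 0) / norm r - r $ l * r $ m / norm r ^ 3"
  show ?thesis
    unfolding pdiff_def[of l] radial_hessian_def
  proof (rule vector_derivative_at, rule has_vector_derivative_transform_within_open[OF _ op])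
    have "((\<lambda>t. (r + t *\<^sub>R axis l 1) $ m / norm (r + t *\<^sub>R axis l 1)) has_real_derivative
        ((if l = m then 1 else 0) * norm (r + 0 *\<^sub>R axis l 1) - (r + 0 *\<^sub>R axis l 1) $ m * (r $ l / norm r))
         / (norm (r + 0 *\<^sub>R axis l 1) * norm (r + 0 *\<^sub>R axis l 1))) (at 0)"
    proof (rule DERIV_divide[OF _ has_real_derivative_norm_line[OF r(2)]])
      show "((\<lambda>t. (r + t *\<^sub>R axis l 1) $ m) has_real_derivative (if l = m then 1 else 0)) (at 0)"
        by (auto simp: axis_def intro!: derivative_eq_intros)
    qed (use r in simp)
    then have "((\<lambda>t. (r + t *\<^sub>R axis l 1) $ m / norm (r + t *\<^sub>R axis l 1)) has_real_derivative ?D) (at 0)"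
      using r by (simp add: field_simps power3_eq_cube split: if_splits)
    then have "((\<lambda>t. complex_of_real ((r + t *\<^sub>R axis l 1) $ m / norm (r + t *\<^sub>R axis l 1))) has_vector_derivative of_real ?D) (at 0)"
      by (intro has_vector_derivative_of_real) (simp only: has_real_derivative_iff_has_vector_derivative)
    from has_vector_derivative_mult[OF this has_vector_derivative_compose_real[OF has_real_derivative_norm_line[OF r(2)], of f1 "f2 (norm r)" l UNIV]]
    have "((\<lambda>t. complex_of_real ((r + t *\<^sub>R axis l 1) $ m / norm (r + t *\<^sub>R axis l 1)) * f1 (norm (r + t *\<^sub>R axis l 1)))
       has_vector_derivative of_real ((r + 0 *\<^sub>R axis l 1) $ m / norm (r + 0 *\<^sub>R axis l 1)) * (of_real (r $ l / norm r) * f2 (norm r))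
         + of_real ?D * f1 (norm (r + 0 *\<^sub>R axis l 1))) (at 0)"
      using r f1 by simp
    moreover have "of_real ((r + 0 *\<^sub>R axis l 1) $ m / norm (r + 0 *\<^sub>R axis l 1)) * (of_real (r $ l / norm r) * f2 (norm r))
      = of_real (r $ l * r $ m / (norm r)\<^sup>2) * f2 (norm r)"
      by (simp add: power2_eq_square)
    ultimately show "((\<lambda>t. complex_of_real ((r + t *\<^sub>R axis l 1) $ m / norm (r + t *\<^sub>R axis l 1)) * f1 (norm (r + t *\<^sub>R axis l 1)))
       has_vector_derivative of_real (r $ l * r $ m / (norm r)\<^sup>2) * f2 (norm r) + of_real ?D * f1 (norm r)) (at 0)"
      by simp
    show "complex_of_real ((r + t *\<^sub>R axis l 1) $ m / norm (r + t *\<^sub>R axis l 1)) * f1 (norm (r + t *\<^sub>R axis l 1))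
        = pdiff m F (r + t *\<^sub>R axis l 1)" if "t \<in> {t. r + t *\<^sub>R axis l 1 \<noteq> 0}" for t
      using 1[OF line[OF r(1) lm(1)]] that by simp
  qed (use r in simp)
qed

text \<open>The term \<open>\<i> \<pi> e\<^sup>\<i>\<^sup>t\<close> carries the contribution of \<open>\<gamma>\<close>, so that \<open>osc\<close> is the integrand
  of the complex shift.\<close>

definition osc :: "nat \<Rightarrow> real \<Rightarrow> real \<Rightarrow> complex" where
  "osc n \<eta> t = kern n (of_real \<eta> - \<i> * of_real t) + \<i> * pi * exp (\<i> * of_real t)"

lemma has_vector_derivative_osc:
  assumes \<eta>: "\<eta> > 0" and n: "n \<le> 2"
  shows "(osc n \<eta> has_vector_derivative \<i> * osc (Suc n) \<eta> t) (at t)"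
proof -
  have "of_real \<eta> - \<i> * of_real t \<notin> \<real>\<^sub>\<le>\<^sub>0" using \<eta> by (intro not_nonpos_Reals_if_Re_pos) simp
  then have "((\<lambda>w. kern n (of_real \<eta> - \<i> * w)) has_field_derivative - kern (Suc n) (of_real \<eta> - \<i> * of_real t) * (- \<i>)) (at (of_real t))"
    by (intro DERIV_chain2[OF has_field_derivative_kern] n) (auto intro!: derivative_eq_intros)
  then have "((\<lambda>w. kern n (of_real \<eta> - \<i> * w) + \<i> * pi * exp (\<i> * w)) has_field_derivative
      - kern (Suc n) (of_real \<eta> - \<i> * of_real t) * (- \<i>) + \<i> * pi * (exp (\<i> * of_real t) * \<i>)) (at (of_real t))"
    by (intro DERIV_add DERIV_cmult) (auto intro!: derivative_eq_intros)
  from has_vector_derivative_real_field[OF this] show ?thesis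
    unfolding osc_def[abs_def] by (simp add: algebra_simps)
qed

lemma continuous_on_kern_line:
  assumes \<eta>: "\<eta> > 0" and n: "n \<le> 3"
  shows "continuous_on UNIV (\<lambda>t. kern n (of_real \<eta> - \<i> * of_real t))"
proof -
  have "isCont (kern n) (of_real \<eta> - \<i> * of_real t)" for t
  proof -
    have "of_real \<eta> - \<i> * of_real t \<notin> \<real>\<^sub>\<le>\<^sub>0" using \<eta> by (intro not_nonpos_Reals_if_Re_pos) simp
    then show ?thesis using n isCont_kern isCont_kern3 by (cases "n = 3") auto
  qed
  then have "isCont (\<lambda>t. kern n (of_real \<eta> - \<i> * of_real t)) t" for t
    by (rule isCont_o2[where g = "kern n", rotated]) (intro continuous_intros)
  then show ?thesis by (simp add: continuous_at_imp_continuous_on)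
qed

lemma continuous_on_osc:
  assumes "\<eta> > 0" "n \<le> 3"
  shows "continuous_on UNIV (osc n \<eta>)"
  unfolding osc_def[abs_def] by (intro continuous_intros continuous_on_kern_line assms)

lemma tendsto_osc:
  assumes "x \<noteq> 0" "n \<le> 2"
  shows "((\<lambda>\<eta>. osc n \<eta> x) \<longlongrightarrow> kern n (- \<i> * of_real x) + \<i> * pi * exp (\<i> * of_real x)) (at_right 0)"
  unfolding osc_def
proof (intro tendsto_add tendsto_const isCont_tendsto_compose[OF isCont_kern[OF _ assms(2)]])
  show "- \<i> * of_real x \<notin> \<real>\<^sub>\<le>\<^sub>0" using assms(1) by (auto simp: complex_nonpos_Reals_iff)
  have "((\<lambda>\<eta>. complex_of_real \<eta> - \<i> * of_real x) \<longlongrightarrow> of_real 0 - \<i> * of_real x) (at_right 0)"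
    by (intro tendsto_intros)
  then show "((\<lambda>\<eta>. complex_of_real \<eta> - \<i> * of_real x) \<longlongrightarrow> - \<i> * of_real x) (at_right 0)" by simp
qed

lemma osc_2: "osc 2 \<eta> t = osc 0 \<eta> t + 2 / (of_real \<eta> - \<i> * of_real t)\<^sup>2"
  by (simp add: osc_def kern_2)

section \<open>The complex shift\<close>

text \<open>The components of k beyond the first d vanish, so sums over \<open>dim_idx d\<close> are
  full inner products with k even when \<mu> or \<nu> leaves \<open>Rd d\<close>.\<close>

lemma transv_proj_expand:
  assumes "d \<in> {1, 2, 3}" "k \<in> Rd d"
  shows "complex_of_real (transv_proj \<mu> k \<nu>)
    = of_real (\<mu> \<bullet> \<nu>) - (\<Sum>l\<in>dim_idx d. \<Sum>m\<in>dim_idx d. of_real (\<mu> $ l * \<nu> $ m) * of_real (k $ l * k $ m))"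
proof -
  have s: "(\<Sum>l\<in>dim_idx d. a $ l * k $ l) = a \<bullet> k" for a :: "real^3"
    unfolding inner_vec_def using assms
    by (intro sum.mono_neutral_cong_left) (auto simp: Rd_def)
  have "transv_proj \<mu> k \<nu> = \<mu> \<bullet> \<nu> - (\<Sum>l\<in>dim_idx d. \<mu> $ l * k $ l) * (\<Sum>m\<in>dim_idx d. \<nu> $ m * k $ m)"
    unfolding s transv_proj_def by (simp add: inner_commute)
  also have "(\<Sum>l\<in>dim_idx d. \<mu> $ l * k $ l) * (\<Sum>m\<in>dim_idx d. \<nu> $ m * k $ m)
      = (\<Sum>l\<in>dim_idx d. \<Sum>m\<in>dim_idx d. (\<mu> $ l * \<nu> $ m) * (k $ l * k $ m))"
    by (simp add: sum_product ac_simps)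
  finally show ?thesis by simp
qed

lemma continuous_on_transv_proj: "continuous_on S (\<lambda>k. complex_of_real (transv_proj \<mu> k \<nu>))"
  unfolding transv_proj_def by (intro continuous_intros)

text \<open>The frequency measure puts 1 / (2 pi) into omega but not into gamma. After the factor i
  / 2 the exponential therefore stands beside the kernel with weight i pi, which is
  \<open>osc\<close>. Measuring frequencies in units of w0 makes \<open>w0 * \<epsilon>\<close> the
  regularisation parameter.\<close>

lemma shift_eq_sphere_int_osc:
  assumes d: "d \<in> {1, 2, 3}" and c: "c > 0" and w0: "w0 > 0" and \<epsilon>: "\<epsilon> > 0"
  shows "- omega_reg d c w0 \<mu> \<nu> r \<epsilon> + (\<i> / 2) * gamma_ij d c w0 \<mu> \<nu> r
    = of_real ((w0 / c) ^ d / (2 * pi) ^ (d - 1)) *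
      sphere_int d (\<lambda>k. of_real (transv_proj \<mu> k \<nu>) * osc d (w0 * \<epsilon>) (w0 / c * (k \<bullet> r)))"
proof -
  define \<eta> where "\<eta> = w0 * \<epsilon>"
  have \<eta>: "\<eta> > 0" using w0 \<epsilon> by (simp add: \<eta>_def)
  define T where "T k = complex_of_real (transv_proj \<mu> k \<nu>)" for k
  define K where "K k = kern d (of_real \<eta> - \<i> * of_real (w0 / c * (k \<bullet> r)))" for k
  define E where "E k = exp (\<i> * complex_of_real (w0 / c * (k \<bullet> r)))" for k
  define p where "p = complex_of_real ((2 * pi) ^ (d - 1))"
  have p: "p \<noteq> 0" by (simp add: p_def)
  have z: "of_real w0 * (of_real \<epsilon> - \<i> * of_real (k \<bullet> r / c)) = of_real \<eta> - \<i> * of_real (w0 / c * (k \<bullet> r))" for k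
    by (simp add: \<eta>_def algebra_simps)
  have inner_sum: "complex_of_real (transv_proj \<mu> k \<nu> / (2 * pi) ^ (d - 1)) *
         (\<Sum>s\<in>{1, -1::real}. pv_int_0_inf w0 (\<lambda>w.
            complex_of_real (w ^ d / (w + s * w0) / (2 * pi)) *
            exp (\<i> * complex_of_real (w * (k \<bullet> r) / c)) * complex_of_real (exp (- \<epsilon> * w))))
      = of_real (w0 ^ d / (2 * pi)) / p * (T k * K k)" for k
    unfolding sum_pv_int_eq_kern[OF w0 \<epsilon> d] z K_def T_def p_def by (simp add: ac_simps)
  have omega: "omega_reg d c w0 \<mu> \<nu> r \<epsilon> = - of_real (2 * pi / c ^ d) * (of_real (w0 ^ d / (2 * pi)) / p * sphere_int d (\<lambda>k. T k * K k))"
    unfolding omega_reg_def inner_sum sphere_int_cmult ..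
  have "complex_of_real (transv_proj \<mu> k \<nu> / (2 * pi) ^ (d - 1)) * exp (\<i> * complex_of_real (w0 * (k \<bullet> r) / c)) = 1 / p * (T k * E k)" for k
    by (simp add: T_def E_def p_def)
  then have gamma: "gamma_ij d c w0 \<mu> \<nu> r = of_real (2 * pi * w0 ^ d / c ^ d) * (1 / p * sphere_int d (\<lambda>k. T k * E k))"
    unfolding gamma_ij_def by (simp only: sphere_int_cmult)
  have cT: "continuous_on UNIV T" unfolding T_def[abs_def] by (rule continuous_on_transv_proj)
  have "continuous_on UNIV K"
    unfolding K_def[abs_def]
    by (rule continuous_on_ridge[OF continuous_on_kern_line[OF \<eta>]]) (use d in auto)
  then have cK: "continuous_on UNIV (\<lambda>k. T k * K k)" by (rule continuous_on_mult[OF cT])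
  have "continuous_on UNIV E"
    unfolding E_def[abs_def] by (intro continuous_intros)
  then have cE: "continuous_on UNIV (\<lambda>k. (\<i> * pi) * (T k * E k))"
    by (intro continuous_on_mult continuous_on_const cT)
  have "sphere_int d (\<lambda>k. T k * osc d \<eta> (w0 / c * (k \<bullet> r))) = sphere_int d (\<lambda>k. T k * K k + (\<i> * pi) * (T k * E k))"
  proof -
    have "t * (K + p * e) = t * K + p * (t * e)" for t K p e :: complex by (simp add: algebra_simps)
    then show ?thesis by (simp only: osc_def K_def E_def)
  qed
  also have "\<dots> = sphere_int d (\<lambda>k. T k * K k) + (\<i> * pi) * sphere_int d (\<lambda>k. T k * E k)"
    unfolding sphere_int_add[OF d cK cE] sphere_int_cmult ..
  finally have "sphere_int d (\<lambda>k. T k * osc d \<eta> (w0 / c * (k \<bullet> r)))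
      = sphere_int d (\<lambda>k. T k * K k) + (\<i> * pi) * sphere_int d (\<lambda>k. T k * E k)" .
  moreover have "- (- of_real (2 * pi / c ^ d) * (of_real (w0 ^ d / (2 * pi)) / p * X)) + \<i> / 2 * (of_real (2 * pi * w0 ^ d / c ^ d) * (1 / p * Y))
      = of_real ((w0 / c) ^ d / (2 * pi) ^ (d - 1)) * (X + (\<i> * pi) * Y)" for X Y
  proof -
    define W where "W = complex_of_real ((w0 / c) ^ d)"
    have 1: "of_real ((w0 / c) ^ d / (2 * pi) ^ (d - 1)) = W / p" by (simp add: W_def p_def)
    have 2: "of_real (2 * pi / c ^ d) * (of_real (w0 ^ d / (2 * pi)) / p * X) = W / p * X"
      by (simp add: W_def power_divide)
    have 3: "\<i> / 2 * (of_real (2 * pi * w0 ^ d / c ^ d) * (1 / p * Y)) = W / p * ((\<i> * pi) * Y)"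
      by (simp add: W_def power_divide)
    show ?thesis unfolding 1 3 mult_minus_left minus_minus 2 by (simp only: distrib_left)
  qed
  ultimately show ?thesis
    unfolding omega gamma T_def[symmetric] \<eta>_def[symmetric] by simp
qed

text \<open>In dimensions 2 and 3 the weight \<open>1 - kk\<close> is produced by differentiating the unweighted
  integral of \<open>osc (d - 2)\<close>, a radial function with profile \<open>\<phi>\<close>.\<close>

lemma tendsto_sphere_int_osc:
  fixes \<phi> \<phi>' \<phi>'' :: "real \<Rightarrow> real \<Rightarrow> complex" and L L' L'' :: "real \<Rightarrow> complex"
  assumes d: "d \<in> {2, 3}" and \<kappa>: "\<kappa> > 0" and r: "r \<in> Rd d" "r \<noteq> 0" and C: "C \<noteq> 0"
    and d\<phi>: "\<And>\<eta> x. \<eta> > 0 \<Longrightarrow> x > 0 \<Longrightarrow> (\<phi> \<eta> has_vector_derivative \<phi>' \<eta> x) (at x)"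
    and d\<phi>': "\<And>\<eta> x. \<eta> > 0 \<Longrightarrow> x > 0 \<Longrightarrow> (\<phi>' \<eta> has_vector_derivative \<phi>'' \<eta> x) (at x)"
    and radial: "\<And>\<eta> r. \<eta> > 0 \<Longrightarrow> r \<in> Rd d \<Longrightarrow> r \<noteq> 0 \<Longrightarrow>
        sphere_int d (\<lambda>k. osc (d - 2) \<eta> (\<kappa> * (k \<bullet> r))) = \<phi> \<eta> (\<kappa> * norm r)"
    and dL: "\<And>x. x > 0 \<Longrightarrow> (L has_vector_derivative L' x) (at x)"
    and dL': "\<And>x. x > 0 \<Longrightarrow> (L' has_vector_derivative L'' x) (at x)"
    and lim1: "\<And>x. x > 0 \<Longrightarrow> ((\<lambda>\<eta>. \<phi>' \<eta> x) \<longlongrightarrow> L' x) (at_right 0)"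
    and lim2: "\<And>x. x > 0 \<Longrightarrow> ((\<lambda>\<eta>. \<phi>'' \<eta> x) \<longlongrightarrow> L'' x) (at_right 0)"
    and lim: "((\<lambda>\<eta>. sphere_int d (\<lambda>k. osc d \<eta> (\<kappa> * (k \<bullet> r)))) \<longlongrightarrow> L (\<kappa> * norm r)) (at_right 0)"
    and green: "\<And>r. r \<noteq> 0 \<Longrightarrow> green d \<kappa> r = C * L (\<kappa> * norm r)"
  shows "((\<lambda>\<eta>. sphere_int d (\<lambda>k. of_real (transv_proj \<mu> k \<nu>) * osc d \<eta> (\<kappa> * (k \<bullet> r)))) \<longlongrightarrow>
      dyadic_green_contr d \<kappa> \<mu> r \<nu> / C) (at_right 0)"
proof -
  have d3: "d \<in> {1, 2, 3}" and dd: "Suc (Suc (d - 2)) = d" and d2: "d - 2 \<le> 2" "Suc (d - 2) \<le> 2" using d by auto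
  let ?x = "\<kappa> * norm r"
  have x: "?x > 0" using \<kappa> r by simp
  have scale: "((\<lambda>x. f (\<kappa> * x)) has_vector_derivative of_real \<kappa> * f' (\<kappa> * x)) (at x)"
    if "\<And>x. x > 0 \<Longrightarrow> (f has_vector_derivative f' x) (at x)" "x > 0" for f f' :: "real \<Rightarrow> complex" and x
    by (rule has_vector_derivative_compose_real) (use that \<kappa> in \<open>auto intro!: derivative_eq_intros\<close>)
  have hess: "pdiff l (pdiff m F) r = of_real (\<kappa>\<^sup>2) * radial_hessian r l m (f' ?x / \<kappa>) (f'' ?x)"
    if F: "\<And>r. r \<in> Rd d \<Longrightarrow> r \<noteq> 0 \<Longrightarrow> F r = f (\<kappa> * norm r)"
      and f: "\<And>x. x > 0 \<Longrightarrow> (f has_vector_derivative f' x) (at x)"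
      and f': "\<And>x. x > 0 \<Longrightarrow> (f' has_vector_derivative f'' x) (at x)"
      and lm: "l \<in> dim_idx d" "m \<in> dim_idx d" for F f f' f'' l m
  proof -
    have 2: "((\<lambda>x. of_real \<kappa> * f' (\<kappa> * x)) has_vector_derivative of_real \<kappa> * (of_real \<kappa> * f'' (\<kappa> * x))) (at x)" if "x > 0" for x
      by (intro has_vector_derivative_mult_right scale f' that)
    have p: "pdiff l (pdiff m F) r = radial_hessian r l m (of_real \<kappa> * f' ?x) (of_real \<kappa> * (of_real \<kappa> * f'' ?x))"
      by (rule pdiff_pdiff_radial[OF F scale[OF f] 2 r lm])
    have e: "of_real \<kappa> * f' ?x = of_real (\<kappa>\<^sup>2) * (f' ?x / \<kappa>)" "of_real \<kappa> * (of_real \<kappa> * f'' ?x) = of_real (\<kappa>\<^sup>2) * f'' ?x"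
      using \<kappa> by (simp_all add: power2_eq_square)
    show ?thesis unfolding p e radial_hessian_mult ..
  qed
  \<comment> \<open>Two derivatives of \<open>osc (d - 2)\<close> bring out i * i = -1, so the
    second moments of k against \<open>osc d\<close> are minus the Hessian. With the minus sign in 1
    - kk the Hessian enters positively, as in the dyadic Green's function.\<close>
  have sp: "sphere_int d (\<lambda>k. of_real (k $ l * k $ m) * osc d \<eta> (\<kappa> * (k \<bullet> r))) =
      - radial_hessian r l m (\<phi>' \<eta> ?x / \<kappa>) (\<phi>'' \<eta> ?x)"
    if \<eta>: "\<eta> > 0" and lm: "l \<in> dim_idx d" "m \<in> dim_idx d" for \<eta> l m
  proof -
    let ?I = "sphere_int d (\<lambda>k. of_real (k $ l * k $ m) * osc d \<eta> (\<kappa> * (k \<bullet> r)))"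
    note o = has_vector_derivative_osc[OF \<eta>]
    have 2: "((\<lambda>t. \<i> * osc (Suc (d - 2)) \<eta> t) has_vector_derivative - osc d \<eta> t) (at t)" for t
      using has_vector_derivative_mult_right[OF o[OF d2(2)], of \<i> t] by (simp add: dd flip: mult.assoc)
    have "d \<le> 3" using d by auto
    then have "continuous_on UNIV (\<lambda>t. - osc d \<eta> t)" by (intro continuous_intros continuous_on_osc \<eta>)
    from pdiff_pdiff_sphere_int[OF d o[OF d2(1)] 2 this, where c = \<kappa> and l = l and m = m and r = r]
    have p: "pdiff l (pdiff m (\<lambda>r. sphere_int d (\<lambda>k. osc (d - 2) \<eta> (\<kappa> * (k \<bullet> r))))) r
        = of_real (\<kappa>\<^sup>2) * sphere_int d (\<lambda>k. (- 1) * (of_real (k $ l * k $ m) * osc d \<eta> (\<kappa> * (k \<bullet> r))))"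
      by simp
    have h: "pdiff l (pdiff m (\<lambda>r. sphere_int d (\<lambda>k. osc (d - 2) \<eta> (\<kappa> * (k \<bullet> r))))) r
        = of_real (\<kappa>\<^sup>2) * radial_hessian r l m (\<phi>' \<eta> ?x / \<kappa>) (\<phi>'' \<eta> ?x)"
      by (rule hess[OF radial[OF \<eta>] d\<phi>[OF \<eta>] d\<phi>'[OF \<eta>] lm])
    have "of_real (\<kappa>\<^sup>2) * - ?I = of_real (\<kappa>\<^sup>2) * radial_hessian r l m (\<phi>' \<eta> ?x / \<kappa>) (\<phi>'' \<eta> ?x)"
      using p unfolding h sphere_int_cmult by simp
    then have n: "- ?I = radial_hessian r l m (\<phi>' \<eta> ?x / \<kappa>) (\<phi>'' \<eta> ?x)"
      using \<kappa> by (subst (asm) mult_left_cancel) auto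
    show ?thesis unfolding n[symmetric] minus_minus ..
  qed
  let ?S = "\<lambda>a b. \<Sum>l\<in>dim_idx d. \<Sum>m\<in>dim_idx d. of_real (\<mu> $ l * \<nu> $ m) * radial_hessian r l m (a / of_real \<kappa>) b"
  have expand: "sphere_int d (\<lambda>k. of_real (transv_proj \<mu> k \<nu>) * osc d \<eta> (\<kappa> * (k \<bullet> r)))
    = of_real (\<mu> \<bullet> \<nu>) * sphere_int d (\<lambda>k. osc d \<eta> (\<kappa> * (k \<bullet> r))) + ?S (\<phi>' \<eta> ?x) (\<phi>'' \<eta> ?x)"
    if \<eta>: "\<eta> > 0" for \<eta>
  proof -
    let ?o = "\<lambda>k. osc d \<eta> (\<kappa> * (k \<bullet> r))"
    let ?t = "\<lambda>l m k. - of_real (\<mu> $ l * \<nu> $ m) * (of_real (k $ l * k $ m) * ?o k)"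
    have co: "continuous_on UNIV ?o"
      by (rule continuous_on_ridge[OF continuous_on_osc]) (use \<eta> d in auto)
    have c: "continuous_on UNIV (\<lambda>k. of_real (\<mu> \<bullet> \<nu>) * ?o k)" "continuous_on UNIV (?t l m)" for l m
      by (intro continuous_on_mult continuous_on_const continuous_on_of_real continuous_on_component
          continuous_on_id co)+
    have cs: "continuous_on UNIV (\<lambda>k. \<Sum>m\<in>dim_idx d. ?t l m k)"
      "continuous_on UNIV (\<lambda>k. \<Sum>l\<in>dim_idx d. \<Sum>m\<in>dim_idx d. ?t l m k)" for l
      by (intro continuous_on_sum c)+
    have "sphere_int d (\<lambda>k. of_real (transv_proj \<mu> k \<nu>) * ?o k)
      = sphere_int d (\<lambda>k. of_real (\<mu> \<bullet> \<nu>) * ?o k + (\<Sum>l\<in>dim_idx d. \<Sum>m\<in>dim_idx d. ?t l m k))"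
    proof (rule sphere_int_cong[OF d3])
      show "of_real (transv_proj \<mu> k \<nu>) * ?o k
          = of_real (\<mu> \<bullet> \<nu>) * ?o k + (\<Sum>l\<in>dim_idx d. \<Sum>m\<in>dim_idx d. ?t l m k)" if "k \<in> Rd d" for k
        unfolding transv_proj_expand[OF d3 that]
        by (simp only: diff_conv_add_uminus distrib_right mult_minus_left sum_distrib_right sum_negf mult.assoc)
    qed
    also have "\<dots> = of_real (\<mu> \<bullet> \<nu>) * sphere_int d ?o + (\<Sum>l\<in>dim_idx d. \<Sum>m\<in>dim_idx d.
        - of_real (\<mu> $ l * \<nu> $ m) * sphere_int d (\<lambda>k. of_real (k $ l * k $ m) * ?o k))"
      unfolding sphere_int_add[OF d3 c(1) cs(2)] sphere_int_sum[OF d3 finite cs(1)] sphere_int_sum[OF d3 finite c(2)]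
        sphere_int_cmult ..
    also have "(\<Sum>l\<in>dim_idx d. \<Sum>m\<in>dim_idx d. - of_real (\<mu> $ l * \<nu> $ m) * sphere_int d (\<lambda>k. of_real (k $ l * k $ m) * ?o k))
      = ?S (\<phi>' \<eta> ?x) (\<phi>'' \<eta> ?x)"
    proof (rule sum.cong[OF refl], rule sum.cong[OF refl])
      fix l m assume lm: "l \<in> dim_idx d" "m \<in> dim_idx d"
      show "- of_real (\<mu> $ l * \<nu> $ m) * sphere_int d (\<lambda>k. of_real (k $ l * k $ m) * ?o k)
          = of_real (\<mu> $ l * \<nu> $ m) * radial_hessian r l m (\<phi>' \<eta> ?x / \<kappa>) (\<phi>'' \<eta> ?x)"
        unfolding sp[OF \<eta> lm] by (simp only: mult_minus_left mult_minus_right minus_minus)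
    qed
    finally show ?thesis .
  qed
  \<comment> \<open>The unweighted integral of \<open>osc d\<close> and the profile of
    \<open>osc (d - 2)\<close> are governed by the same limit function L, although their integrands
    differ by a rational term.\<close>
  have "((\<lambda>\<eta>. of_real (\<mu> \<bullet> \<nu>) * sphere_int d (\<lambda>k. osc d \<eta> (\<kappa> * (k \<bullet> r))) + ?S (\<phi>' \<eta> ?x) (\<phi>'' \<eta> ?x))
    \<longlongrightarrow> of_real (\<mu> \<bullet> \<nu>) * L ?x + ?S (L' ?x) (L'' ?x)) (at_right 0)"
    using \<kappa> by (intro tendsto_add tendsto_mult_left tendsto_sum tendsto_radial_hessian tendsto_divide tendsto_const
        lim lim1 lim2 x) simp
  moreover have "\<forall>\<^sub>F \<eta> in at_right 0.
      of_real (\<mu> \<bullet> \<nu>) * sphere_int d (\<lambda>k. osc d \<eta> (\<kappa> * (k \<bullet> r))) + ?S (\<phi>' \<eta> ?x) (\<phi>'' \<eta> ?x)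
      = sphere_int d (\<lambda>k. of_real (transv_proj \<mu> k \<nu>) * osc d \<eta> (\<kappa> * (k \<bullet> r)))"
    using eventually_at_right_less[of 0] by eventually_elim (rule expand[symmetric])
  ultimately have "((\<lambda>\<eta>. sphere_int d (\<lambda>k. of_real (transv_proj \<mu> k \<nu>) * osc d \<eta> (\<kappa> * (k \<bullet> r)))) \<longlongrightarrow>
      of_real (\<mu> \<bullet> \<nu>) * L ?x + ?S (L' ?x) (L'' ?x)) (at_right 0)"
    by (rule Lim_transform_eventually)
  also have "of_real (\<mu> \<bullet> \<nu>) * L ?x + ?S (L' ?x) (L'' ?x) = dyadic_green_contr d \<kappa> \<mu> r \<nu> / C"
  proof -
    have gr: "pdiff l (pdiff m (green d \<kappa>)) r = (C * of_real (\<kappa>\<^sup>2)) * radial_hessian r l m (L' ?x / \<kappa>) (L'' ?x)"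
      if lm: "l \<in> dim_idx d" "m \<in> dim_idx d" for l m
      using hess[of "green d \<kappa>" "\<lambda>x. C * L x" "\<lambda>x. C * L' x" "\<lambda>x. C * L'' x", OF green
          has_vector_derivative_mult_right[OF dL] has_vector_derivative_mult_right[OF dL'] lm]
      by (simp add: radial_hessian_mult mult.left_commute flip: times_divide_eq_right)
    have "(\<Sum>l\<in>dim_idx d. \<Sum>m\<in>dim_idx d. of_real (\<mu> $ l * \<nu> $ m) * pdiff l (pdiff m (green d \<kappa>)) r)
        = (\<Sum>l\<in>dim_idx d. \<Sum>m\<in>dim_idx d. (C * of_real (\<kappa>\<^sup>2)) * (of_real (\<mu> $ l * \<nu> $ m) * radial_hessian r l m (L' ?x / \<kappa>) (L'' ?x)))"
      by (intro sum.cong refl) (simp add: gr)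
    also have "\<dots> = (C * of_real (\<kappa>\<^sup>2)) * ?S (L' ?x) (L'' ?x)"
      by (simp only: sum_distrib_left)
    finally have e: "(\<Sum>l\<in>dim_idx d. \<Sum>m\<in>dim_idx d. of_real (\<mu> $ l * \<nu> $ m) * pdiff l (pdiff m (green d \<kappa>)) r)
        = (C * of_real (\<kappa>\<^sup>2)) * ?S (L' ?x) (L'' ?x)" .
    have "a * b + S = (a * (C * b) + of_real (1 / \<kappa>\<^sup>2) * (C * of_real (\<kappa>\<^sup>2) * S)) / C" for a b S
      using C \<kappa> by (simp add: field_simps)
    then show ?thesis
      unfolding dyadic_green_contr_def green[OF r(2)] e .
  qed
  finally show ?thesis .
qed

section \<open>Rational remainders and the planar radial function\<close>

lemma continuous_on_inverse_power_line:
  assumes "\<eta> > 0"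
  shows "continuous_on UNIV (\<lambda>t. a / (of_real \<eta> - \<i> * of_real t) ^ n :: complex)"
proof (intro continuous_intros ballI)
  fix t :: real
  have "Re (of_real \<eta> - \<i> * of_real t) \<noteq> 0" using assms by simp
  then have "of_real \<eta> - \<i> * of_real t \<noteq> 0" by (metis zero_complex.sel(1))
  then show "(of_real \<eta> - \<i> * of_real t) ^ n \<noteq> 0" by (rule power_not_zero)
qed

lemma has_vector_derivative_inverse_power_line:
  assumes "\<eta> > 0"
  shows "((\<lambda>t. a / (of_real \<eta> - \<i> * of_real t) ^ n) has_vector_derivative
    of_nat n * \<i> * a / (of_real \<eta> - \<i> * of_real t) ^ Suc n) (at t)"
proof -
  let ?z = "of_real \<eta> - \<i> * of_real t"
  have "Re ?z \<noteq> 0" using assms by simp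
  then have z: "?z \<noteq> 0" by (metis zero_complex.sel(1))
  have "((\<lambda>w. a * inverse ((of_real \<eta> - \<i> * w) ^ n)) has_field_derivative
      a * - (inverse (?z ^ n) * (of_nat n * ?z ^ (n - 1) * - \<i>) * inverse (?z ^ n))) (at (of_real t))"
  proof (rule DERIV_cmult, rule DERIV_inverse')
    show "((\<lambda>w. (of_real \<eta> - \<i> * w) ^ n) has_field_derivative of_nat n * ?z ^ (n - 1) * - \<i>) (at (of_real t))"
      by (auto intro!: derivative_eq_intros)
    show "?z ^ n \<noteq> 0" using z by (rule power_not_zero)
  qed
  moreover have "a * - (inverse (z ^ n) * (of_nat n * z ^ (n - 1) * - \<i>) * inverse (z ^ n))
      = of_nat n * \<i> * a / z ^ Suc n" if "z \<noteq> 0" for z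
    using that by (cases n) (simp_all add: field_simps)
  note this[OF z]
  ultimately have "((\<lambda>w. a * inverse ((of_real \<eta> - \<i> * w) ^ n)) has_field_derivative
      of_nat n * \<i> * a / ?z ^ Suc n) (at (of_real t))" by (simp only:)
  from has_vector_derivative_real_field[OF this] show ?thesis by (simp add: divide_inverse)
qed

text \<open>As a function of x the integral q satisfies (\<eta>^2 + x^2) q' + 3 x q = 0, so it is a
  multiple of (\<eta>^2 + x^2)^(-3/2). At x = 0 the integrand is constant, which fixes the
  factor.\<close>

lemma circle_integral_inverse_square:
  assumes \<eta>: "\<eta> > 0"
  shows "integral (cbox 0 (2 * pi)) (\<lambda>\<phi>. 1 * (1 / (of_real \<eta> - \<i> * of_real (0 + x * cos \<phi>))\<^sup>2))
    = of_real (2 * pi * \<eta> / sqrt (\<eta>\<^sup>2 + x\<^sup>2) ^ 3)"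
proof -
  define h where "h t = 1 / (of_real \<eta> - \<i> * of_real t)\<^sup>2" for t
  define h' where "h' t = 2 * \<i> / (of_real \<eta> - \<i> * of_real t) ^ 3" for t
  define q where "q x = integral (cbox 0 (2 * pi)) (\<lambda>\<phi>. 1 * h (0 + x * cos \<phi>))" for x
  define q' where "q' x = integral (cbox 0 (2 * pi)) (\<lambda>\<phi>. 1 * (of_real (cos \<phi>) * h' (0 + x * cos \<phi>)))" for x
  have dh: "(h has_vector_derivative h' t) (at t)" for t
    unfolding h_def[abs_def] h'_def
    using has_vector_derivative_inverse_power_line[OF \<eta>, of 1 2 t] by (simp add: numeral_3_eq_3 numeral_2_eq_2)
  have ch': "continuous_on UNIV h'" and ch: "continuous_on UNIV h"
    unfolding h'_def[abs_def] h_def[abs_def] by (rule continuous_on_inverse_power_line[OF \<eta>])+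
  have dq: "(q has_vector_derivative q' x) (at x)" for x
    unfolding q_def[abs_def] q'_def
    by (rule has_vector_derivative_integral_affine[OF _ _ _ dh ch']) (intro continuous_intros)+
  have ode: "of_real (\<eta>\<^sup>2 + x\<^sup>2) * q' x + 3 * of_real x * q x = 0" for x
  proof -
    let ?D = "\<lambda>w. of_real \<eta> - \<i> * (of_real x * cos w)"
    let ?N = "\<lambda>w. 2 * \<i> * of_real \<eta> + of_real x * cos w"
    \<comment> \<open>Its \<phi>-derivative is the integrand of the left-hand side, and the factor
      sin makes it vanish at 0 and 2 pi.\<close>
    let ?F = "\<lambda>w. sin w * ?N w / (?D w)\<^sup>2"
    have "((\<lambda>\<phi>. ?F (of_real \<phi>)) has_vector_derivative
        of_real (\<eta>\<^sup>2 + x\<^sup>2) * (of_real (cos \<phi>) * h' (0 + x * cos \<phi>)) + 3 * of_real x * h (0 + x * cos \<phi>)) (at \<phi>)" for \<phi> :: real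
    proof -
      let ?w = "complex_of_real \<phi>"
      have "Re (?D ?w) \<noteq> 0" using \<eta> by (simp add: cos_of_real)
      then have D0: "?D ?w \<noteq> 0" by (metis zero_complex.sel(1))
      have num: "((\<lambda>w. sin w * ?N w) has_field_derivative cos ?w * ?N ?w + of_real x * - sin ?w * sin ?w) (at ?w)"
        by (rule DERIV_mult) (auto intro!: derivative_eq_intros)
      have den: "((\<lambda>w. (?D w)\<^sup>2) has_field_derivative 2 * ?D ?w * (\<i> * of_real x * sin ?w)) (at ?w)"
        by (auto intro!: derivative_eq_intros)
      have "(?F has_field_derivative ((cos ?w * ?N ?w + of_real x * - sin ?w * sin ?w) * (?D ?w)\<^sup>2
          - sin ?w * ?N ?w * (2 * ?D ?w * (\<i> * of_real x * sin ?w))) / ((?D ?w)\<^sup>2 * (?D ?w)\<^sup>2)) (at ?w)"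
        using D0 by (intro DERIV_divide num den) auto
      moreover have "((c * N + X * - s * s) * D\<^sup>2 - s * N * (2 * D * (\<i> * X * s))) / (D\<^sup>2 * D\<^sup>2)
          = (e\<^sup>2 + X\<^sup>2) * (c * (2 * \<i> / D ^ 3)) + 3 * X * (1 / D\<^sup>2)"
        if "D = e - \<i> * (X * c)" "N = 2 * \<i> * e + X * c" "s\<^sup>2 + c\<^sup>2 = 1" "D \<noteq> 0" for c N X s D e :: complex
      proof -
        have ii: "\<i> * \<i> = -1" by simp
        have "(c * N + X * - s * s) * D - s * N * (2 * (\<i> * X * s)) = (e\<^sup>2 + X\<^sup>2) * (c * (2 * \<i>)) + 3 * X * D"
          using that(1-3) ii by algebra
        then have "((c * N + X * - s * s) * D - s * N * (2 * (\<i> * X * s))) * D / D ^ 4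
            = ((e\<^sup>2 + X\<^sup>2) * (c * (2 * \<i>)) + 3 * X * D) * D / D ^ 4" by simp
        then show ?thesis using that(4)
          by (simp add: field_simps power2_eq_square power3_eq_cube power4_eq_xxxx)
      qed
      from this[OF refl refl _ D0, of "sin ?w"]
      have "((cos ?w * ?N ?w + of_real x * - sin ?w * sin ?w) * (?D ?w)\<^sup>2
          - sin ?w * ?N ?w * (2 * ?D ?w * (\<i> * of_real x * sin ?w))) / ((?D ?w)\<^sup>2 * (?D ?w)\<^sup>2)
          = ((of_real \<eta>)\<^sup>2 + (of_real x)\<^sup>2) * (cos ?w * (2 * \<i> / ?D ?w ^ 3)) + 3 * of_real x * (1 / (?D ?w)\<^sup>2)"
        by simp
      ultimately have "(?F has_field_derivative ((of_real \<eta>)\<^sup>2 + (of_real x)\<^sup>2) * (cos ?w * (2 * \<i> / ?D ?w ^ 3)) + 3 * of_real x * (1 / (?D ?w)\<^sup>2)) (at ?w)"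
        by (simp only:)
      from has_vector_derivative_real_field[OF this] show ?thesis
        by (simp add: h_def h'_def cos_of_real)
    qed
    then have "((\<lambda>\<phi>. of_real (\<eta>\<^sup>2 + x\<^sup>2) * (of_real (cos \<phi>) * h' (0 + x * cos \<phi>)) + 3 * of_real x * h (0 + x * cos \<phi>))
        has_integral (?F (of_real (2 * pi)) - ?F (of_real 0))) {0..2 * pi}"
      by (intro fundamental_theorem_of_calculus) (auto simp: has_vector_derivative_at_within)
    then have F0: "((\<lambda>\<phi>. of_real (\<eta>\<^sup>2 + x\<^sup>2) * (of_real (cos \<phi>) * h' (0 + x * cos \<phi>)) + 3 * of_real x * h (0 + x * cos \<phi>))
        has_integral 0) (cbox 0 (2 * pi))"
      by (simp only: sin_of_real cbox_interval) simp
    have "(\<lambda>\<phi>. 1 * (of_real (cos \<phi>) * h' (0 + x * cos \<phi>))) integrable_on cbox 0 (2 * pi)"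
      "(\<lambda>\<phi>. 1 * h (0 + x * cos \<phi>)) integrable_on cbox 0 (2 * pi)"
      by (intro integrable_continuous continuous_on_mult continuous_on_of_real continuous_on_const
          continuous_on_compose2[OF ch] continuous_on_compose2[OF ch'] continuous_intros; simp)+
    then have "((\<lambda>\<phi>. of_real (\<eta>\<^sup>2 + x\<^sup>2) * (1 * (of_real (cos \<phi>) * h' (0 + x * cos \<phi>))) + 3 * of_real x * (1 * h (0 + x * cos \<phi>)))
        has_integral of_real (\<eta>\<^sup>2 + x\<^sup>2) * q' x + 3 * of_real x * q x) (cbox 0 (2 * pi))"
      unfolding q_def q'_def by (intro has_integral_add has_integral_mult_right integrable_integral)
    with F0 show ?thesis using has_integral_unique by (simp only: mult_1_left) blast
  qed
  define s where "s x = sqrt (\<eta>\<^sup>2 + x\<^sup>2)" for x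
  have s0: "s x > 0" "(s x)\<^sup>2 = \<eta>\<^sup>2 + x\<^sup>2" for x using \<eta> by (auto simp: s_def add_pos_nonneg)
  have "((\<lambda>x. of_real (s x ^ 3) * q x) has_vector_derivative 0) (at x)" for x
  proof -
    have "(s has_real_derivative x / s x) (at x)"
      unfolding s_def[abs_def] using s0(1)[of x] by (auto intro!: derivative_eq_intros simp: s_def field_simps)
    then have "((\<lambda>x. s x ^ 3) has_real_derivative of_nat 3 * (x / s x * s x ^ (3 - Suc 0))) (at x)"
      by (rule DERIV_power)
    then have "((\<lambda>x. s x ^ 3) has_real_derivative 3 * x * s x) (at x)"
      using s0(1)[of x] by (simp add: power2_eq_square mult.assoc)
    then have "((\<lambda>x. complex_of_real (s x ^ 3)) has_vector_derivative of_real (3 * x * s x)) (at x)"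
      by (intro has_vector_derivative_of_real) (simp add: has_real_derivative_iff_has_vector_derivative)
    from has_vector_derivative_mult[OF this dq]
    have "((\<lambda>x. of_real (s x ^ 3) * q x) has_vector_derivative of_real (s x ^ 3) * q' x + of_real (3 * x * s x) * q x) (at x)" .
    moreover have "of_real (s x ^ 3) * q' x + of_real (3 * x * s x) * q x
        = of_real (s x) * (of_real ((s x)\<^sup>2) * q' x + 3 * of_real x * q x)"
      by (simp add: algebra_simps power2_eq_square power3_eq_cube)
    ultimately show ?thesis unfolding s0(2) ode by simp
  qed
  then have "of_real (s x ^ 3) * q x = of_real (s 0 ^ 3) * q 0"
    using has_vector_derivative_zero_constant[of UNIV "\<lambda>x. of_real (s x ^ 3) * q x"] by (metis UNIV_I convex_UNIV)
  also have "\<dots> = of_real (2 * pi * \<eta>)"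
    using \<eta> by (simp add: s_def q_def h_def scaleR_conv_of_real power2_eq_square power3_eq_cube)
  finally have "q x = of_real (2 * pi * \<eta>) / of_real (s x ^ 3)"
    using s0(1)[of x] by (simp add: field_simps)
  then show ?thesis by (simp add: q_def h_def s_def)
qed

text \<open>This family takes the role of \<open>u\<close> in \<open>bessel_limit\<close>; x stands
  for the wave number times the distance.\<close>

definition circle_profile :: "real \<Rightarrow> real \<Rightarrow> complex" where
  "circle_profile \<eta> x = integral (cbox 0 (2 * pi)) (\<lambda>\<phi>. 1 * osc 0 \<eta> (0 + x * cos \<phi>))"

definition circle_profile' :: "real \<Rightarrow> real \<Rightarrow> complex" where
  "circle_profile' \<eta> x = integral (cbox 0 (2 * pi)) (\<lambda>\<phi>. 1 * (of_real (cos \<phi>) * (\<i> * osc 1 \<eta> (0 + x * cos \<phi>))))"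

lemma circle_integral_osc_2:
  assumes \<eta>: "\<eta> > 0"
  shows "integral (cbox 0 (2 * pi)) (\<lambda>\<phi>. 1 * osc 2 \<eta> (0 + x * cos \<phi>))
    = circle_profile \<eta> x + of_real (4 * pi * \<eta> / sqrt (\<eta>\<^sup>2 + x\<^sup>2) ^ 3)"
proof -
  have i: "(\<lambda>\<phi>. 1 * osc 0 \<eta> (0 + x * cos \<phi>)) integrable_on cbox 0 (2 * pi)"
    by (intro integrable_continuous continuous_on_mult continuous_on_const
        continuous_on_compose2[OF continuous_on_osc[OF \<eta>, of 0]] continuous_intros) auto
  have j: "(\<lambda>\<phi>. 2 * (1 * (1 / (of_real \<eta> - \<i> * of_real (0 + x * cos \<phi>))\<^sup>2))) integrable_on cbox 0 (2 * pi)"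
    by (intro integrable_continuous continuous_on_mult continuous_on_const
        continuous_on_compose2[OF continuous_on_inverse_power_line[OF \<eta>]] continuous_intros) auto
  have "integral (cbox 0 (2 * pi)) (\<lambda>\<phi>. 1 * osc 2 \<eta> (0 + x * cos \<phi>))
      = integral (cbox 0 (2 * pi)) (\<lambda>\<phi>. 1 * osc 0 \<eta> (0 + x * cos \<phi>)
          + 2 * (1 * (1 / (of_real \<eta> - \<i> * of_real (0 + x * cos \<phi>))\<^sup>2)))"
    by (simp add: osc_2)
  also have "\<dots> = circle_profile \<eta> x + 2 * of_real (2 * pi * \<eta> / sqrt (\<eta>\<^sup>2 + x\<^sup>2) ^ 3)"
  proof -
    have "integral (cbox 0 (2 * pi)) (\<lambda>\<phi>. 2 * (1 * (1 / (of_real \<eta> - \<i> * of_real (0 + x * cos \<phi>))\<^sup>2)))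
      = 2 * integral (cbox 0 (2 * pi)) (\<lambda>\<phi>. 1 * (1 / (of_real \<eta> - \<i> * of_real (0 + x * cos \<phi>))\<^sup>2))"
      by (rule integral_mult_right)
    then show ?thesis
      unfolding integral_add[OF i j] circle_profile_def circle_integral_inverse_square[OF \<eta>] by (simp only:)
  qed
  finally show ?thesis by simp
qed

text \<open>In x u'' the integrand \<open>osc 2\<close> has the weight cos^2, and integration by
  parts in \<phi> gives it the weight sin^2 in u'; together they form -x times the unweighted
  integral of \<open>osc 2\<close>. Passing to \<open>osc 0\<close> costs the term 2 / z^2, whose
  circle integral yields the source.\<close>

lemma
  assumes \<eta>: "\<eta> > 0"
  shows has_vector_derivative_circle_profile: "(circle_profile \<eta> has_vector_derivative circle_profile' \<eta> x) (at x)"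
    and circle_profile_ode: "((\<lambda>x. of_real x * circle_profile' \<eta> x) has_vector_derivative
      - of_real x * circle_profile \<eta> x - of_real (bessel_source \<eta> x)) (at x)"
    and continuous_circle_profile': "isCont (circle_profile' \<eta>) x"
proof -
  let ?B = "cbox 0 (2 * pi) :: real set"
  have o0: "(osc 0 \<eta> has_vector_derivative \<i> * osc 1 \<eta> t) (at t)" for t
    using has_vector_derivative_osc[OF \<eta>, of 0 t] by simp
  have o1: "((\<lambda>t. \<i> * osc 1 \<eta> t) has_vector_derivative - osc 2 \<eta> t) (at t)" for t
    using has_vector_derivative_mult_right[OF has_vector_derivative_osc[OF \<eta>, of 1 t], of \<i>]
    by (simp add: numeral_2_eq_2 flip: mult.assoc)
  have c1: "continuous_on UNIV (\<lambda>t. \<i> * osc 1 \<eta> t)" and c2: "continuous_on UNIV (\<lambda>t. - osc 2 \<eta> t)"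
    by (intro continuous_intros continuous_on_osc \<eta>; simp)+
  show "(circle_profile \<eta> has_vector_derivative circle_profile' \<eta> x) (at x)"
    unfolding circle_profile_def[abs_def] circle_profile'_def
    by (rule has_vector_derivative_integral_affine[OF _ _ _ o0 c1]) (intro continuous_intros)+
  define U where "U x = integral ?B (\<lambda>\<phi>. of_real (cos \<phi>) * (of_real (cos \<phi>) * - osc 2 \<eta> (0 + x * cos \<phi>)))" for x
  have dU: "(circle_profile' \<eta> has_vector_derivative U x) (at x)" for x
  proof -
    have "((\<lambda>x. integral ?B (\<lambda>\<phi>. of_real (cos \<phi>) * (\<i> * osc 1 \<eta> (0 + x * cos \<phi>)))) has_vector_derivative U x) (at x)"
      unfolding U_def by (rule has_vector_derivative_integral_affine[OF _ _ _ o1 c2]) (intro continuous_intros)+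
    then show ?thesis by (simp add: circle_profile'_def[abs_def])
  qed
  then show "isCont (circle_profile' \<eta>) x" by (rule has_vector_derivative_continuous)
  have parts: "circle_profile' \<eta> x + of_real x * U x = - of_real x * integral ?B (\<lambda>\<phi>. 1 * osc 2 \<eta> (0 + x * cos \<phi>))"
  proof -
    let ?O = "\<lambda>\<phi>. osc 2 \<eta> (0 + x * cos \<phi>)"
    have "((\<lambda>\<phi>. of_real (sin \<phi>) * (\<i> * osc 1 \<eta> (0 + x * cos \<phi>))) has_vector_derivative
        of_real (sin \<phi>) * (of_real (x * - sin \<phi>) * - ?O \<phi>) + of_real (cos \<phi>) * (\<i> * osc 1 \<eta> (0 + x * cos \<phi>))) (at \<phi> within {0..2 * pi})" for \<phi>
    proof (rule has_vector_derivative_mult)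
      show "((\<lambda>\<phi>. complex_of_real (sin \<phi>)) has_vector_derivative of_real (cos \<phi>)) (at \<phi> within {0..2 * pi})"
        using DERIV_sin[of \<phi>] has_vector_derivative_at_within
        by (intro has_vector_derivative_of_real) (auto simp: has_real_derivative_iff_has_vector_derivative)
      show "((\<lambda>\<phi>. \<i> * osc 1 \<eta> (0 + x * cos \<phi>)) has_vector_derivative of_real (x * - sin \<phi>) * - ?O \<phi>) (at \<phi> within {0..2 * pi})"
        by (rule has_vector_derivative_compose_real[OF _ o1]) (auto intro!: derivative_eq_intros)
    qed
    then have "((\<lambda>\<phi>. of_real (sin \<phi>) * (of_real (x * - sin \<phi>) * - ?O \<phi>) + of_real (cos \<phi>) * (\<i> * osc 1 \<eta> (0 + x * cos \<phi>)))
       has_integral of_real (sin (2 * pi)) * (\<i> * osc 1 \<eta> (0 + x * cos (2 * pi))) - of_real (sin 0) * (\<i> * osc 1 \<eta> (0 + x * cos 0))) {0..2 * pi}"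
      by (intro fundamental_theorem_of_calculus) auto
    then have "((\<lambda>\<phi>. of_real (sin \<phi>) * (of_real (x * - sin \<phi>) * - ?O \<phi>) + of_real (cos \<phi>) * (\<i> * osc 1 \<eta> (0 + x * cos \<phi>)))
       has_integral 0) ?B" by (simp add: cbox_interval)
    moreover have "(\<lambda>\<phi>. of_real (cos \<phi>) * (of_real (cos \<phi>) * - ?O \<phi>)) integrable_on ?B"
      by (intro integrable_continuous continuous_on_mult continuous_on_of_real
          continuous_on_compose2[OF c2] continuous_intros) auto
    then have "((\<lambda>\<phi>. of_real x * (of_real (cos \<phi>) * (of_real (cos \<phi>) * - ?O \<phi>))) has_integral of_real x * U x) ?B"
      unfolding U_def by (intro has_integral_mult_right integrable_integral)
    moreover have "(\<lambda>\<phi>. 1 * ?O \<phi>) integrable_on ?B"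
      by (intro integrable_continuous continuous_on_mult continuous_on_const
          continuous_on_compose2[OF continuous_on_osc[OF \<eta>, of 2]] continuous_intros) auto
    then have "((\<lambda>\<phi>. of_real x * (1 * ?O \<phi>)) has_integral of_real x * integral ?B (\<lambda>\<phi>. 1 * ?O \<phi>)) ?B"
      by (intro has_integral_mult_right integrable_integral)
    ultimately have "((\<lambda>\<phi>. (of_real (sin \<phi>) * (of_real (x * - sin \<phi>) * - ?O \<phi>) + of_real (cos \<phi>) * (\<i> * osc 1 \<eta> (0 + x * cos \<phi>)))
        - of_real x * (of_real (cos \<phi>) * (of_real (cos \<phi>) * - ?O \<phi>)) - of_real x * (1 * ?O \<phi>))
       has_integral 0 - of_real x * U x - of_real x * integral ?B (\<lambda>\<phi>. 1 * ?O \<phi>)) ?B"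
      by (intro has_integral_diff)
    moreover have "(of_real (sin \<phi>) * (of_real (x * - sin \<phi>) * - ?O \<phi>) + of_real (cos \<phi>) * (\<i> * osc 1 \<eta> (0 + x * cos \<phi>)))
        - of_real x * (of_real (cos \<phi>) * (of_real (cos \<phi>) * - ?O \<phi>)) - of_real x * (1 * ?O \<phi>)
      = 1 * (of_real (cos \<phi>) * (\<i> * osc 1 \<eta> (0 + x * cos \<phi>)))" for \<phi>
    proof -
      have "complex_of_real ((sin \<phi>)\<^sup>2 + (cos \<phi>)\<^sup>2) = 1" by (simp only: sin_cos_squared_add of_real_1)
      then have sc: "complex_of_real (sin \<phi>) * of_real (sin \<phi>) + of_real (cos \<phi>) * of_real (cos \<phi>) = 1"
        by (simp add: power2_eq_square)
      have "(s * ((X * - s) * - Q) + R) - X * (c * (c * - Q)) - X * (1 * Q) = 1 * R" if "s * s + c * c = 1" for s c X Q R :: complex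
        using that by algebra
      from this[OF sc] show ?thesis by simp
    qed
    ultimately have "((\<lambda>\<phi>. 1 * (of_real (cos \<phi>) * (\<i> * osc 1 \<eta> (0 + x * cos \<phi>)))) has_integral
        0 - of_real x * U x - of_real x * integral ?B (\<lambda>\<phi>. 1 * ?O \<phi>)) ?B" by (simp only:)
    then have "circle_profile' \<eta> x = 0 - of_real x * U x - of_real x * integral ?B (\<lambda>\<phi>. 1 * ?O \<phi>)"
      unfolding circle_profile'_def by (rule integral_unique)
    then show ?thesis by simp
  qed
  have "((\<lambda>x. complex_of_real x) has_vector_derivative of_real 1) (at x)"
    by (intro has_vector_derivative_of_real) simp
  from has_vector_derivative_mult[OF this dU]
  have "((\<lambda>x. of_real x * circle_profile' \<eta> x) has_vector_derivative circle_profile' \<eta> x + of_real x * U x) (at x)"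
    by (simp add: add.commute)
  moreover have "circle_profile' \<eta> x + of_real x * U x = - of_real x * circle_profile \<eta> x - of_real (bessel_source \<eta> x)"
    unfolding parts circle_integral_osc_2[OF \<eta>] bessel_source_def by (simp add: algebra_simps)
  ultimately show "((\<lambda>x. of_real x * circle_profile' \<eta> x) has_vector_derivative
      - of_real x * circle_profile \<eta> x - of_real (bessel_source \<eta> x)) (at x)" by simp
qed

lemma tendsto_circle_profile:
  assumes "x > 0"
  shows "((\<lambda>\<eta>. circle_profile \<eta> x) \<longlongrightarrow> 2 * pi\<^sup>2 * (\<i> * J0 x - Y0 x)) (at_right 0)"
    and "((\<lambda>\<eta>. circle_profile' \<eta> x) \<longlongrightarrow> 2 * pi\<^sup>2 * (\<i> * J0' x - Y0' x)) (at_right 0)"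
proof -
  \<comment> \<open>At x = 0 the integrand is constant, and 2 / pi times the length 2 pi gives the
    factor 4. The term i pi of \<open>osc 0\<close> becomes 4 pi i.\<close>
  have "((\<lambda>\<eta>. 4 * (kern 0 (of_real \<eta>) + of_real (2 * ln \<eta>)) + (4 * pi * \<i> + of_real (8 * euler_mascheroni)))
      \<longlongrightarrow> 4 * of_real (- 2 * euler_mascheroni) + (4 * pi * \<i> + of_real (8 * euler_mascheroni))) (at_right 0)"
    by (intro tendsto_add tendsto_mult_left tendsto_const kern_0_at_0)
  then have init: "((\<lambda>\<eta>. of_real (2 / pi) * circle_profile \<eta> 0 + of_real (8 * ln \<eta> + 8 * euler_mascheroni)) \<longlongrightarrow> 4 * pi * \<i>) (at_right 0)"
    by (simp add: circle_profile_def osc_def scaleR_conv_of_real algebra_simps)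
  note b = bessel_limit[OF has_vector_derivative_circle_profile circle_profile_ode continuous_circle_profile' init assms]
  show "((\<lambda>\<eta>. circle_profile \<eta> x) \<longlongrightarrow> 2 * pi\<^sup>2 * (\<i> * J0 x - Y0 x)) (at_right 0)" by (rule b(1))
  show "((\<lambda>\<eta>. circle_profile' \<eta> x) \<longlongrightarrow> 2 * pi\<^sup>2 * (\<i> * J0' x - Y0' x)) (at_right 0)" by (rule b(2))
qed

lemma has_real_derivative_unscale:
  fixes f :: "real \<Rightarrow> real"
  assumes "((\<lambda>x. x * f x) has_real_derivative - x * g) (at x)" and x: "x > 0"
  shows "(f has_real_derivative - f x / x - g) (at x)"
proof -
  have "((\<lambda>x. x * f x / x) has_real_derivative ((- x * g) * x - x * f x * 1) / (x * x)) (at x)"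
    using assms by (intro DERIV_divide DERIV_ident) auto
  moreover have "((- x * g) * x - x * f x * 1) / (x * x) = - f x / x - g"
    using x by (simp add: field_simps)
  ultimately have "((\<lambda>x. x * f x / x) has_real_derivative - f x / x - g) (at x)" by (simp only:)
  then show ?thesis
    by (rule has_field_derivative_transform_within_open[where S = "{0<..}"]) (use x in auto)
qed

lemmas has_real_derivative_J0' = has_real_derivative_unscale[OF J0_ode]
lemmas has_real_derivative_Y0' = has_real_derivative_unscale[OF Y0_ode]

text \<open>The limit profile is 2 pi^2 i times the outgoing Hankel function J_0 + i Y_0, whereas
  the Green's function carries i / 4; hence the constant 1 / (8 pi^2).\<close>

lemma tendsto_shift_2:
  assumes \<kappa>: "\<kappa> > 0" and r: "r \<in> Rd 2" "r \<noteq> 0"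
  shows "((\<lambda>\<eta>. sphere_int 2 (\<lambda>k. of_real (transv_proj \<mu> k \<nu>) * osc 2 \<eta> (\<kappa> * (k \<bullet> r)))) \<longlongrightarrow>
      dyadic_green_contr 2 \<kappa> \<mu> r \<nu> / of_real (1 / (8 * pi\<^sup>2))) (at_right 0)"
proof -
  define L where "L x = 2 * pi\<^sup>2 * (\<i> * J0 x - Y0 x)" for x
  define L1 where "L1 x = 2 * pi\<^sup>2 * (\<i> * J0' x - Y0' x)" for x
  \<comment> \<open>The second derivative of the profile, obtained from
    \<open>circle_profile_ode\<close>; its last term is the source divided by x and vanishes in the
    limit for x > 0.\<close>
  define \<phi>2 where "\<phi>2 \<eta> x = - circle_profile' \<eta> x / of_real x - circle_profile \<eta> x
      - of_real (4 * pi * \<eta> / sqrt (\<eta>\<^sup>2 + x\<^sup>2) ^ 3)" for \<eta> x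
  have rv: "((\<lambda>x. complex_of_real (f x)) has_vector_derivative of_real f') (at x)" if "(f has_real_derivative f') (at x)" for f f' x
    using that by (intro has_vector_derivative_of_real) (simp add: has_real_derivative_iff_has_vector_derivative)
  have src: "((\<lambda>\<eta>. complex_of_real (4 * pi * \<eta> / sqrt (\<eta>\<^sup>2 + x\<^sup>2) ^ 3)) \<longlongrightarrow> of_real 0) (at_right 0)" if "x > 0" for x
    by (rule tendsto_of_real) (use that in real_asymp)
  have lims: "((\<lambda>\<eta>. circle_profile \<eta> x) \<longlongrightarrow> L x) (at_right 0)" "((\<lambda>\<eta>. circle_profile' \<eta> x) \<longlongrightarrow> L1 x) (at_right 0)"
    if "x > 0" for x
    unfolding L_def L1_def using that by (rule tendsto_circle_profile)+
  have h: "(osc 0 \<eta> has_vector_derivative \<i> * osc 1 \<eta> t) (at t)" "continuous_on UNIV (\<lambda>t. \<i> * osc 1 \<eta> t)"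
    "(osc 2 \<eta> has_vector_derivative \<i> * osc 3 \<eta> t) (at t)" "continuous_on UNIV (\<lambda>t. \<i> * osc 3 \<eta> t)"
    if "\<eta> > 0" for \<eta> t
    using has_vector_derivative_osc[OF that, of 0 t] has_vector_derivative_osc[OF that, of 2 t]
    by (auto intro!: continuous_intros continuous_on_osc that simp: numeral_3_eq_3)
  show ?thesis
  proof (rule tendsto_sphere_int_osc[where \<phi> = circle_profile and \<phi>' = circle_profile' and \<phi>'' = \<phi>2 and L = L and L' = L1
        and L'' = "\<lambda>x. - L1 x / of_real x - L x"])
    fix \<eta> x :: real assume \<eta>: "\<eta> > 0" and x: "x > 0"
    show "(circle_profile \<eta> has_vector_derivative circle_profile' \<eta> x) (at x)"
      by (rule has_vector_derivative_circle_profile[OF \<eta>])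
    have inv: "((\<lambda>x. complex_of_real (1 / x)) has_vector_derivative of_real (- (1 / x\<^sup>2))) (at x)"
      by (rule rv) (use x in \<open>auto intro!: derivative_eq_intros simp: power2_eq_square\<close>)
    have "((\<lambda>x. of_real (1 / x) * (of_real x * circle_profile' \<eta> x)) has_vector_derivative
        of_real (1 / x) * (- of_real x * circle_profile \<eta> x - of_real (bessel_source \<eta> x))
        + of_real (- (1 / x\<^sup>2)) * (of_real x * circle_profile' \<eta> x)) (at x)"
      by (rule has_vector_derivative_mult[OF inv circle_profile_ode[OF \<eta>]])
    also have "of_real (1 / x) * (- of_real x * circle_profile \<eta> x - of_real (bessel_source \<eta> x))
        + of_real (- (1 / x\<^sup>2)) * (of_real x * circle_profile' \<eta> x) = \<phi>2 \<eta> x"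
      using x by (simp add: \<phi>2_def bessel_source_def field_simps power2_eq_square)
    finally show "(circle_profile' \<eta> has_vector_derivative \<phi>2 \<eta> x) (at x)"
      by (rule has_vector_derivative_transform_within_open[where S = "{0<..}"]) (use x in auto)
  next
    fix \<eta> :: real and r :: "real^3" assume \<eta>: "\<eta> > 0" and r: "r \<in> Rd 2"
    show "sphere_int 2 (\<lambda>k. osc (2 - 2) \<eta> (\<kappa> * (k \<bullet> r))) = circle_profile \<eta> (\<kappa> * norm r)"
      using sphere_int_2_radial[OF h(1,2)[OF \<eta>] r] by (simp add: circle_profile_def)
  next
    fix x :: real assume x: "x > 0"
    show "(L has_vector_derivative L1 x) (at x)"
      unfolding L_def[abs_def] L1_def
      by (intro has_vector_derivative_mult_right has_vector_derivative_diff rv has_real_derivative_J0 has_real_derivative_Y0 x)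
    have "(L1 has_vector_derivative 2 * pi\<^sup>2 * (\<i> * of_real (- J0' x / x - J0 x) - of_real (- Y0' x / x - Y0 x))) (at x)"
      unfolding L1_def[abs_def]
      by (intro has_vector_derivative_mult_right has_vector_derivative_diff rv has_real_derivative_J0'[OF x] has_real_derivative_Y0'[OF x x])
    also have "2 * pi\<^sup>2 * (\<i> * of_real (- J0' x / x - J0 x) - of_real (- Y0' x / x - Y0 x)) = - L1 x / of_real x - L x"
      unfolding L1_def L_def using x by (simp add: field_simps)
    finally show "(L1 has_vector_derivative - L1 x / of_real x - L x) (at x)" .
    show "((\<lambda>\<eta>. circle_profile' \<eta> x) \<longlongrightarrow> L1 x) (at_right 0)" by (rule lims[OF x])
    have "((\<lambda>\<eta>. \<phi>2 \<eta> x) \<longlongrightarrow> - L1 x / of_real x - L x - of_real 0) (at_right 0)"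
      unfolding \<phi>2_def using x by (intro tendsto_diff tendsto_divide tendsto_minus tendsto_const lims src) auto
    then show "((\<lambda>\<eta>. \<phi>2 \<eta> x) \<longlongrightarrow> - L1 x / of_real x - L x) (at_right 0)" by simp
  next
    have x: "\<kappa> * norm r > 0" using \<kappa> r by simp
    have "((\<lambda>\<eta>. circle_profile \<eta> (\<kappa> * norm r) + of_real (4 * pi * \<eta> / sqrt (\<eta>\<^sup>2 + (\<kappa> * norm r)\<^sup>2) ^ 3)) \<longlongrightarrow>
        L (\<kappa> * norm r) + of_real 0) (at_right 0)"
      by (intro tendsto_add lims src x)
    moreover have "\<forall>\<^sub>F \<eta> in at_right 0. circle_profile \<eta> (\<kappa> * norm r) + of_real (4 * pi * \<eta> / sqrt (\<eta>\<^sup>2 + (\<kappa> * norm r)\<^sup>2) ^ 3)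
        = sphere_int 2 (\<lambda>k. osc 2 \<eta> (\<kappa> * (k \<bullet> r)))"
      using eventually_at_right_less[of 0]
      by eventually_elim (simp only: sphere_int_2_radial[OF h(3,4) r(1)] circle_integral_osc_2)
    ultimately have "((\<lambda>\<eta>. sphere_int 2 (\<lambda>k. osc 2 \<eta> (\<kappa> * (k \<bullet> r)))) \<longlongrightarrow> L (\<kappa> * norm r) + of_real 0) (at_right 0)"
      by (rule Lim_transform_eventually)
    then show "((\<lambda>\<eta>. sphere_int 2 (\<lambda>k. osc 2 \<eta> (\<kappa> * (k \<bullet> r)))) \<longlongrightarrow> L (\<kappa> * norm r)) (at_right 0)" by simp
  next
    fix r :: "real^3" assume r: "r \<noteq> 0"
    show "green 2 \<kappa> r = of_real (1 / (8 * pi\<^sup>2)) * L (\<kappa> * norm r)"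
      unfolding green_2[OF \<kappa> r] L_def by (simp add: field_simps)
  qed (use \<kappa> r in auto)
qed

text \<open>Because \<open>- \<i> * osc 0\<close> is a primitive of \<open>osc 1\<close>, the radial
  profile is elementary: a difference of \<open>osc 0\<close> at x and -x, divided by x. Its limit
  is 4 pi^2 exp(i x) / x, and comparison with exp(i \<kappa> |r|) / (4 pi |r|) gives the constant
  \<kappa> / (16 pi^3).\<close>

lemma tendsto_shift_3:
  assumes \<kappa>: "\<kappa> > 0" and r: "r \<in> Rd 3" "r \<noteq> 0"
  shows "((\<lambda>\<eta>. sphere_int 3 (\<lambda>k. of_real (transv_proj \<mu> k \<nu>) * osc 3 \<eta> (\<kappa> * (k \<bullet> r)))) \<longlongrightarrow>
      dyadic_green_contr 3 \<kappa> \<mu> r \<nu> / of_real (\<kappa> / (16 * pi ^ 3))) (at_right 0)"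
proof -
  \<comment> \<open>The azimuthal length 2 pi times the factor -i from the primitive of
    \<open>osc 1\<close>.\<close>
  define K where "K = - 2 * pi * \<i>"
  define D where "D \<eta> x = osc 0 \<eta> x - osc 0 \<eta> (- x)" for \<eta> x
  define D1 where "D1 \<eta> x = \<i> * osc 1 \<eta> x + \<i> * osc 1 \<eta> (- x)" for \<eta> x
  define D2 where "D2 \<eta> x = - osc 2 \<eta> x + osc 2 \<eta> (- x)" for \<eta> x
  define E where "E x = 2 * pi * \<i> * exp (\<i> * of_real x)" for x
  have rv: "((\<lambda>x. complex_of_real (f x)) has_vector_derivative of_real f') (at x)" if "(f has_real_derivative f') (at x)" for f f' x
    using that by (intro has_vector_derivative_of_real) (simp add: has_real_derivative_iff_has_vector_derivative)
  have h: "(osc 0 \<eta> has_vector_derivative \<i> * osc 1 \<eta> t) (at t)" "(osc 1 \<eta> has_vector_derivative \<i> * osc 2 \<eta> t) (at t)"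
    if "\<eta> > 0" for \<eta> t
    using has_vector_derivative_osc[OF that, of 0 t] has_vector_derivative_osc[OF that, of 1 t] by (auto simp: numeral_2_eq_2)
  have h': "((\<lambda>t. f (- t)) has_vector_derivative - f' (- x)) (at x)" if "\<And>t. (f has_vector_derivative f' t) (at t)"
    for f f' :: "real \<Rightarrow> complex" and x
    using has_vector_derivative_compose_real[of uminus "- 1" x f "f' (- x)" UNIV, OF DERIV_minus[OF DERIV_ident] that] by simp
  have quot: "((\<lambda>x. of_real (1 / x) * f x) has_vector_derivative of_real (1 / x) * f' + of_real (- (1 / x\<^sup>2)) * f x) (at x)"
    if "(f has_vector_derivative f') (at x)" "x > 0" for f :: "real \<Rightarrow> complex" and f' x
    by (intro has_vector_derivative_mult rv that) (use that in \<open>auto intro!: derivative_eq_intros simp: power2_eq_square\<close>)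
  have quot2: "((\<lambda>x. of_real (1 / x\<^sup>2) * f x) has_vector_derivative of_real (1 / x\<^sup>2) * f' + of_real (- (2 / x ^ 3)) * f x) (at x)"
    if "(f has_vector_derivative f') (at x)" "x > 0" for f :: "real \<Rightarrow> complex" and f' x
    by (intro has_vector_derivative_mult rv that)
      (use that in \<open>auto intro!: derivative_eq_intros simp: field_simps power2_eq_square power3_eq_cube\<close>)
  define \<Phi> where "\<Phi> f x = K * (of_real (1 / x) * f x)" for f x
  define \<Phi>1 where "\<Phi>1 f g x = K * (of_real (1 / x) * g x - of_real (1 / x\<^sup>2) * f x)" for f g x
  define \<Phi>2 where "\<Phi>2 f g k x = K * (of_real (1 / x) * k x - 2 * (of_real (1 / x\<^sup>2) * g x) + 2 * (of_real (1 / x ^ 3) * f x))" for f g k x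
  have d\<Phi>: "(\<Phi> f has_vector_derivative \<Phi>1 f g x) (at x)" if "\<And>x. (f has_vector_derivative g x) (at x)" "x > 0" for f g x
    unfolding \<Phi>_def[abs_def] \<Phi>1_def using quot[OF that] by (intro has_vector_derivative_mult_right) simp
  have d\<Phi>1: "(\<Phi>1 f g has_vector_derivative \<Phi>2 f g k x) (at x)"
    if "\<And>x. (f has_vector_derivative g x) (at x)" "\<And>x. (g has_vector_derivative k x) (at x)" "x > 0" for f g k x
  proof -
    have "((\<lambda>x. of_real (1 / x) * g x - of_real (1 / x\<^sup>2) * f x) has_vector_derivative
        (of_real (1 / x) * k x + of_real (- (1 / x\<^sup>2)) * g x) - (of_real (1 / x\<^sup>2) * g x + of_real (- (2 / x ^ 3)) * f x)) (at x)"
      by (intro has_vector_derivative_diff quot quot2 that)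
    then have "((\<lambda>x. of_real (1 / x) * g x - of_real (1 / x\<^sup>2) * f x) has_vector_derivative
        of_real (1 / x) * k x - 2 * (of_real (1 / x\<^sup>2) * g x) + 2 * (of_real (1 / x ^ 3) * f x)) (at x)"
      by (simp add: algebra_simps)
    then show ?thesis unfolding \<Phi>1_def[abs_def] \<Phi>2_def by (rule has_vector_derivative_mult_right)
  qed
  have dD: "(D \<eta> has_vector_derivative D1 \<eta> x) (at x)" if "\<eta> > 0" for \<eta> x
    unfolding D_def[abs_def] D1_def
    using has_vector_derivative_diff[OF h(1)[OF that] h'[OF h(1)[OF that]], of x] by simp
  have dD1: "(D1 \<eta> has_vector_derivative D2 \<eta> x) (at x)" if "\<eta> > 0" for \<eta> x
  proof -
    have o: "((\<lambda>t. \<i> * osc 1 \<eta> t) has_vector_derivative - osc 2 \<eta> t) (at t)" for t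
      using has_vector_derivative_mult_right[OF h(2)[OF that], of \<i>] by (simp flip: mult.assoc)
    show ?thesis unfolding D1_def[abs_def] D2_def
      using has_vector_derivative_add[OF o h'[OF o], of x] by simp
  qed
  have dE: "(E has_vector_derivative \<i> * E x) (at x)" "((\<lambda>x. \<i> * E x) has_vector_derivative - E x) (at x)" for x
  proof -
    have "((\<lambda>w. 2 * pi * \<i> * exp (\<i> * w)) has_field_derivative \<i> * (2 * pi * \<i> * exp (\<i> * of_real x))) (at (of_real x))"
      by (auto intro!: derivative_eq_intros)
    from has_vector_derivative_real_field[OF this]
    show 1: "(E has_vector_derivative \<i> * E x) (at x)" unfolding E_def[abs_def] .
    show "((\<lambda>x. \<i> * E x) has_vector_derivative - E x) (at x)"
      using has_vector_derivative_mult_right[OF 1, of \<i>] by (simp flip: mult.assoc)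
  qed
  have exps: "exp (\<i> * of_real x) = of_real (cos x) + \<i> * of_real (sin x)" for x
    by (simp add: cis_conv_exp[symmetric] cis.ctr complex_eq_iff)
  have lim0: "((\<lambda>\<eta>. D \<eta> x) \<longlongrightarrow> E x) (at_right 0)" if "x > 0" for x
  proof -
    have "((\<lambda>\<eta>. D \<eta> x) \<longlongrightarrow> (kern 0 (- \<i> * of_real x) + \<i> * pi * exp (\<i> * of_real x))
        - (kern 0 (- \<i> * of_real (- x)) + \<i> * pi * exp (\<i> * of_real (- x)))) (at_right 0)"
      unfolding D_def by (intro tendsto_diff tendsto_osc) (use that in auto)
    moreover have "(kern 0 (- \<i> * of_real x) + \<i> * pi * exp (\<i> * of_real x))
        - (kern 0 (- \<i> * of_real (- x)) + \<i> * pi * exp (\<i> * of_real (- x))) = E x"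
      using kern_0_imaginary[OF that] unfolding E_def exps by (simp add: algebra_simps cos_of_real)
    ultimately show ?thesis by simp
  qed
  have lim1: "((\<lambda>\<eta>. D1 \<eta> x) \<longlongrightarrow> \<i> * E x) (at_right 0)" if "x > 0" for x
  proof -
    have "((\<lambda>\<eta>. D1 \<eta> x) \<longlongrightarrow> \<i> * (kern 1 (- \<i> * of_real x) + \<i> * pi * exp (\<i> * of_real x))
        + \<i> * (kern 1 (- \<i> * of_real (- x)) + \<i> * pi * exp (\<i> * of_real (- x)))) (at_right 0)"
      unfolding D1_def
      by (rule tendsto_add[OF tendsto_mult_left[OF tendsto_osc] tendsto_mult_left[OF tendsto_osc]]) (use that in auto)
    moreover have "\<i> * (kern 1 (- \<i> * of_real x) + \<i> * pi * exp (\<i> * of_real x))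
        + \<i> * (kern 1 (- \<i> * of_real (- x)) + \<i> * pi * exp (\<i> * of_real (- x))) = \<i> * E x"
    proof -
      have "(kern 1 (- \<i> * of_real x) + \<i> * pi * exp (\<i> * of_real x))
        + (kern 1 (- \<i> * of_real (- x)) + \<i> * pi * exp (\<i> * of_real (- x))) = E x"
        using kern_1_imaginary[OF that] unfolding E_def exps by (simp add: algebra_simps complex_eq_iff)
      then show ?thesis by (simp only: distrib_left[symmetric])
    qed
    ultimately show ?thesis by simp
  qed
  \<comment> \<open>The end point values have equal limits, since i x and - i x have the same
    square.\<close>
  have inv2: "((\<lambda>\<eta>. 1 / (of_real \<eta> - \<i> * of_real x)\<^sup>2 - 1 / (of_real \<eta> - \<i> * of_real (- x))\<^sup>2) \<longlongrightarrow> 0) (at_right 0)"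
    if "x > 0" for x
  proof -
    have "((\<lambda>\<eta>. 1 / (of_real \<eta> - \<i> * of_real x)\<^sup>2 - 1 / (of_real \<eta> - \<i> * of_real (- x))\<^sup>2) \<longlongrightarrow>
        1 / (of_real 0 - \<i> * of_real x)\<^sup>2 - 1 / (of_real 0 - \<i> * of_real (- x))\<^sup>2) (at_right 0)"
      using that by (intro tendsto_intros) auto
    then show ?thesis by simp
  qed
  have lim2: "((\<lambda>\<eta>. D2 \<eta> x) \<longlongrightarrow> - E x) (at_right 0)" if "x > 0" for x
  proof -
    have "((\<lambda>\<eta>. - (D \<eta> x) - 2 * (1 / (of_real \<eta> - \<i> * of_real x)\<^sup>2 - 1 / (of_real \<eta> - \<i> * of_real (- x))\<^sup>2)) \<longlongrightarrow> - E x - 2 * 0) (at_right 0)"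
      by (intro tendsto_diff tendsto_minus tendsto_mult_left lim0 inv2 that)
    then show ?thesis by (simp add: D2_def D_def osc_2 algebra_simps)
  qed
  have radial: "sphere_int 3 (\<lambda>k. osc 1 \<eta> (\<kappa> * (k \<bullet> r))) = \<Phi> (D \<eta>) (\<kappa> * norm r)" if \<eta>: "\<eta> > 0" and r: "r \<noteq> 0" for \<eta> r
  proof -
    have H: "((\<lambda>t. - \<i> * osc 0 \<eta> t) has_vector_derivative osc 1 \<eta> t) (at t)" for t
      using has_vector_derivative_mult_right[OF h(1)[OF \<eta>], of "- \<i>"] by (simp flip: mult.assoc)
    have "continuous_on UNIV (\<lambda>t. \<i> * osc 2 \<eta> t)" by (intro continuous_intros continuous_on_osc \<eta>) simp
    from sphere_int_3_radial[OF H h(2)[OF \<eta>] this _ r, of \<kappa>] \<kappa>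
    have "sphere_int 3 (\<lambda>k. osc 1 \<eta> (\<kappa> * (k \<bullet> r))) = 2 * pi / (\<kappa> * norm r) *
        (- \<i> * osc 0 \<eta> (\<kappa> * norm r) - - \<i> * osc 0 \<eta> (- (\<kappa> * norm r)))" by simp
    then show ?thesis by (simp add: \<Phi>_def K_def D_def algebra_simps)
  qed
  show ?thesis
  proof (rule tendsto_sphere_int_osc[where \<phi> = "\<lambda>\<eta>. \<Phi> (D \<eta>)" and \<phi>' = "\<lambda>\<eta>. \<Phi>1 (D \<eta>) (D1 \<eta>)" and \<phi>'' = "\<lambda>\<eta>. \<Phi>2 (D \<eta>) (D1 \<eta>) (D2 \<eta>)"
        and L = "\<Phi> E" and L' = "\<Phi>1 E (\<lambda>x. \<i> * E x)" and L'' = "\<Phi>2 E (\<lambda>x. \<i> * E x) (\<lambda>x. - E x)"])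
    fix \<eta> x :: real assume \<eta>: "\<eta> > 0" and x: "x > 0"
    show "(\<Phi> (D \<eta>) has_vector_derivative \<Phi>1 (D \<eta>) (D1 \<eta>) x) (at x)" by (rule d\<Phi>[OF dD[OF \<eta>] x])
    show "(\<Phi>1 (D \<eta>) (D1 \<eta>) has_vector_derivative \<Phi>2 (D \<eta>) (D1 \<eta>) (D2 \<eta>) x) (at x)"
      by (rule d\<Phi>1[OF dD[OF \<eta>] dD1[OF \<eta>] x])
  next
    fix \<eta> :: real and r :: "real^3" assume "\<eta> > 0" "r \<noteq> 0"
    then show "sphere_int 3 (\<lambda>k. osc (3 - 2) \<eta> (\<kappa> * (k \<bullet> r))) = \<Phi> (D \<eta>) (\<kappa> * norm r)"
      using radial by simp
  next
    fix x :: real assume x: "x > 0"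
    show "(\<Phi> E has_vector_derivative \<Phi>1 E (\<lambda>x. \<i> * E x) x) (at x)" by (rule d\<Phi>[OF dE(1) x])
    show "(\<Phi>1 E (\<lambda>x. \<i> * E x) has_vector_derivative \<Phi>2 E (\<lambda>x. \<i> * E x) (\<lambda>x. - E x) x) (at x)"
      by (rule d\<Phi>1[OF dE x])
    show "((\<lambda>\<eta>. \<Phi>1 (D \<eta>) (D1 \<eta>) x) \<longlongrightarrow> \<Phi>1 E (\<lambda>x. \<i> * E x) x) (at_right 0)"
      unfolding \<Phi>1_def by (intro tendsto_mult_left tendsto_diff lim0 lim1 x)
    show "((\<lambda>\<eta>. \<Phi>2 (D \<eta>) (D1 \<eta>) (D2 \<eta>) x) \<longlongrightarrow> \<Phi>2 E (\<lambda>x. \<i> * E x) (\<lambda>x. - E x) x) (at_right 0)"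
      unfolding \<Phi>2_def by (intro tendsto_mult_left tendsto_add tendsto_diff lim0 lim1 lim2 x)
  next
    let ?x = "\<kappa> * norm r"
    have x: "?x > 0" using \<kappa> r by simp
    \<comment> \<open>The remainder \<open>kern 3 - kern 1\<close>. It becomes singular for k
      orthogonal to r, but its spherical integral is the difference treated in \<open>inv2\<close>
      and tends to 0.\<close>
    let ?p = "\<lambda>\<eta> t. 4 / (of_real \<eta> - \<i> * of_real t) ^ 3"
    have p: "sphere_int 3 (\<lambda>k. ?p \<eta> (\<kappa> * (k \<bullet> r))) = 2 * pi / ?x * (- 2 * \<i> *
        (1 / (of_real \<eta> - \<i> * of_real ?x)\<^sup>2 - 1 / (of_real \<eta> - \<i> * of_real (- ?x))\<^sup>2))" if \<eta>: "\<eta> > 0" for \<eta>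
    proof -
      have H: "((\<lambda>t. - 2 * \<i> / (of_real \<eta> - \<i> * of_real t) ^ 2) has_vector_derivative ?p \<eta> t) (at t)" for t
        using has_vector_derivative_inverse_power_line[OF \<eta>, of "- 2 * \<i>" 2 t] by (simp add: numeral_3_eq_3 numeral_2_eq_2 algebra_simps)
      have h: "(?p \<eta> has_vector_derivative of_nat 3 * \<i> * 4 / (of_real \<eta> - \<i> * of_real t) ^ Suc 3) (at t)" for t
        by (rule has_vector_derivative_inverse_power_line[OF \<eta>])
      have "\<kappa> \<noteq> 0" using \<kappa> by simp
      from sphere_int_3_radial[OF H h continuous_on_inverse_power_line[OF \<eta>] this r(2)]
      show ?thesis by (simp add: right_diff_distrib)
    qed
    have "((\<lambda>\<eta>. \<Phi> (D \<eta>) ?x + 2 * pi / ?x * (- 2 * \<i> *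
        (1 / (of_real \<eta> - \<i> * of_real ?x)\<^sup>2 - 1 / (of_real \<eta> - \<i> * of_real (- ?x))\<^sup>2))) \<longlongrightarrow>
        \<Phi> E ?x + 2 * pi / ?x * (- 2 * \<i> * 0)) (at_right 0)"
      unfolding \<Phi>_def by (intro tendsto_add tendsto_mult_left lim0 inv2 x)
    moreover have "\<forall>\<^sub>F \<eta> in at_right 0. \<Phi> (D \<eta>) ?x + 2 * pi / ?x * (- 2 * \<i> *
        (1 / (of_real \<eta> - \<i> * of_real ?x)\<^sup>2 - 1 / (of_real \<eta> - \<i> * of_real (- ?x))\<^sup>2))
        = sphere_int 3 (\<lambda>k. osc 3 \<eta> (\<kappa> * (k \<bullet> r)))"
      using eventually_at_right_less[of 0]
    proof eventually_elim
      case (elim \<eta>)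
      have "sphere_int 3 (\<lambda>k. osc 3 \<eta> (\<kappa> * (k \<bullet> r))) = sphere_int 3 (\<lambda>k. osc 1 \<eta> (\<kappa> * (k \<bullet> r)) + ?p \<eta> (\<kappa> * (k \<bullet> r)))"
        by (simp add: osc_def kern_3 algebra_simps)
      also have "\<dots> = sphere_int 3 (\<lambda>k. osc 1 \<eta> (\<kappa> * (k \<bullet> r))) + sphere_int 3 (\<lambda>k. ?p \<eta> (\<kappa> * (k \<bullet> r)))"
        by (rule sphere_int_add)
          (use elim in \<open>simp_all only: continuous_on_ridge[OF continuous_on_osc] continuous_on_ridge[OF continuous_on_inverse_power_line] insert_iff, simp_all\<close>)
      finally show ?case unfolding radial[OF elim r(2)] p[OF elim] ..
    qed
    ultimately have "((\<lambda>\<eta>. sphere_int 3 (\<lambda>k. osc 3 \<eta> (\<kappa> * (k \<bullet> r)))) \<longlongrightarrow> \<Phi> E ?x + 2 * pi / ?x * (- 2 * \<i> * 0)) (at_right 0)"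
      by (rule Lim_transform_eventually)
    then show "((\<lambda>\<eta>. sphere_int 3 (\<lambda>k. osc 3 \<eta> (\<kappa> * (k \<bullet> r)))) \<longlongrightarrow> \<Phi> E ?x) (at_right 0)" by simp
  next
    fix r :: "real^3" assume r: "r \<noteq> 0"
    show "green 3 \<kappa> r = of_real (\<kappa> / (16 * pi ^ 3)) * \<Phi> E (\<kappa> * norm r)"
      unfolding green_3[OF \<kappa> r] \<Phi>_def E_def K_def using \<kappa> by (simp add: field_simps power3_eq_cube)
  qed (use \<kappa> r in auto)
qed

text \<open>On the line k \<bullet> r is never 0, so the limit is taken separately at the two
  directions, which share the projector value \<open>P\<close>. In the Green's dyadic the second
  derivative of the wave is -\<kappa>^2 times the wave; the component along the line drops out and
  the same \<open>P\<close> remains.\<close>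

lemma tendsto_shift_1:
  assumes \<kappa>: "\<kappa> > 0" and r: "r \<in> Rd 1" "r \<noteq> 0"
  shows "((\<lambda>\<eta>. sphere_int 1 (\<lambda>k. of_real (transv_proj \<mu> k \<nu>) * osc 1 \<eta> (\<kappa> * (k \<bullet> r)))) \<longlongrightarrow>
      dyadic_green_contr 1 \<kappa> \<mu> r \<nu> / of_real (1 / (4 * pi * \<kappa>))) (at_right 0)"
proof -
  define P where "P = \<mu> \<bullet> \<nu> - \<mu> $ 1 * \<nu> $ 1"
  define X where "X = \<kappa> * r $ 1"
  define x where "x = \<kappa> * norm r"
  have x: "x > 0" using \<kappa> r by (simp add: x_def)
  have r23: "r $ 2 = 0" "r $ 3 = 0" using r by (auto simp: Rd_def dim_idx_def)
  have n: "norm r = \<bar>r $ 1\<bar>" by (simp add: norm_eq_sqrt_inner inner_3 r23)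
  have r1: "r $ 1 \<noteq> 0" using n r by auto
  have X: "X = x \<or> X = - x" by (auto simp: X_def x_def n abs_if)
  have "transv_proj \<mu> (axis 1 1) \<nu> = P" "transv_proj \<mu> (- axis 1 1) \<nu> = P"
    by (simp_all add: P_def transv_proj_def inner_axis inner_axis')
  then have "sphere_int 1 (\<lambda>k. of_real (transv_proj \<mu> k \<nu>) * osc 1 \<eta> (\<kappa> * (k \<bullet> r))) = of_real P * (osc 1 \<eta> X + osc 1 \<eta> (- X))" for \<eta>
    unfolding sphere_int_1 by (simp add: X_def inner_axis' distrib_left)
  then have si: "sphere_int 1 (\<lambda>k. of_real (transv_proj \<mu> k \<nu>) * osc 1 \<eta> (\<kappa> * (k \<bullet> r))) = of_real P * (osc 1 \<eta> x + osc 1 \<eta> (- x))" for \<eta>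
    using X by auto
  have "((\<lambda>\<eta>. of_real P * (osc 1 \<eta> x + osc 1 \<eta> (- x))) \<longlongrightarrow>
     of_real P * ((kern 1 (- \<i> * of_real x) + \<i> * pi * exp (\<i> * of_real x))
       + (kern 1 (- \<i> * of_real (- x)) + \<i> * pi * exp (\<i> * of_real (- x))))) (at_right 0)"
    by (intro tendsto_mult_left tendsto_add tendsto_osc) (use x in auto)
  also have "(kern 1 (- \<i> * of_real x) + \<i> * pi * exp (\<i> * of_real x))
       + (kern 1 (- \<i> * of_real (- x)) + \<i> * pi * exp (\<i> * of_real (- x))) = 2 * pi * \<i> * exp (\<i> * of_real x)"
  proof -
    have exps: "exp (\<i> * of_real x) = of_real (cos x) + \<i> * of_real (sin x)" for x
      by (simp add: cis_conv_exp[symmetric] cis.ctr complex_eq_iff)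
    show ?thesis
      using kern_1_imaginary[OF x] unfolding exps by (simp add: algebra_simps complex_eq_iff)
  qed
  also have "of_real P * (2 * pi * \<i> * exp (\<i> * of_real x)) = dyadic_green_contr 1 \<kappa> \<mu> r \<nu> / of_real (1 / (4 * pi * \<kappa>))"
  proof -
    define g where "g t = \<i> / (2 * \<kappa>) * exp (\<i> * (\<kappa> * t))" for t
    define g1 where "g1 t = \<i> / (2 * \<kappa>) * (\<i> * \<kappa> * exp (\<i> * (\<kappa> * t)))" for t
    have dg: "(g has_vector_derivative g1 t) (at t)" for t
    proof -
      have "((\<lambda>w. \<i> / (2 * \<kappa>) * exp (\<i> * (\<kappa> * w))) has_field_derivative \<i> / (2 * \<kappa>) * (\<i> * \<kappa> * exp (\<i> * (\<kappa> * of_real t)))) (at (of_real t))"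
        by (rule DERIV_cmult) (auto intro!: derivative_eq_intros)
      from has_vector_derivative_real_field[OF this] show ?thesis by (simp add: g_def[abs_def] g1_def)
    qed
    have g1: "g1 t = \<i> * \<kappa> * g t" for t by (simp add: g1_def g_def)
    have dg1: "(g1 has_vector_derivative - of_real (\<kappa>\<^sup>2) * g t) (at t)" for t
    proof -
      have "(\<i> * \<kappa>) * ((\<i> * \<kappa>) * y) = - of_real (\<kappa>\<^sup>2) * y" for y
        by (simp add: power2_eq_square ac_simps)
      with has_vector_derivative_mult_right[OF dg, of "\<i> * \<kappa>" t] show ?thesis
        unfolding g1[abs_def] by (simp only: g1)
    qed
    have idx: "dim_idx 1 = {1}" by (simp add: dim_idx_def)
    have "pdiff 1 (pdiff 1 (green 1 \<kappa>)) r = radial_hessian r 1 1 (g1 (norm r)) (- of_real (\<kappa>\<^sup>2) * g (norm r))"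
      by (rule pdiff_pdiff_radial[OF _ dg dg1 r]) (use green_1[OF \<kappa>] in \<open>simp_all add: g_def dim_idx_def\<close>)
    also have "\<dots> = of_real (r $ 1 * r $ 1 / (norm r)\<^sup>2) * (- of_real (\<kappa>\<^sup>2) * g (norm r))
        + of_real ((if (1::3) = 1 then 1 else 0) / norm r - r $ 1 * r $ 1 / norm r ^ 3) * g1 (norm r)"
      by (rule radial_hessian_def)
    also have "r $ 1 * r $ 1 / (norm r)\<^sup>2 = 1" unfolding n using r1 by (simp add: power2_eq_square)
    also have "(if (1::3) = 1 then 1 else 0) / norm r - r $ 1 * r $ 1 / norm r ^ 3 = 0"
      unfolding n using r1 by (simp add: power3_eq_cube)
    finally have "pdiff 1 (pdiff 1 (green 1 \<kappa>)) r = - of_real (\<kappa>\<^sup>2) * g (norm r)" by simp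
    moreover have "green 1 \<kappa> r = g (norm r)" using green_1[OF \<kappa> r(2)] by (simp add: g_def)
    ultimately have "dyadic_green_contr 1 \<kappa> \<mu> r \<nu> = of_real P * g (norm r)"
      using \<kappa> unfolding dyadic_green_contr_def idx by (simp add: P_def left_diff_distrib)
    then show ?thesis using \<kappa> by (simp add: g_def x_def field_simps)
  qed
  finally show ?thesis unfolding si .
qed

theorem theorem2:
  fixes d :: nat and c w0 :: real and \<mu>i \<mu>j r :: "real^3"
  assumes "d \<in> {1, 2, 3}" and "c > 0" and "w0 > 0"
    and "r \<in> Rd d" and "r \<noteq> 0"
  shows "((\<lambda>\<epsilon>. - omega_reg d c w0 \<mu>i \<mu>j r \<epsilon> + (\<i> / 2) * gamma_ij d c w0 \<mu>i \<mu>j r)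
           \<longlongrightarrow> 4 * pi * (w0 / c)\<^sup>2 * dyadic_green_contr d (w0 / c) \<mu>i r \<mu>j) (at_right 0)"
proof -
  define \<kappa> where "\<kappa> = w0 / c"
  have \<kappa>: "\<kappa> > 0" using assms by (simp add: \<kappa>_def)
  let ?S = "\<lambda>\<eta>. sphere_int d (\<lambda>k. of_real (transv_proj \<mu>i k \<mu>j) * osc d \<eta> (\<kappa> * (k \<bullet> r)))"
  let ?G = "dyadic_green_contr d \<kappa> \<mu>i r \<mu>j"
  \<comment> \<open>The prefactor \<open>\<kappa> ^ d / (2 * pi) ^ (d - 1)\<close> divided by the
    constants 1 / (4 pi \<kappa>), 1 / (8 pi^2) and \<kappa> / (16 pi^3) of the three cases is 4 pi
    \<kappa>^2 each time.\<close>
  have lim: "((\<lambda>\<eta>. of_real (\<kappa> ^ d / (2 * pi) ^ (d - 1)) * ?S \<eta>) \<longlongrightarrow> 4 * pi * \<kappa>\<^sup>2 * ?G) (at_right 0)"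
  proof -
    from assms(1) consider "d = 1" | "d = 2" | "d = 3" by auto
    then show ?thesis
    proof cases
      case 1
      have "((\<lambda>\<eta>. of_real (\<kappa> ^ 1 / (2 * pi) ^ (1 - 1)) * ?S \<eta>) \<longlongrightarrow>
          of_real (\<kappa> ^ 1 / (2 * pi) ^ (1 - 1)) * (?G / of_real (1 / (4 * pi * \<kappa>)))) (at_right 0)"
        using tendsto_shift_1[OF \<kappa>] assms unfolding 1 by (intro tendsto_mult_left) simp
      then show ?thesis using \<kappa> unfolding 1 by (simp add: power2_eq_square ac_simps)
    next
      case 2
      have "((\<lambda>\<eta>. of_real (\<kappa> ^ 2 / (2 * pi) ^ (2 - 1)) * ?S \<eta>) \<longlongrightarrow>
          of_real (\<kappa> ^ 2 / (2 * pi) ^ (2 - 1)) * (?G / of_real (1 / (8 * pi\<^sup>2)))) (at_right 0)"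
        using tendsto_shift_2[OF \<kappa>] assms unfolding 2 by (intro tendsto_mult_left) simp
      also have "of_real (\<kappa> ^ 2 / (2 * pi) ^ (2 - 1)) * (?G / of_real (1 / (8 * pi\<^sup>2))) = 4 * pi * \<kappa>\<^sup>2 * ?G"
        by (simp add: power2_eq_square field_simps)
      finally show ?thesis unfolding 2 .
    next
      case 3
      have "((\<lambda>\<eta>. of_real (\<kappa> ^ 3 / (2 * pi) ^ (3 - 1)) * ?S \<eta>) \<longlongrightarrow>
          of_real (\<kappa> ^ 3 / (2 * pi) ^ (3 - 1)) * (?G / of_real (\<kappa> / (16 * pi ^ 3)))) (at_right 0)"
        using tendsto_shift_3[OF \<kappa>] assms unfolding 3 by (intro tendsto_mult_left) simp
      also have "of_real (\<kappa> ^ 3 / (2 * pi) ^ (3 - 1)) * (?G / of_real (\<kappa> / (16 * pi ^ 3))) = 4 * pi * \<kappa>\<^sup>2 * ?G"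
        using \<kappa> by (simp add: power2_eq_square power3_eq_cube field_simps)
      finally show ?thesis unfolding 3 .
    qed
  qed
  \<comment> \<open>The limit is known in terms of \<eta> = w0 \<epsilon>; since w0 > 0, this
    variable also approaches 0 from the right.\<close>
  have "filterlim (\<lambda>\<epsilon>. w0 * \<epsilon>) (at_right 0) (at_right 0)"
    using assms(3) by real_asymp
  from filterlim_compose[OF lim this]
  have "((\<lambda>\<epsilon>. of_real (\<kappa> ^ d / (2 * pi) ^ (d - 1)) * ?S (w0 * \<epsilon>)) \<longlongrightarrow> 4 * pi * \<kappa>\<^sup>2 * ?G) (at_right 0)" .
  moreover have "\<forall>\<^sub>F \<epsilon> in at_right 0. of_real (\<kappa> ^ d / (2 * pi) ^ (d - 1)) * ?S (w0 * \<epsilon>)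
      = - omega_reg d c w0 \<mu>i \<mu>j r \<epsilon> + (\<i> / 2) * gamma_ij d c w0 \<mu>i \<mu>j r"
    using eventually_at_right_less[of 0]
    by eventually_elim (simp only: shift_eq_sphere_int_osc[OF assms(1-3)] \<kappa>_def)
  ultimately show ?thesis unfolding \<kappa>_def by (rule Lim_transform_eventually)
qed

end
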